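(* Assume that the non-stationary scheme $\{S_{\mathbf a^{[k]}},\ k\ge0\}$ is $\Phi_N$-reproducing and is asymptotically similar to a convergent stationary scheme $\{S_{\mathbf a}\}$. Assume further that the initial data are of the form $\mathbf f^{[m]}=\{f^{[m]}_i=f(2^{-m}i),\ i\in\mathbb Z\}$ for some fixed $m\ge0$ and for some function $f\in W^\gamma_\infty(\mathbb R)$, where $\gamma\in\mathbb N$, $\gamma\le N$. If the Wronskian matrix $\mathcal W_{\Phi_\gamma}(0)$ of $\Phi_\gamma\subseteq\Phi_N$ is invertible, then $$\|g_{\mathbf f^{[m]}}-f\|_{L_\infty(\mathbb R)}\le C_f\,2^{-\gamma m},\qquad m\ge0,$$ with a constant $C_f>0$ depending only on $f$.
   Context: Subdivision schemes. For each $k\ge 0$ let $\mathbf a^{[k]}=\{a^{[k]}_i\in\mathbb R,\ i\in\mathbb Z\}$ be a mask; all masks are supported in $\{-M,\dots,M\}$ for one fixed $M\in\mathbb N$. The subdivision operator is $(S_{\mathbf a^{[k]}}\mathbf f)_i=\sum_{j\in\mathbb Z}a^{[k]}_{i-2j}f_j$, $i\in\mathbb Z$. The (non-stationary) scheme $\{S_{\mathbf a^{[k]}},k\ge0\}$ is called stationary, written $\{S_{\mathbf a}\}$, if all its operators coincide. The scheme is convergent if for every $\mathbf f^{[0]}\in\ell_\infty(\mathbb Z)$ there is a continuous function $g$ on $\mathbb R$ (the limit, written $\lim_{k\to\infty}S_{\mathbf a^{[k]}}\cdots S_{\mathbf a^{[0]}}\mathbf f^{[0]}$) with $\lim_{k\to\infty}\sup_{i\in\mathbb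 Z}|g(i2^{-k})-(S_{\mathbf a^{[k-1]}}\cdots S_{\mathbf a^{[0]}}\mathbf f^{[0]})_i|=0$. (For unbounded data, such as samples of exponential polynomials, the limit is understood locally, which makes sense because the masks are finitely supported.) Limit from level $m$. The basic limit functions are $\phi_m=\lim_{\ell\to\infty}S_{\mathbf a^{[m+\ell]}}\cdots S_{\mathbf a^{[m]}}\boldsymbol\delta$, $m\ge0$, with $\boldsymbol\delta=\{\delta_{i,0},\ i\in\mathbb Z\}$. $g_{\mathbf f^{[m]}}$ is the limit of the subdivision scheme obtained from the initial data $\mathbf f^{[m]}$, i.e. $g_{\mathbf f^{[m]}}(u)=\sum_{i\in\mathbb Z}f_i^{[m]}\phi_m(2^mu-i)$, $u\in\mathbb R$. Exponential polynomials. Let $\eta,N\in\mathbb N$, $\lambda_1,\dots,\lambda_\eta\in\mathbb C$, and $\mu_1,\dots,\mu_\eta\in\mathbb N$ with $\sum_{n=1}^\eta\mu_n=N$. $\Phi_N=\mathrm{span}\{x^\beta e^{\lambda_n x}:\beta=0,\dots,\mu_n-1,\ n=1,\dots,\eta\}$, spanned by $N$ linearly independent functions; these are listed as $\varphi_0,\dots,\varphi_{N-1}$. For $\gamma\le N$, $\Phi_\gamma$ is the space spanned by $\varphi_0,\dots,\varphi_{\gamma-1}$, and $\mathcal W_{\Phi_\gamma}(x)=\left(\frac1{\beta!}\frac{d^\beta\varphi_\alpha(x)}{dx^\beta}\right)_{\alpha,\beta=0,\dots,\gamma-1}$. Parametrization. Level-$k$ data are attached to the grid points $t_i^{[k]}=(i+p)/2^k$,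 $i\in\mathbb Z$, with shift parameter $p=-\nu/2$, $\nu\in\{0,1\}$ (primal scheme if $\nu=0$, dual scheme if $\nu=1$). Reproduction. A convergent scheme is $\Phi_N$-reproducing if for every $f\in\Phi_N$ and initial data $\mathbf f^{[0]}=\{f(t_i^{[0]}),\ i\in\mathbb Z\}$ one has $\lim_{k\to\infty}S_{\mathbf a^{[k]}}S_{\mathbf a^{[k-1]}}\cdots S_{\mathbf a^{[0]}}\mathbf f^{[0]}=f$. Asymptotical similarity of $\{S_{\mathbf a^{[k]}},k\ge0\}$ and $\{S_{\mathbf a}\}$: $\lim_{k\to\infty}\|\mathbf a^{[k]}-\mathbf a\|=0$, where $\|\cdot\|$ is the supremum norm of sequences and the mask $\mathbf a$ is also supported in $\{-M,\dots,M\}$. $W^\gamma_\infty(\mathbb R)$ is the Sobolev space of all $f\in L_\infty(\mathbb R)$ with $\frac{d^\ell f}{du^\ell}\in L_\infty(\mathbb R)$ for all $0\le\ell\le\gamma$.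
   Formalization: Reproduction is assumed from every starting level m, not only level 0 (else false). For dual schemes with γ≥2 data f(2^{-m}i) give only order 1, so the bound for those data is claimed for primal schemes or γ=1; for data f(t_i^{[m]}) it holds in all cases. *)

theory Defs
  imports
    "HOL-Analysis.Analysis"
    "HOL-Probability.Essential_Supremum"
    "Jordan_Normal_Form.Matrix"
begin

section \<open>Subdivision schemes\<close>

text \<open>Masks are real. Data are polymorphic because bounded data are real, whereas samples of
  exponential polynomials are complex. All series over the integers below have finitely many
  nonzero terms, since masks are finitely supported.\<close>

definition mask_supported :: "nat \<Rightarrow> (int \<Rightarrow> real) \<Rightarrow> bool" where
  "mask_supported M a \<longleftrightarrow> (\<forall>i. a i \<noteq> 0 \<longrightarrow> i \<in> {- int M..int M})"

definition subdiv :: "(int \<Rightarrow> real) \<Rightarrow> (int \<Rightarrow> 'b::real_normed_vector) \<Rightarrow> int \<Rightarrow> 'b" where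
  "subdiv a f i = (\<Sum>\<^sub>\<infinity>j. a (i - 2 * j) *\<^sub>R f j)"

text \<open>\<open>subdiv_iter a m k f\<close> applies the \<open>k\<close> operators with masks \<open>a m, \<dots>, a (m + k - 1)\<close>,
  in this order, to \<open>f\<close>.\<close>

primrec subdiv_iter ::
    "(nat \<Rightarrow> int \<Rightarrow> real) \<Rightarrow> nat \<Rightarrow> nat \<Rightarrow> (int \<Rightarrow> 'b::real_normed_vector) \<Rightarrow> int \<Rightarrow> 'b" where
  "subdiv_iter a m 0 f = f"
| "subdiv_iter a m (Suc k) f = subdiv (a (m + k)) (subdiv_iter a m k f)"

text \<open>The limit of the scheme started at level \<open>m\<close>, in the coordinate in which the data started
  from have grid spacing 1.\<close>

definition is_subdiv_limit ::
    "(nat \<Rightarrow> int \<Rightarrow> real) \<Rightarrow> nat \<Rightarrow> (int \<Rightarrow> 'b::real_normed_vector) \<Rightarrow> (real \<Rightarrow> 'b) \<Rightarrow> bool" where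
  "is_subdiv_limit a m f g \<longleftrightarrow> continuous_on UNIV g \<and>
     (\<lambda>k. SUP i. ereal (norm (g (real_of_int i / 2 ^ k) - subdiv_iter a m k f i))) \<longlonglongrightarrow> 0"

definition is_local_subdiv_limit ::
    "(nat \<Rightarrow> int \<Rightarrow> real) \<Rightarrow> nat \<Rightarrow> (int \<Rightarrow> 'b::real_normed_vector) \<Rightarrow> (real \<Rightarrow> 'b) \<Rightarrow> bool" where
  "is_local_subdiv_limit a m f g \<longleftrightarrow> continuous_on UNIV g \<and>
     (\<forall>R>0. (\<lambda>k. SUP i\<in>{i. \<bar>real_of_int i / 2 ^ k\<bar> \<le> R}.
        ereal (norm (g (real_of_int i / 2 ^ k) - subdiv_iter a m k f i))) \<longlonglongrightarrow> 0)"

definition convergent_scheme :: "(nat \<Rightarrow> int \<Rightarrow> real) \<Rightarrow> bool" where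
  "convergent_scheme a \<longleftrightarrow>
     (\<forall>f :: int \<Rightarrow> real. bounded (range f) \<longrightarrow> (\<exists>g. is_subdiv_limit a 0 f g))"

definition basic_limit :: "(nat \<Rightarrow> int \<Rightarrow> real) \<Rightarrow> nat \<Rightarrow> real \<Rightarrow> real" where
  "basic_limit a m = (THE \<phi>. is_subdiv_limit a m (\<lambda>i. if i = 0 then 1 else 0) \<phi>)"

definition limit_from_level ::
    "(nat \<Rightarrow> int \<Rightarrow> real) \<Rightarrow> nat \<Rightarrow> (int \<Rightarrow> 'b::real_normed_vector) \<Rightarrow> real \<Rightarrow> 'b" where
  "limit_from_level a m f u = (\<Sum>\<^sub>\<infinity>i. basic_limit a m (2 ^ m * u - real_of_int i) *\<^sub>R f i)"

definition asymptotically_similar :: "(nat \<Rightarrow> int \<Rightarrow> real) \<Rightarrow> (int \<Rightarrow> real) \<Rightarrow> bool" where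
  "asymptotically_similar a b \<longleftrightarrow> (\<lambda>k. SUP i. ereal \<bar>a k i - b i\<bar>) \<longlonglongrightarrow> 0"


section \<open>Exponential polynomials and their reproduction\<close>

definition exp_monomial :: "complex \<Rightarrow> nat \<Rightarrow> real \<Rightarrow> complex" where
  "exp_monomial l \<beta> x = of_real x ^ \<beta> * exp (l * of_real x)"

definition exp_monomials :: "nat \<Rightarrow> (nat \<Rightarrow> complex) \<Rightarrow> (nat \<Rightarrow> nat) \<Rightarrow> (real \<Rightarrow> complex) set" where
  "exp_monomials \<eta> lam \<mu> = {exp_monomial (lam n) \<beta> | n \<beta>. n \<in> {1..\<eta>} \<and> \<beta> < \<mu> n}"

definition exp_poly_space :: "nat \<Rightarrow> (nat \<Rightarrow> complex) \<Rightarrow> (nat \<Rightarrow> nat) \<Rightarrow> (real \<Rightarrow> complex) set" where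
  "exp_poly_space \<eta> lam \<mu> =
     {\<lambda>x. \<Sum>n=1..\<eta>. \<Sum>\<beta><\<mu> n. c n \<beta> * exp_monomial (lam n) \<beta> x | c. True}"

definition wronskian_mat :: "nat \<Rightarrow> (nat \<Rightarrow> real \<Rightarrow> complex) \<Rightarrow> real \<Rightarrow> complex mat" where
  "wronskian_mat \<gamma> \<phi> x = Matrix.mat \<gamma> \<gamma> (\<lambda>(\<alpha>, \<beta>).
     ((\<lambda>g y. vector_derivative g (at y)) ^^ \<beta>) (\<phi> \<alpha>) x / fact \<beta>)"

definition grid :: "nat \<Rightarrow> nat \<Rightarrow> int \<Rightarrow> real" where
  "grid \<nu> k i = (real_of_int i - real \<nu> / 2) / 2 ^ k"

text \<open>Reproduction is required from every starting level \<open>m\<close>, not only from \<open>m = 0\<close>: a change of the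
  single mask \<open>a 0\<close> can restore reproduction from level 0 for a scheme whose later operators do
  not reproduce, so level 0 says nothing about \<open>limit_from_level a m\<close> for \<open>m > 0\<close>. For instance,
  take cubic B-spline masks at all levels \<open>k > 0\<close>, and at level 0 the cubic B-spline operator
  composed with the quasi-interpolation prefilter \<open>(-1/6, 4/3, -1/6)\<close>.

  The limit is rescaled by \<open>2 ^ m\<close> because \<^const>\<open>is_local_subdiv_limit\<close> uses unit spacing at
  the starting level.\<close>

definition reproducing ::
    "nat \<Rightarrow> (nat \<Rightarrow> int \<Rightarrow> real) \<Rightarrow> (real \<Rightarrow> complex) set \<Rightarrow> bool" where
  "reproducing \<nu> a \<Phi> \<longleftrightarrow> convergent_scheme a \<and>
     (\<forall>f\<in>\<Phi>. \<forall>m. is_local_subdiv_limit a m (\<lambda>i. f (grid \<nu> m i)) (\<lambda>x. f (x / 2 ^ m)))"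


section \<open>The Sobolev space\<close>

definition Linf_norm :: "(real \<Rightarrow> complex) \<Rightarrow> ereal" where
  "Linf_norm f = esssup lebesgue (\<lambda>x. ereal (norm (f x)))"

definition Linf :: "(real \<Rightarrow> complex) set" where
  "Linf = {f \<in> borel_measurable lebesgue. Linf_norm f < \<infinity>}"

definition test_function :: "(real \<Rightarrow> real) \<Rightarrow> bool" where
  "test_function \<psi> \<longleftrightarrow> (\<forall>n x. (deriv ^^ n) \<psi> differentiable at x) \<and> (\<exists>R. \<forall>x. \<bar>x\<bar> > R \<longrightarrow> \<psi> x = 0)"

definition has_weak_deriv :: "nat \<Rightarrow> (real \<Rightarrow> complex) \<Rightarrow> (real \<Rightarrow> complex) \<Rightarrow> bool" where
  "has_weak_deriv l f h \<longleftrightarrow> (\<forall>\<psi>. test_function \<psi> \<longrightarrow>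
     (LINT x|lebesgue. (deriv ^^ l) \<psi> x *\<^sub>R f x) = (-1) ^ l * (LINT x|lebesgue. \<psi> x *\<^sub>R h x))"

definition sobolev_Linf :: "nat \<Rightarrow> (real \<Rightarrow> complex) set" where
  "sobolev_Linf \<gamma> = {f \<in> Linf. \<forall>l\<le>\<gamma>. \<exists>h\<in>Linf. has_weak_deriv l f h}"

end

theory Submission imports Defs begin

text \<open>The limit at \<open>u\<close> of data given at level \<open>m\<close> is a combination of the data at a bounded number of
  grid points within distance \<open>O(2^(-m))\<close> of \<open>u\<close>; its weights are values of the basic limit function
  \<open>\<phi>\<^sub>m\<close>, which is supported in \<open>[-M, M]\<close>. If the \<open>\<phi>\<^sub>m\<close> are bounded uniformly in \<open>m\<close>, the rate follows
  by comparing \<open>f\<close> with an exponential polynomial \<open>q\<close> that has the same derivatives of order less than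
  \<open>\<gamma>\<close> at \<open>u\<close>. Samples of \<open>q\<close> are reproduced, so the error at \<open>u\<close> is the limit function of the samples
  of \<open>f - q\<close>, and those near \<open>u\<close> are \<open>O(2^(-\<gamma>m))\<close>. Such a \<open>q\<close> exists with constants independent of \<open>u\<close>:
  the Wronskian matrix at \<open>0\<close> is invertible, so some \<open>p\<close> in the span of the first \<open>\<gamma>\<close> functions
  has at \<open>0\<close> the derivatives that \<open>f\<close> has at \<open>u\<close>, and \<open>q(y) = p(y - u)\<close> lies in \<open>\<Phi>\<^sub>N\<close>, because
  \<open>\<Phi>\<^sub>N\<close> is invariant under translation (\<open>local_approximation\<close>, \<open>approximation_order\<close>).

  The main work is the existence and uniform boundedness of the \<open>\<phi>\<^sub>m\<close> (\<open>uniform_basic_limits\<close>).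
  The space contains an exponential \<open>x \<mapsto> exp (l x)\<close>. Let \<open>E\<^sub>k\<close> be the \<open>k\<close>-th iterate of its samples at level
  \<open>m\<close>; it converges to the exponential. This forces the limit mask \<open>b\<close> to preserve constants.
  Convergence of the stationary scheme makes the kernel of its \<open>L\<close>-th power vary slowly, for \<open>L\<close>
  large. At late levels, products of \<open>L\<close> consecutive operators are close to that power.
  Hence they leave invariant the cone of sequences of small relative variation, to which the \<open>E\<^sub>k\<close>
  then belong, and they halve the oscillation of a ratio \<open>V/v\<close> of two data sequences with \<open>v\<close> in the
  cone (\<open>cone_invariant\<close>, \<open>ratio_contracts\<close>). With the unit impulse for the numerator and \<open>E\<^sub>k\<close> for
  the denominator, the ratios converge uniformly, and multiplying by the exponential gives \<open>\<phi>\<^sub>m\<close>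
  with a bound independent of \<open>m\<close>. The finitely many early levels follow by the refinement
  equation.

  The detour through \<open>E\<^sub>k\<close> is needed since reproduction is a statement about limits: if the integer
  translates of the basic limit functions are linearly dependent, \<open>E\<^sub>k\<close> need not consist of the samples of the
  exponential at level \<open>m + k\<close>.

  Finally, \<open>f\<close> has only weak derivatives. It is replaced by mollifications, whose classical
  derivatives are bounded by the essential bounds of the weak ones; as the estimate at \<open>u\<close> involves
  finitely many values of the continuous function \<open>f\<close>, it survives the passage to the limit.\<close>

section \<open>Kernels of iterated subdivision\<close>

definition unit_seq :: "int \<Rightarrow> real" where
  "unit_seq i = (if i = 0 then 1 else 0)"

text \<open>The matrix entries of a product of \<open>n\<close> operators: such a product sends \<open>v\<close> to
  \<open>\<Sum>j. kernel a m n (i - 2 ^ n * j) v j\<close>, see \<open>subdiv_iter_eq_sum\<close>. The same numbers, sampled on the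
  grid \<open>2 ^ (- n)\<close>, approximate the basic limit function.\<close>

definition kernel :: "(nat \<Rightarrow> int \<Rightarrow> real) \<Rightarrow> nat \<Rightarrow> nat \<Rightarrow> int \<Rightarrow> real" where
  "kernel a m n = subdiv_iter a m n unit_seq"

lemma finite_row: "finite {j :: int. \<bar>i - 2 * j\<bar> \<le> int M}"
  by (rule finite_subset[of _ "{(i - int M) div 2 - 1 .. (i + int M) div 2 + 1}"]) auto

lemma subdiv_eq_sum:
  assumes "mask_supported M a" "finite J" "\<And>j. \<bar>i - 2 * j\<bar> \<le> int M \<Longrightarrow> j \<in> J"
  shows "subdiv a v i = (\<Sum>j\<in>J. a (i - 2 * j) *\<^sub>R v j)"
proof -
  have "subdiv a v i = (\<Sum>\<^sub>\<infinity>j\<in>J. a (i - 2 * j) *\<^sub>R v j)"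
    unfolding subdiv_def
  proof (rule infsum_cong_neutral)
    fix j assume "j \<in> UNIV - J"
    then have "\<not> \<bar>i - 2 * j\<bar> \<le> int M" using assms(3) by blast
    then have "a (i - 2 * j) = 0" using assms(1) unfolding mask_supported_def by force
    then show "a (i - 2 * j) *\<^sub>R v j = 0" by simp
  qed auto
  then show ?thesis using assms(2) by simp
qed

lemma subdiv_iter_add:
  "subdiv_iter a m (k + n) v = subdiv_iter a (m + k) n (subdiv_iter a m k v)"
  by (induction n) (simp_all add: add.assoc)

locale supported_masks =
  fixes a :: "nat \<Rightarrow> int \<Rightarrow> real" and M :: nat
  assumes supp: "\<And>k. mask_supported M (a k)"
begin

text \<open>Each step doubles the support and widens it by the support of one mask: \<open>M + 2 M (2 ^ n - 1)
  = M (2 ^ (n + 1) - 1)\<close>.\<close>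

lemma kernel_support: "\<bar>i\<bar> > int M * (2 ^ n - 1) \<Longrightarrow> kernel a m n i = 0"
proof (induction n arbitrary: i)
  case 0
  then show ?case by (simp add: kernel_def unit_seq_def)
next
  case (Suc n)
  have "kernel a m (Suc n) i
      = (\<Sum>j\<in>{j. \<bar>i - 2 * j\<bar> \<le> int M}. a (m + n) (i - 2 * j) *\<^sub>R kernel a m n j)"
    unfolding kernel_def by (simp add: subdiv_eq_sum[OF supp finite_row])
  also have "\<dots> = 0"
  proof (rule sum.neutral, rule ballI)
    fix j assume "j \<in> {j. \<bar>i - 2 * j\<bar> \<le> int M}"
    then have j: "\<bar>i - 2 * j\<bar> \<le> int M" by simp
    have "\<bar>i\<bar> > 2 * (int M * (2 ^ n - 1)) + int M" using Suc.prems by (simp add: algebra_simps)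
    then have "\<bar>j\<bar> > int M * (2 ^ n - 1)" using j by linarith
    then show "a (m + n) (i - 2 * j) *\<^sub>R kernel a m n j = 0" using Suc.IH by simp
  qed
  finally show ?case .
qed

lemma kernel_support': "\<bar>i\<bar> > int M * 2 ^ n \<Longrightarrow> kernel a m n i = 0"
  by (rule kernel_support) (simp add: algebra_simps)

lemma subdiv_iter_eq_sum:
  assumes "finite J" "\<And>j. \<bar>i - 2 ^ n * j\<bar> \<le> int M * (2 ^ n - 1) \<Longrightarrow> j \<in> J"
  shows "subdiv_iter a m n v i = (\<Sum>j\<in>J. kernel a m n (i - 2 ^ n * j) *\<^sub>R v j)"
  using assms(2)
proof (induction n arbitrary: i)
  case 0
  then have "i \<in> J" by simp
  have "(\<Sum>j\<in>J. kernel a m 0 (i - 2 ^ 0 * j) *\<^sub>R v j) = (\<Sum>j\<in>J. if j = i then v j else 0)"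
    by (rule sum.cong) (auto simp: kernel_def unit_seq_def)
  then show ?case using \<open>i \<in> J\<close> assms(1) by simp
next
  case (Suc n)
  let ?L = "{l. \<bar>i - 2 * l\<bar> \<le> int M}"
  have "subdiv_iter a m (Suc n) v i = (\<Sum>l\<in>?L. a (m + n) (i - 2 * l) *\<^sub>R subdiv_iter a m n v l)"
    by (simp add: subdiv_eq_sum[OF supp finite_row])
  also have "\<dots> = (\<Sum>l\<in>?L. a (m + n) (i - 2 * l) *\<^sub>R
                     (\<Sum>j\<in>J. kernel a m n (l - 2 ^ n * j) *\<^sub>R v j))"
  proof (rule sum.cong[OF refl])
    fix l assume "l \<in> ?L"
    then have l: "\<bar>i - 2 * l\<bar> \<le> int M" by simp
    have "subdiv_iter a m n v l = (\<Sum>j\<in>J. kernel a m n (l - 2 ^ n * j) *\<^sub>R v j)"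
    proof (rule Suc.IH)
      fix j assume j: "\<bar>l - 2 ^ n * j\<bar> \<le> int M * (2 ^ n - 1)"
      have "\<bar>i - 2 ^ Suc n * j\<bar> \<le> \<bar>i - 2 * l\<bar> + 2 * \<bar>l - 2 ^ n * j\<bar>"
      proof -
        have "i - 2 ^ Suc n * j = (i - 2 * l) + 2 * (l - 2 ^ n * j)" by simp
        moreover have "\<bar>p + 2 * q\<bar> \<le> \<bar>p\<bar> + 2 * \<bar>q\<bar>" for p q :: int by linarith
        ultimately show ?thesis by metis
      qed
      also have "\<dots> \<le> int M + 2 * (int M * (2 ^ n - 1))" using l j by (intro add_mono mult_left_mono) auto
      also have "\<dots> = int M * (2 ^ Suc n - 1)" by (simp add: algebra_simps)
      finally show "j \<in> J" by (rule Suc.prems)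
    qed
    then show "a (m + n) (i - 2 * l) *\<^sub>R subdiv_iter a m n v l
      = a (m + n) (i - 2 * l) *\<^sub>R (\<Sum>j\<in>J. kernel a m n (l - 2 ^ n * j) *\<^sub>R v j)" by simp
  qed
  also have "\<dots> = (\<Sum>j\<in>J. (\<Sum>l\<in>?L. a (m + n) (i - 2 * l) * kernel a m n (l - 2 ^ n * j)) *\<^sub>R v j)"
    by (simp add: scaleR_sum_right scaleR_sum_left sum.swap[of _ ?L])
  also have "\<dots> = (\<Sum>j\<in>J. kernel a m (Suc n) (i - 2 ^ Suc n * j) *\<^sub>R v j)"
  proof (rule sum.cong[OF refl])
    fix j
    let ?i = "i - 2 ^ Suc n * j"
    have "kernel a m (Suc n) ?i
        = (\<Sum>l\<in>{l. \<bar>?i - 2 * l\<bar> \<le> int M}. a (m + n) (?i - 2 * l) * kernel a m n l)"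
      unfolding kernel_def by (simp add: subdiv_eq_sum[OF supp finite_row])
    also have "\<dots> = (\<Sum>l\<in>?L. a (m + n) (i - 2 * l) * kernel a m n (l - 2 ^ n * j))"
      by (rule sum.reindex_bij_witness[of _ "\<lambda>l. l - 2 ^ n * j" "\<lambda>l. l + 2 ^ n * j"])
        (auto simp: algebra_simps)
    finally show "(\<Sum>l\<in>?L. a (m + n) (i - 2 * l) * kernel a m n (l - 2 ^ n * j)) *\<^sub>R v j
        = kernel a m (Suc n) ?i *\<^sub>R v j" by simp
  qed
  finally show ?case .
qed

text \<open>Contains every \<open>j\<close> whose datum influences the \<open>n\<close>-fold iterate at an index within distance \<open>2 ^ n\<close>
  of \<open>i\<close>. Neighbouring rows can therefore be subtracted as sums over one index set of a size that does
  not depend on \<open>n\<close>.\<close>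

definition window :: "nat \<Rightarrow> int \<Rightarrow> int set" where
  "window n i = {i div 2 ^ n - (int M + 1) .. i div 2 ^ n + (int M + 1)}"

lemma finite_window [simp]: "finite (window n i)"
  by (simp add: window_def)

lemma card_window [simp]: "card (window n i) = 2 * M + 3"
  by (simp add: window_def)

lemma in_window_iff: "j \<in> window n i \<longleftrightarrow> \<bar>j - i div 2 ^ n\<bar> \<le> int M + 1"
  by (auto simp: window_def)

lemma in_window:
  assumes "\<bar>i' - i\<bar> \<le> 2 ^ n" "\<bar>i' - 2 ^ n * j\<bar> \<le> int M * (2 ^ n - 1)"
  shows "j \<in> window n i"
proof -
  define q r where "q = i div 2 ^ n" and "r = i mod (2 :: int) ^ n"
  have i: "i = 2 ^ n * q + r" and r: "0 \<le> r" "r < 2 ^ n"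
    by (simp_all add: q_def r_def)
  have "2 ^ n * (j - q) < 2 ^ n * (int M + 2)"
    using assms r unfolding i by (simp add: algebra_simps)
  then have "j - q < int M + 2" by (simp only: mult_less_cancel_left_pos zero_less_power zero_less_numeral)
  moreover have "2 ^ n * (- (int M + 1)) \<le> 2 ^ n * (j - q)"
    using assms r unfolding i by (simp add: algebra_simps)
  then have "- (int M + 1) \<le> j - q"
    by (simp only: mult_le_cancel_left_pos zero_less_power zero_less_numeral)
  ultimately show ?thesis unfolding window_def q_def by simp
qed

lemma subdiv_iter_window:
  assumes "\<bar>i' - i\<bar> \<le> 2 ^ n"
  shows "subdiv_iter a m n v i' = (\<Sum>j\<in>window n i. kernel a m n (i' - 2 ^ n * j) *\<^sub>R v j)"
  by (rule subdiv_iter_eq_sum) (auto intro: in_window[OF assms])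

lemma kernel_tendsto_limit_kernel:
  assumes "mask_supported M b" "\<And>i. (\<lambda>k. a k i) \<longlonglongrightarrow> b i"
  shows "(\<lambda>m. kernel a m n i) \<longlonglongrightarrow> kernel (\<lambda>_. b) 0 n i"
proof (induction n arbitrary: i)
  case 0
  then show ?case by (simp add: kernel_def)
next
  case (Suc n)
  have 1: "kernel a m (Suc n) i
      = (\<Sum>j\<in>{j. \<bar>i - 2 * j\<bar> \<le> int M}. a (m + n) (i - 2 * j) * kernel a m n j)" for m
    unfolding kernel_def by (simp add: subdiv_eq_sum[OF supp finite_row])
  have 2: "kernel (\<lambda>_. b) 0 (Suc n) i
      = (\<Sum>j\<in>{j. \<bar>i - 2 * j\<bar> \<le> int M}. b (i - 2 * j) * kernel (\<lambda>_. b) 0 n j)"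
    unfolding kernel_def by (simp add: subdiv_eq_sum[OF assms(1) finite_row])
  have "(\<lambda>m. a (m + n) (i - 2 * j)) \<longlonglongrightarrow> b (i - 2 * j)" for j
    by (rule LIMSEQ_ignore_initial_segment[OF assms(2)])
  then show ?case unfolding 1 2 by (intro tendsto_intros Suc.IH)
qed

text \<open>Pointwise convergence is uniform because all kernels of \<open>n\<close> steps vanish outside one finite set.\<close>

lemma kernel_uniform_limit:
  assumes b: "mask_supported M b" "\<And>i. (\<lambda>k. a k i) \<longlonglongrightarrow> b i" and "\<epsilon> > 0"
  shows "\<exists>m0. \<forall>m\<ge>m0. \<forall>i. \<bar>kernel a m n i - kernel (\<lambda>_. b) 0 n i\<bar> \<le> \<epsilon>"
proof -
  interpret b: supported_masks "\<lambda>_. b" M by unfold_locales (rule b(1))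
  let ?I = "{- (int M * 2 ^ n) .. int M * 2 ^ n}"
  have "\<forall>i\<in>?I. eventually (\<lambda>m. \<bar>kernel a m n i - kernel (\<lambda>_. b) 0 n i\<bar> \<le> \<epsilon>) sequentially"
  proof
    fix i
    have "eventually (\<lambda>m. dist (kernel a m n i) (kernel (\<lambda>_. b) 0 n i) < \<epsilon>) sequentially"
      using kernel_tendsto_limit_kernel[OF b] \<open>\<epsilon> > 0\<close> by (rule tendstoD)
    then show "eventually (\<lambda>m. \<bar>kernel a m n i - kernel (\<lambda>_. b) 0 n i\<bar> \<le> \<epsilon>) sequentially"
      by (rule eventually_mono) (simp add: dist_real_def)
  qed
  then have "eventually (\<lambda>m. \<forall>i\<in>?I. \<bar>kernel a m n i - kernel (\<lambda>_. b) 0 n i\<bar> \<le> \<epsilon>) sequentially"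
    by (intro eventually_ball_finite) auto
  then obtain m0 where m0: "\<And>m i. m \<ge> m0 \<Longrightarrow> i \<in> ?I \<Longrightarrow> \<bar>kernel a m n i - kernel (\<lambda>_. b) 0 n i\<bar> \<le> \<epsilon>"
    unfolding eventually_sequentially by blast
  have "\<bar>kernel a m n i - kernel (\<lambda>_. b) 0 n i\<bar> \<le> \<epsilon>" if "m \<ge> m0" for m i
  proof (cases "i \<in> ?I")
    case False
    then have "\<bar>i\<bar> > int M * 2 ^ n" by auto
    then show ?thesis using kernel_support' b.kernel_support' \<open>\<epsilon> > 0\<close> by simp
  qed (use m0 that in blast)
  then show ?thesis by blast
qed

lemma kernel_bounded: "\<exists>B>0. \<forall>i. \<bar>kernel a m n i\<bar> \<le> B"
proof -
  let ?I = "{- (int M * 2 ^ n) .. int M * 2 ^ n}"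
  let ?B = "1 + (\<Sum>i\<in>?I. \<bar>kernel a m n i\<bar>)"
  have "\<bar>kernel a m n i\<bar> \<le> ?B" for i
  proof (cases "i \<in> ?I")
    case True
    then have "\<bar>kernel a m n i\<bar> \<le> (\<Sum>i\<in>?I. \<bar>kernel a m n i\<bar>)" by (intro member_le_sum) auto
    then show ?thesis by simp
  next
    case False
    then have "\<bar>i\<bar> > int M * 2 ^ n" by auto
    then show ?thesis using kernel_support' by (simp add: sum_nonneg)
  qed
  moreover have "?B > 0" by (simp add: add_pos_nonneg sum_nonneg)
  ultimately show ?thesis by blast
qed

end

section \<open>Limits of subdivision\<close>

text \<open>The convergence notions are phrased with suprema of extended reals; this equivalence gives access to
  ordinary \<open>\<epsilon>\<close>-estimates.\<close>

lemma SUP_ereal_tendsto_0_iff: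
  fixes h :: "nat \<Rightarrow> 'i \<Rightarrow> real"
  assumes "\<And>k. A k \<noteq> {}" "\<And>k i. h k i \<ge> 0"
  shows "((\<lambda>k. SUP i\<in>A k. ereal (h k i)) \<longlonglongrightarrow> 0)
    \<longleftrightarrow> (\<forall>\<epsilon>>0. \<forall>\<^sub>F k in sequentially. \<forall>i\<in>A k. h k i \<le> \<epsilon>)" (is "?l \<longleftrightarrow> ?r")
proof
  assume ?l
  show ?r
  proof (intro allI impI)
    fix \<epsilon> :: real assume "\<epsilon> > 0"
    then have "\<forall>\<^sub>F k in sequentially. (SUP i\<in>A k. ereal (h k i)) < ereal \<epsilon>"
      using \<open>?l\<close> by (intro order_tendstoD) (auto simp: zero_ereal_def)
    then show "\<forall>\<^sub>F k in sequentially. \<forall>i\<in>A k. h k i \<le> \<epsilon>"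
      by (rule eventually_mono) (metis SUP_upper ereal_less_eq(3) less_imp_le order_trans)
  qed
next
  assume r: ?r
  have nonneg: "(SUP i\<in>A k. ereal (h k i)) \<ge> 0" for k
  proof -
    obtain i where "i \<in> A k" using assms(1) by blast
    then show ?thesis using assms(2) by (intro SUP_upper2[of i]) auto
  qed
  show ?l
  proof (rule order_tendstoI)
    fix y :: ereal assume "y < 0"
    then show "\<forall>\<^sub>F k in sequentially. y < (SUP i\<in>A k. ereal (h k i))"
      using nonneg by (intro always_eventually) (meson less_le_trans)
  next
    fix y :: ereal assume "0 < y"
    then obtain e where e: "0 < ereal e" "ereal e < y"
      using ereal_dense2[of 0 y] by auto
    then have "\<forall>\<^sub>F k in sequentially. \<forall>i\<in>A k. h k i \<le> e" using r by auto
    then show "\<forall>\<^sub>F k in sequentially. (SUP i\<in>A k. ereal (h k i)) < y"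
    proof (rule eventually_mono)
      fix k assume "\<forall>i\<in>A k. h k i \<le> e"
      then have "(SUP i\<in>A k. ereal (h k i)) \<le> ereal e" by (intro SUP_least) auto
      then show "(SUP i\<in>A k. ereal (h k i)) < y" using e by simp
    qed
  qed
qed

lemma is_subdiv_limit_iff:
  "is_subdiv_limit a m f g \<longleftrightarrow> continuous_on UNIV g \<and>
     (\<forall>\<epsilon>>0. \<forall>\<^sub>F k in sequentially. \<forall>i. norm (g (real_of_int i / 2 ^ k) - subdiv_iter a m k f i) \<le> \<epsilon>)"
  unfolding is_subdiv_limit_def by (subst SUP_ereal_tendsto_0_iff) auto

lemma is_local_subdiv_limit_iff:
  "is_local_subdiv_limit a m f g \<longleftrightarrow> continuous_on UNIV g \<and>
     (\<forall>R>0. \<forall>\<epsilon>>0. \<forall>\<^sub>F k in sequentially. \<forall>i. \<bar>real_of_int i / 2 ^ k\<bar> \<le> R \<longrightarrow>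
        norm (g (real_of_int i / 2 ^ k) - subdiv_iter a m k f i) \<le> \<epsilon>)"
proof -
  have "{i. \<bar>real_of_int i / 2 ^ k\<bar> \<le> R} \<noteq> {}" if "R > 0" for k R
    using that by (auto intro!: exI[of _ 0])
  then show ?thesis
    unfolding is_local_subdiv_limit_def
    by (auto simp: SUP_ereal_tendsto_0_iff)
qed

lemma is_local_subdiv_limit_if_is_subdiv_limit:
  "is_subdiv_limit a m f g \<Longrightarrow> is_local_subdiv_limit a m f g"
  unfolding is_subdiv_limit_iff is_local_subdiv_limit_iff by (auto elim!: eventually_mono)

lemma floor_dyadic_tendsto: "(\<lambda>k. real_of_int \<lfloor>2 ^ k * x\<rfloor> / 2 ^ k) \<longlonglongrightarrow> x"
proof (rule LIMSEQ_I)
  fix r :: real assume "r > 0"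
  then obtain n where n: "(1/2) ^ n < r" using real_arch_pow_inv[of r "1/2"] by auto
  have "norm (real_of_int \<lfloor>2 ^ k * x\<rfloor> / 2 ^ k - x) < r" if "k \<ge> n" for k
  proof -
    have "real_of_int \<lfloor>2 ^ k * x\<rfloor> / 2 ^ k - x = (real_of_int \<lfloor>2 ^ k * x\<rfloor> - 2 ^ k * x) / 2 ^ k"
      by (simp add: field_simps)
    also have "norm \<dots> \<le> 1 / 2 ^ k"
      unfolding real_norm_def abs_divide
      unfolding abs_of_pos[OF zero_less_power[OF zero_less_numeral]]
      by (rule divide_right_mono) (linarith, simp)
    also have "\<dots> \<le> (1/2) ^ n"
      using power_decreasing[OF that, of "1/2::real"] by (simp add: power_divide)
    finally show ?thesis using n by simp
  qed
  then show "\<exists>no. \<forall>n\<ge>no. norm (real_of_int \<lfloor>2 ^ n * x\<rfloor> / 2 ^ n - x) < r" by blast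
qed

text \<open>Following the iterates along grid points that approach an arbitrary real \<open>x\<close> determines the limit
  function everywhere, and not just at dyadic points. Uniqueness of limits and the reproduction
  identity both rest on this.\<close>

lemma local_subdiv_limit_tendsto:
  assumes "is_local_subdiv_limit a m f g"
    and "(\<lambda>k. real_of_int (i k) / 2 ^ k) \<longlonglongrightarrow> x"
  shows "(\<lambda>k. subdiv_iter a m k f (i k)) \<longlonglongrightarrow> g x"
proof -
  have g: "continuous_on UNIV g"
    and lim: "\<And>R \<epsilon>. R > 0 \<Longrightarrow> \<epsilon> > 0 \<Longrightarrow> \<forall>\<^sub>F k in sequentially. \<forall>i. \<bar>real_of_int i / 2 ^ k\<bar> \<le> R \<longrightarrow>
        norm (g (real_of_int i / 2 ^ k) - subdiv_iter a m k f i) \<le> \<epsilon>"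
    using assms(1) unfolding is_local_subdiv_limit_iff by auto
  have 1: "(\<lambda>k. g (real_of_int (i k) / 2 ^ k)) \<longlonglongrightarrow> g x"
    using g assms(2) by (intro isCont_tendsto_compose[of x g]) (simp_all add: continuous_on_eq_continuous_at)
  have ev: "\<forall>\<^sub>F k in sequentially. \<bar>real_of_int (i k) / 2 ^ k\<bar> \<le> \<bar>x\<bar> + 1"
  proof -
    have "\<forall>\<^sub>F k in sequentially. dist (real_of_int (i k) / 2 ^ k) x < 1"
      using assms(2) by (rule tendstoD) simp
    then show ?thesis by (rule eventually_mono) (unfold dist_real_def, linarith)
  qed
  have "(\<lambda>k. g (real_of_int (i k) / 2 ^ k) - subdiv_iter a m k f (i k)) \<longlonglongrightarrow> 0"
  proof (rule tendstoI)
    fix e :: real assume "e > 0"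
    have "\<forall>\<^sub>F k in sequentially. \<forall>i. \<bar>real_of_int i / 2 ^ k\<bar> \<le> \<bar>x\<bar> + 1 \<longrightarrow>
        norm (g (real_of_int i / 2 ^ k) - subdiv_iter a m k f i) \<le> e / 2"
      by (rule lim) (use \<open>e > 0\<close> in auto)
    with ev show "\<forall>\<^sub>F k in sequentially.
        dist (g (real_of_int (i k) / 2 ^ k) - subdiv_iter a m k f (i k)) 0 < e"
      by eventually_elim (use \<open>e > 0\<close> in \<open>force simp: dist_norm\<close>)
  qed
  from tendsto_diff[OF 1 this] show ?thesis by simp
qed

lemma is_subdiv_limit_unique:
  assumes "is_subdiv_limit a m f g" "is_subdiv_limit a m f h"
  shows "g = h"
proof
  fix x
  show "g x = h x"
    by (rule LIMSEQ_unique[OF local_subdiv_limit_tendsto local_subdiv_limit_tendsto])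
      (use assms floor_dyadic_tendsto in \<open>auto intro: is_local_subdiv_limit_if_is_subdiv_limit\<close>)
qed

lemma basic_limit_eqI:
  assumes "is_subdiv_limit a m unit_seq g"
  shows "basic_limit a m = g"
  unfolding basic_limit_def
proof (rule the_equality)
  show "is_subdiv_limit a m (\<lambda>i. if i = 0 then 1 else 0) g"
    using assms by (simp add: unit_seq_def[abs_def])
  then show "h = g" if "is_subdiv_limit a m (\<lambda>i. if i = 0 then 1 else 0) h" for h
    using that by (rule is_subdiv_limit_unique[rotated])
qed

section \<open>Perturbations of a convergent stationary scheme\<close>

lemma geometric_cauchy:
  fixes s :: "nat \<Rightarrow> complex"
  assumes step: "\<And>k. norm (s (Suc k) - s k) \<le> C * \<rho> ^ k" and \<rho>: "0 \<le> \<rho>" "\<rho> < 1"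
  shows "\<exists>l. s \<longlonglongrightarrow> l \<and> (\<forall>k. norm (l - s k) \<le> C * \<rho> ^ k / (1 - \<rho>))"
proof -
  let ?d = "\<lambda>k. s (Suc k) - s k"
  have geo: "summable (\<lambda>k. C * \<rho> ^ k)" using \<rho> by (intro summable_mult summable_geometric) simp
  have sm: "summable (\<lambda>k. norm (?d k))"
    by (rule summable_comparison_test'[OF geo, of 0]) (use step in simp)
  then have sd: "summable ?d" by (rule summable_norm_cancel)
  let ?l = "s 0 + suminf ?d"
  have part: "s k = s 0 + (\<Sum>i<k. ?d i)" for k
    by (induction k) auto
  have "(\<lambda>k. s 0 + (\<Sum>i<k. ?d i)) \<longlonglongrightarrow> ?l"
    using summable_LIMSEQ[OF sd] by (intro tendsto_intros)
  then have "s \<longlonglongrightarrow> ?l" unfolding part[symmetric] .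
  moreover have "norm (?l - s k) \<le> C * \<rho> ^ k / (1 - \<rho>)" for k
  proof -
    have "?l - s k = (\<Sum>i. ?d (i + k))"
      using suminf_split_initial_segment[OF sd, of k] part[of k] by (simp add: algebra_simps)
    also have "norm \<dots> \<le> (\<Sum>i. norm (?d (i + k)))"
      using sm by (intro summable_norm) (simp add: summable_iff_shift[of "\<lambda>k. norm (?d k)"])
    also have "\<dots> \<le> (\<Sum>i. C * \<rho> ^ (i + k))"
    proof (rule suminf_le)
      show "summable (\<lambda>i. norm (?d (i + k)))"
        using sm by (simp add: summable_iff_shift[of "\<lambda>k. norm (?d k)"])
      show "summable (\<lambda>i. C * \<rho> ^ (i + k))"
        using geo by (simp add: summable_iff_shift[of "\<lambda>k. C * \<rho> ^ k"])
    qed (rule step)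
    also have "\<dots> = (\<Sum>i. (C * \<rho> ^ k) * \<rho> ^ i)" by (simp add: power_add mult_ac)
    also have "\<dots> = C * \<rho> ^ k * (\<Sum>i. \<rho> ^ i)"
      using \<rho> by (intro suminf_mult summable_geometric) simp
    also have "\<dots> = C * \<rho> ^ k / (1 - \<rho>)" using \<rho> by (simp add: suminf_geometric)
    finally show ?thesis .
  qed
  ultimately show ?thesis by blast
qed

text \<open>Small relative variation over the distance \<open>M + 1\<close>, the radius of a window. Unlike a bound on
  absolute differences, this is scale invariant and holds globally for samples of an exponential
  on a fine grid.\<close>

definition near_const :: "nat \<Rightarrow> real \<Rightarrow> (int \<Rightarrow> complex) \<Rightarrow> bool" where
  "near_const M \<delta> v \<longleftrightarrow> (\<forall>j j'. \<bar>j' - j\<bar> \<le> int M + 1 \<longrightarrow> norm (v j' - v j) \<le> \<delta> * norm (v j))"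

definition osc_le :: "nat \<Rightarrow> real \<Rightarrow> (int \<Rightarrow> complex) \<Rightarrow> bool" where
  "osc_le M d v \<longleftrightarrow> (\<forall>j j'. \<bar>j' - j\<bar> \<le> int M + 1 \<longrightarrow> norm (v j' - v j) \<le> d)"

lemma near_constD: "near_const M \<delta> v \<Longrightarrow> \<bar>j' - j\<bar> \<le> int M + 1 \<Longrightarrow> norm (v j' - v j) \<le> \<delta> * norm (v j)"
  by (simp add: near_const_def)

lemma osc_leD: "osc_le M d v \<Longrightarrow> \<bar>j' - j\<bar> \<le> int M + 1 \<Longrightarrow> norm (v j' - v j) \<le> d"
  by (simp add: osc_le_def)

lemma abs_div_diff_le:
  fixes i i' :: int
  assumes "\<bar>i' - i\<bar> \<le> K"
  shows "\<bar>i' div 2 ^ n - i div 2 ^ n\<bar> \<le> K"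
proof -
  have *: "i' div 2 ^ n \<le> i div 2 ^ n + k" if "i' \<le> i + k" "k \<ge> 0" for i i' k :: int
  proof -
    have "k \<le> 2 ^ n * k" using that(2) by (simp add: mult_le_cancel_right1)
    then have "i' \<le> i + 2 ^ n * k" using that by linarith
    then have "i' div 2 ^ n \<le> (i + 2 ^ n * k) div 2 ^ n" by (rule zdiv_mono1) simp
    then show ?thesis by simp
  qed
  show ?thesis using *[of i' i K] *[of i i' K] assms by linarith
qed

text \<open>The operators at late levels are small perturbations of one operator that preserves constants
  and whose powers have slowly varying kernels. The row sums and the differences of neighbouring rows
  are then under control, uniformly over all late levels.\<close>

locale perturbed_scheme = supported_masks +
  fixes b :: "int \<Rightarrow> real"
  assumes supp_b: "mask_supported M b"
    and mask_lim: "\<And>i. (\<lambda>k. a k i) \<longlonglongrightarrow> b i"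
    and preserves_one: "subdiv b (\<lambda>_. 1 :: real) = (\<lambda>_. 1)"
    and limit_kernel_smooth: "\<And>\<omega>. \<omega> > 0 \<Longrightarrow> \<exists>n0. \<forall>n\<ge>n0. \<forall>i i'. \<bar>i' - i\<bar> \<le> int M + 1 \<longrightarrow>
           \<bar>kernel (\<lambda>_. b) 0 n i' - kernel (\<lambda>_. b) 0 n i\<bar> \<le> \<omega>"
begin

sublocale b: supported_masks "\<lambda>_. b" M
  by unfold_locales (rule supp_b)

abbreviation "stationary_kernel n \<equiv> kernel (\<lambda>_. b) 0 n"

lemma limit_kernel_row_sum:
  assumes "\<bar>i' - i\<bar> \<le> 2 ^ n"
  shows "(\<Sum>j\<in>window n i. stationary_kernel n (i' - 2 ^ n * j)) = 1"
proof -
  have "subdiv_iter (\<lambda>_. b) 0 n (\<lambda>_. 1 :: real) = (\<lambda>_. 1)"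
    by (induction n) (simp_all add: preserves_one)
  then have "1 = subdiv_iter (\<lambda>_. b) 0 n (\<lambda>_. 1 :: real) i'" by simp
  also have "\<dots> = (\<Sum>j\<in>window n i. stationary_kernel n (i' - 2 ^ n * j))"
    using b.subdiv_iter_window[OF assms, of 0 "\<lambda>_. 1 :: real"] by simp
  finally show ?thesis by simp
qed

definition kernel_close :: "nat \<Rightarrow> nat \<Rightarrow> real \<Rightarrow> real \<Rightarrow> bool" where
  "kernel_close m n \<beta> \<epsilon> \<longleftrightarrow> \<epsilon> \<ge> 0 \<and> \<beta> \<ge> 0 \<and> (\<forall>i. \<bar>kernel a m n i - stationary_kernel n i\<bar> \<le> \<epsilon>) \<and> (\<forall>i. \<bar>stationary_kernel n i\<bar> \<le> \<beta>)"

text \<open>The number of indices in a window.\<close>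

abbreviation "W \<equiv> real (2 * M + 3)"

lemma subdiv_iter_bound:
  assumes cl: "kernel_close m n \<beta> \<epsilon>" and i': "\<bar>i' - i\<bar> \<le> 2 ^ n"
    and u: "\<And>j. \<bar>j - i div 2 ^ n\<bar> \<le> int M + 1 \<Longrightarrow> norm (u j) \<le> D"
  shows "norm (subdiv_iter a m n u i' :: complex) \<le> W * ((\<beta> + \<epsilon>) * D)"
proof -
  have "norm (\<Sum>j\<in>window n i. kernel a m n (i' - 2 ^ n * j) *\<^sub>R u j)
      \<le> of_nat (card (window n i)) * ((\<beta> + \<epsilon>) * D)"
  proof (rule sum_norm_bound)
    fix j assume "j \<in> window n i"
    then have uj: "norm (u j) \<le> D" using u by (simp add: in_window_iff)
    have "\<bar>kernel a m n (i' - 2 ^ n * j)\<bar> \<le> \<beta> + \<epsilon>"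
      proof -
      let ?x = "i' - 2 ^ n * j"
      have "\<bar>kernel a m n ?x - stationary_kernel n ?x\<bar> \<le> \<epsilon>" "\<bar>stationary_kernel n ?x\<bar> \<le> \<beta>"
        using cl unfolding kernel_close_def by auto
      then show ?thesis by linarith
    qed
    then show "norm (kernel a m n (i' - 2 ^ n * j) *\<^sub>R u j) \<le> (\<beta> + \<epsilon>) * D"
      using uj by (simp add: mult_mono)
  qed
  then show ?thesis using subdiv_iter_window[OF i', of m u] by simp
qed

lemma subdiv_iter_diff_bound:
  assumes cl: "kernel_close m n \<beta> \<epsilon>" and i': "\<bar>i' - i\<bar> \<le> int M + 1" "int M + 1 \<le> 2 ^ n"
    and sm: "\<And>i i'. \<bar>i' - i\<bar> \<le> int M + 1 \<Longrightarrow> \<bar>stationary_kernel n i' - stationary_kernel n i\<bar> \<le> \<omega>"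
    and u: "\<And>j. \<bar>j - i div 2 ^ n\<bar> \<le> int M + 1 \<Longrightarrow> norm (u j) \<le> D"
  shows "norm (subdiv_iter a m n u i' - subdiv_iter a m n u i :: complex) \<le> W * ((\<omega> + 2 * \<epsilon>) * D)"
proof -
  have i'2: "\<bar>i' - i\<bar> \<le> 2 ^ n" using i' by linarith
  have "norm (\<Sum>j\<in>window n i. (kernel a m n (i' - 2 ^ n * j) - kernel a m n (i - 2 ^ n * j)) *\<^sub>R u j)
      \<le> of_nat (card (window n i)) * ((\<omega> + 2 * \<epsilon>) * D)"
  proof (rule sum_norm_bound)
    fix j assume "j \<in> window n i"
    then have uj: "norm (u j) \<le> D" using u by (simp add: in_window_iff)
    have "\<bar>kernel a m n (i' - 2 ^ n * j) - stationary_kernel n (i' - 2 ^ n * j)\<bar> \<le> \<epsilon>"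
         "\<bar>kernel a m n (i - 2 ^ n * j) - stationary_kernel n (i - 2 ^ n * j)\<bar> \<le> \<epsilon>"
      using cl unfolding kernel_close_def by auto
    moreover have "\<bar>stationary_kernel n (i' - 2 ^ n * j) - stationary_kernel n (i - 2 ^ n * j)\<bar> \<le> \<omega>"
      by (rule sm) (use i' in simp)
    ultimately have "\<bar>kernel a m n (i' - 2 ^ n * j) - kernel a m n (i - 2 ^ n * j)\<bar> \<le> \<omega> + 2 * \<epsilon>"
      by linarith
    then show "norm ((kernel a m n (i' - 2 ^ n * j) - kernel a m n (i - 2 ^ n * j)) *\<^sub>R u j)
        \<le> (\<omega> + 2 * \<epsilon>) * D"
      using uj by (simp add: mult_mono)
  qed
  then show ?thesis
    using subdiv_iter_window[OF i'2, of m u] subdiv_iter_window[of i i n m u]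
    by (simp add: scaleR_diff_left sum_subtractf)
qed

lemma kernel_row_sum_near_one:
  assumes cl: "kernel_close m n \<beta> \<epsilon>" and i': "\<bar>i' - i\<bar> \<le> 2 ^ n"
  shows "\<bar>(\<Sum>j\<in>window n i. kernel a m n (i' - 2 ^ n * j)) - 1\<bar> \<le> W * \<epsilon>"
proof -
  have "norm (\<Sum>j\<in>window n i. kernel a m n (i' - 2 ^ n * j) - stationary_kernel n (i' - 2 ^ n * j))
      \<le> of_nat (card (window n i)) * \<epsilon>"
    by (rule sum_norm_bound) (use cl in \<open>auto simp: kernel_close_def\<close>)
  then show ?thesis by (simp add: sum_subtractf limit_kernel_row_sum[OF i'])
qed

text \<open>Only the deviation of the data from their value \<open>z\<close> at the centre of the window has to be estimated
  entry by entry; \<open>z\<close> itself is multiplied by a row sum, which is close to \<open>1\<close>.\<close>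

lemma subdiv_iter_split_const:
  assumes i': "\<bar>i' - i\<bar> \<le> 2 ^ n"
  shows "subdiv_iter a m n v i'
    = subdiv_iter a m n (\<lambda>j. v j - z) i' + of_real (\<Sum>j\<in>window n i. kernel a m n (i' - 2 ^ n * j)) * (z :: complex)"
  unfolding subdiv_iter_window[OF i']
  by (simp add: scaleR_diff_right sum_subtractf scaleR_sum_left[symmetric] scaleR_conv_of_real[of _ z] sum_distrib_right[symmetric])

lemma subdiv_iter_near:
  assumes cl: "kernel_close m n \<beta> \<epsilon>" and v: "near_const M \<delta> v"
  shows "norm (subdiv_iter a m n v i - v (i div 2 ^ n)) \<le> (W * \<epsilon> + W * (\<beta> + \<epsilon>) * \<delta>) * norm (v (i div 2 ^ n))"
proof -
  let ?z = "v (i div 2 ^ n)" and ?s = "\<Sum>j\<in>window n i. kernel a m n (i - 2 ^ n * j)"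
  have "subdiv_iter a m n v i - ?z = subdiv_iter a m n (\<lambda>j. v j - ?z) i + of_real (?s - 1) * ?z"
    using subdiv_iter_split_const[of i i n m v ?z] by (simp add: algebra_simps)
  also have "norm \<dots> \<le> W * ((\<beta> + \<epsilon>) * (\<delta> * norm ?z)) + W * \<epsilon> * norm ?z"
  proof (rule norm_triangle_mono)
    show "norm (subdiv_iter a m n (\<lambda>j. v j - ?z) i) \<le> W * ((\<beta> + \<epsilon>) * (\<delta> * norm ?z))"
      by (rule subdiv_iter_bound[OF cl, of i i]) (use near_constD[OF v] in simp_all)
    show "norm (of_real (?s - 1) * ?z) \<le> W * \<epsilon> * norm ?z"
      unfolding norm_mult norm_of_real
      by (rule mult_right_mono) (use kernel_row_sum_near_one[OF cl, of i i] in simp_all)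
  qed
  also have "\<dots> = (W * \<epsilon> + W * (\<beta> + \<epsilon>) * \<delta>) * norm ?z" by (simp only: algebra_simps)
  finally show ?thesis .
qed

lemma subdiv_iter_cone_diff:
  assumes cl: "kernel_close m n \<beta> \<epsilon>" and i': "\<bar>i' - i\<bar> \<le> int M + 1" "int M + 1 \<le> 2 ^ n"
    and sm: "\<And>i i'. \<bar>i' - i\<bar> \<le> int M + 1 \<Longrightarrow> \<bar>stationary_kernel n i' - stationary_kernel n i\<bar> \<le> \<omega>"
    and v: "near_const M \<delta> v"
  shows "norm (subdiv_iter a m n v i' - subdiv_iter a m n v i)
    \<le> ((W * \<omega> + 2 * (W * \<epsilon>)) * \<delta> + 2 * (W * \<epsilon>)) * norm (v (i div 2 ^ n))"
proof -
  have i'2: "\<bar>i' - i\<bar> \<le> 2 ^ n" using i' by linarith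
  let ?z = "v (i div 2 ^ n)" and ?s = "\<lambda>i'. \<Sum>j\<in>window n i. kernel a m n (i' - 2 ^ n * j)"
  have "subdiv_iter a m n v i' - subdiv_iter a m n v i
     = (subdiv_iter a m n (\<lambda>j. v j - ?z) i' - subdiv_iter a m n (\<lambda>j. v j - ?z) i)
       + of_real (?s i' - ?s i) * ?z"
    using subdiv_iter_split_const[OF i'2, of m v ?z] subdiv_iter_split_const[of i i n m v ?z]
    by (simp add: algebra_simps)
  also have "norm \<dots> \<le> W * ((\<omega> + 2 * \<epsilon>) * (\<delta> * norm ?z)) + 2 * (W * \<epsilon>) * norm ?z"
  proof (rule norm_triangle_mono)
    show "norm (subdiv_iter a m n (\<lambda>j. v j - ?z) i' - subdiv_iter a m n (\<lambda>j. v j - ?z) i)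
        \<le> W * ((\<omega> + 2 * \<epsilon>) * (\<delta> * norm ?z))"
      by (rule subdiv_iter_diff_bound[OF cl i' sm]) (use near_constD[OF v] in simp_all)
    have "\<bar>?s i' - ?s i\<bar> \<le> 2 * (W * \<epsilon>)"
      using kernel_row_sum_near_one[OF cl i'2] kernel_row_sum_near_one[OF cl, of i i] by simp
    then show "norm (of_real (?s i' - ?s i) * ?z) \<le> 2 * (W * \<epsilon>) * norm ?z"
      unfolding norm_mult norm_of_real by (rule mult_right_mono) simp
  qed
  also have "\<dots> = ((W * \<omega> + 2 * (W * \<epsilon>)) * \<delta> + 2 * (W * \<epsilon>)) * norm ?z" by (simp only: algebra_simps)
  finally show ?thesis .
qed

text \<open>By linearity, the new ratio deviates from \<open>r\<close> only through the variation of the old ratio about \<open>r\<close>.\<close>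

lemma subdiv_iter_ratio:
  assumes nz: "\<And>j. v j \<noteq> 0"
  shows "subdiv_iter a m n V i - (r :: complex) * subdiv_iter a m n v i
    = subdiv_iter a m n (\<lambda>j. v j * (V j / v j - r)) (i :: int)"
proof -
  have "(\<lambda>j. v j * (V j / v j - r)) = (\<lambda>j. V j - r * v j)" using nz by (auto simp: algebra_simps)
  then show ?thesis
    by (simp add: subdiv_iter_window[of i i n m] scaleR_diff_right sum_subtractf sum_distrib_left)
qed

text \<open>In the cone, an iterate differs from the old value at the centre of the window by a small fraction,
  so it cannot vanish; this provides the denominators for the ratios.\<close>

lemma near_window_value:
  assumes "kernel_close m n \<beta> \<epsilon>" "\<delta> \<ge> 0" "\<delta> \<le> 1/4" "W * (\<beta> + \<epsilon>) * \<delta> \<le> 1/16" "W * \<epsilon> \<le> \<delta> / 64"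
    and v: "near_const M \<delta> v"
  shows "norm (subdiv_iter a m n v i - v (i div 2 ^ n)) \<le> norm (v (i div 2 ^ n)) / 8"
    "norm (v (i div 2 ^ n)) / 2 \<le> norm (subdiv_iter a m n v i)"
proof -
  let ?z = "norm (v (i div 2 ^ n))"
  have "W * \<epsilon> + W * (\<beta> + \<epsilon>) * \<delta> \<le> 1/8" using assms by linarith
  then have "(W * \<epsilon> + W * (\<beta> + \<epsilon>) * \<delta>) * ?z \<le> 1/8 * ?z" by (rule mult_right_mono) simp
  then show 1: "norm (subdiv_iter a m n v i - v (i div 2 ^ n)) \<le> ?z / 8"
    using subdiv_iter_near[OF assms(1) v, of i] by linarith
  have "?z - norm (subdiv_iter a m n v i) \<le> norm (subdiv_iter a m n v i - v (i div 2 ^ n))"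
    by (metis norm_minus_commute norm_triangle_ineq2)
  moreover have "0 \<le> ?z" by simp
  ultimately show "?z / 2 \<le> norm (subdiv_iter a m n v i)" using 1 by linarith
qed

text \<open>Two effects move the difference of neighbouring new values: differences of kernel rows, which
  multiply the variation \<open>\<delta>\<close> of the old data by a small factor, and the error of the row sums, which
  is small compared with \<open>\<delta>\<close>. Together they stay well below \<open>\<delta>\<close> times a new value.\<close>

lemma cone_invariant:
  assumes cl: "kernel_close m n \<beta> \<epsilon>" and nn: "int M + 1 \<le> 2 ^ n"
    and sm: "\<And>i i'. \<bar>i' - i\<bar> \<le> int M + 1 \<Longrightarrow> \<bar>stationary_kernel n i' - stationary_kernel n i\<bar> \<le> \<omega>"
    and num: "\<delta> \<ge> 0" "\<delta> \<le> 1/4" "W * (\<beta> + \<epsilon>) * \<delta> \<le> 1/16" "W * \<epsilon> \<le> \<delta> / 64" "W * \<omega> \<le> 1/32"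
    and v: "near_const M \<delta> v" and i': "\<bar>i' - i\<bar> \<le> int M + 1"
  shows "norm (subdiv_iter a m n v i' - subdiv_iter a m n v i) \<le> \<delta> / 8 * norm (v (i div 2 ^ n))"
    and "norm (subdiv_iter a m n v i' - subdiv_iter a m n v i) \<le> \<delta> * norm (subdiv_iter a m n v i)"
proof -
  let ?z = "norm (v (i div 2 ^ n))"
  have \<epsilon>: "0 \<le> W * \<epsilon>" using cl unfolding kernel_close_def by simp
  have "W * \<omega> + 2 * (W * \<epsilon>) \<le> 1/16" using num \<epsilon> by linarith
  then have "(W * \<omega> + 2 * (W * \<epsilon>)) * \<delta> \<le> 1/16 * \<delta>" using num by (intro mult_right_mono) auto
  then have "(W * \<omega> + 2 * (W * \<epsilon>)) * \<delta> + 2 * (W * \<epsilon>) \<le> \<delta> / 8" using num by linarith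
  then have "((W * \<omega> + 2 * (W * \<epsilon>)) * \<delta> + 2 * (W * \<epsilon>)) * ?z \<le> \<delta> / 8 * ?z"
    by (rule mult_right_mono) simp
  then show 1: "norm (subdiv_iter a m n v i' - subdiv_iter a m n v i) \<le> \<delta> / 8 * ?z"
    using subdiv_iter_cone_diff[OF cl i' nn sm v] by linarith
  have "\<delta> * (?z / 2) \<le> \<delta> * norm (subdiv_iter a m n v i)"
    using near_window_value(2)[OF cl num(1-4) v, of i] num by (intro mult_left_mono) auto
  moreover have "\<delta> / 8 * ?z \<le> \<delta> * (?z / 2)" using num by simp
  ultimately show "norm (subdiv_iter a m n v i' - subdiv_iter a m n v i) \<le> \<delta> * norm (subdiv_iter a m n v i)"
    using 1 by linarith
qed

lemma ratio_numerator_bound: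
  assumes v: "near_const M \<delta> v" and "\<delta> \<le> 1/4" and osc: "osc_le M d (\<lambda>j. V j / v j)"
    and j: "\<bar>j - q\<bar> \<le> int M + 1"
  shows "norm (v j * (V j / v j - V q / v q)) \<le> 5/4 * d * norm (v q)"
proof -
  have d: "0 \<le> d" using osc_leD[OF osc, of q q] by simp
  have "norm (v j) \<le> norm (v q) + norm (v j - v q)" using norm_triangle_sub by blast
  also have "\<dots> \<le> norm (v q) + \<delta> * norm (v q)" using near_constD[OF v j] by simp
  also have "\<dots> \<le> norm (v q) + 1/4 * norm (v q)" using assms(2) by (intro add_left_mono mult_right_mono) auto
  finally have "norm (v j) \<le> 5/4 * norm (v q)" by simp
  then have "norm (v j) * norm (V j / v j - V q / v q) \<le> 5/4 * norm (v q) * d"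
    using osc_leD[OF osc j] by (intro mult_mono) auto
  then show ?thesis by (simp only: norm_mult mult_ac)
qed

lemma ratio_near:
  assumes cl: "kernel_close m n \<beta> \<epsilon>"
    and num: "\<delta> \<ge> 0" "\<delta> \<le> 1/4" "W * (\<beta> + \<epsilon>) * \<delta> \<le> 1/16" "W * \<epsilon> \<le> \<delta> / 64"
    and v: "near_const M \<delta> v" "\<And>j. v j \<noteq> 0" and osc: "osc_le M d (\<lambda>j. V j / v j)"
  shows "norm (subdiv_iter a m n V i / subdiv_iter a m n v i - V (i div 2 ^ n) / v (i div 2 ^ n))
    \<le> 5/2 * (W * (\<beta> + \<epsilon>)) * d"
proof -
  let ?q = "i div 2 ^ n"
  let ?r = "V ?q / v ?q" and ?z = "norm (v ?q)"
  let ?u = "\<lambda>j. v j * (V j / v j - ?r)"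
  let ?P = "subdiv_iter a m n"
  have z: "?z > 0" using v(2) by simp
  have den: "?z / 2 \<le> norm (?P v i)" by (rule near_window_value(2)[OF cl num v(1)])
  then have "?P v i \<noteq> 0" using z by auto
  then have "?P V i / ?P v i - ?r = ?P ?u i / ?P v i"
    using subdiv_iter_ratio[of v m n V i ?r] v(2) by (simp add: field_simps)
  moreover have num: "norm (?P ?u i) \<le> W * ((\<beta> + \<epsilon>) * (5/4 * d * ?z))"
    by (rule subdiv_iter_bound[OF cl, of i i])
      (simp, rule ratio_numerator_bound[OF v(1) num(2) osc])
  ultimately have "norm (?P V i / ?P v i - ?r) \<le> W * ((\<beta> + \<epsilon>) * (5/4 * d * ?z)) / (?z / 2)"
    using den z order_trans[OF norm_ge_zero num] by (simp only: norm_divide) (rule frac_le; linarith)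
  also have "\<dots> = 5/2 * (W * (\<beta> + \<epsilon>)) * d" using z by (simp add: field_simps)
  finally show ?thesis .
qed

text \<open>Write \<open>u = V - r v\<close>, where \<open>r\<close> is the ratio at the centre of the window, so that \<open>u\<close> is at most a
  multiple of \<open>d \<bar>v\<bar>\<close> on the window. The difference of \<open>P u / P v\<close> at two neighbours, for the product \<open>P\<close>
  of operators, is caused by the change of \<open>P u\<close>, small because kernel rows change slowly, and
  by the change of \<open>P v\<close>, small by invariance of the cone.\<close>

lemma ratio_contracts:
  assumes cl: "kernel_close m n \<beta> \<epsilon>" and nn: "int M + 1 \<le> 2 ^ n"
    and sm: "\<And>i i'. \<bar>i' - i\<bar> \<le> int M + 1 \<Longrightarrow> \<bar>stationary_kernel n i' - stationary_kernel n i\<bar> \<le> \<omega>"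
    and num: "\<delta> \<ge> 0" "\<delta> \<le> 1/4" "W * (\<beta> + \<epsilon>) * \<delta> \<le> 1/16" "W * \<epsilon> \<le> \<delta> / 64" "W * \<omega> \<le> 1/32"
    and v: "near_const M \<delta> v" "\<And>j. v j \<noteq> 0" and osc: "osc_le M d (\<lambda>j. V j / v j)"
  shows "osc_le M (d / 2) (\<lambda>i. subdiv_iter a m n V i / subdiv_iter a m n v i)"
  unfolding osc_le_def
proof (intro allI impI)
  fix i i' assume i': "\<bar>i' - i\<bar> \<le> int M + 1"
  let ?q = "i div 2 ^ n"
  let ?r = "V ?q / v ?q" and ?z = "norm (v ?q)"
  let ?u = "\<lambda>j. v j * (V j / v j - ?r)"
  let ?P = "subdiv_iter a m n"
  have d: "d \<ge> 0" using osc_leD[OF osc, of 0 0] by simp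
  have z: "?z > 0" using v(2) by simp
  have den: "?z / 2 \<le> norm (?P v i)" by (rule near_window_value(2)[OF cl num(1-4) v(1)])
  have dv: "norm (?P v i' - ?P v i) \<le> \<delta> / 8 * ?z"
    by (rule cone_invariant(1)[OF cl nn sm num v(1) i'])
  also have "\<dots> \<le> ?z / 32" using num z by simp
  finally have den': "?z / 4 \<le> norm (?P v i')"
    using den norm_triangle_ineq2[of "?P v i" "?P v i'"] z
    unfolding norm_minus_commute[of "?P v i" "?P v i'"] by linarith
  have nz: "?P v i \<noteq> 0" "?P v i' \<noteq> 0" using den den' z by auto
  have u: "norm (?u j) \<le> 5/4 * d * ?z" if "\<bar>j - ?q\<bar> \<le> int M + 1" for j
    by (rule ratio_numerator_bound[OF v(1) num(2) osc that])
  have "?P V i' / ?P v i' - ?P V i / ?P v i = ?P ?u i' / ?P v i' - ?P ?u i / ?P v i"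
    unfolding subdiv_iter_ratio[OF v(2), symmetric] using nz by (simp add: field_simps)
  also have "\<dots> = (?P ?u i' - ?P ?u i) / ?P v i' + ?P ?u i * (?P v i - ?P v i') / (?P v i * ?P v i')"
    using nz by (simp add: field_simps)
  finally have eq: "?P V i' / ?P v i' - ?P V i / ?P v i
    = (?P ?u i' - ?P ?u i) / ?P v i' + ?P ?u i * (?P v i - ?P v i') / (?P v i * ?P v i')" .
  have "norm (?P V i' / ?P v i' - ?P V i / ?P v i) \<le> (5/64 * d * ?z) / (?z / 4) + (5/4 * d * ?z * (1/128 * ?z)) / (?z / 2 * (?z / 4))"
    unfolding eq
  proof (rule norm_triangle_mono)
    have \<epsilon>: "0 \<le> W * \<epsilon>" using cl unfolding kernel_close_def by simp
    have regroup: "W * ((\<omega> + 2 * \<epsilon>) * x) = (W * \<omega> + 2 * (W * \<epsilon>)) * x" for x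
      by (simp only: algebra_simps)
    have "W * \<omega> + 2 * (W * \<epsilon>) \<le> 1/16" using num \<epsilon> by linarith
    then have "(W * \<omega> + 2 * (W * \<epsilon>)) * (5/4 * d * ?z) \<le> 1/16 * (5/4 * d * ?z)"
      using d z by (intro mult_right_mono) auto
    moreover have "norm (?P ?u i' - ?P ?u i) \<le> W * ((\<omega> + 2 * \<epsilon>) * (5/4 * d * ?z))"
      by (rule subdiv_iter_diff_bound[OF cl i' nn sm u])
    ultimately have "norm (?P ?u i' - ?P ?u i) \<le> 5/64 * d * ?z"
      unfolding regroup by linarith
    then show "norm ((?P ?u i' - ?P ?u i) / ?P v i') \<le> (5/64 * d * ?z) / (?z / 4)"
      unfolding norm_divide using den' z d by (intro frac_le) auto
    have num_le: "norm (?P ?u i) \<le> W * ((\<beta> + \<epsilon>) * (5/4 * d * ?z))"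
      by (rule subdiv_iter_bound[OF cl, of i i]) (use u in auto)
    have "norm (?P ?u i) * norm (?P v i - ?P v i')
        \<le> (W * ((\<beta> + \<epsilon>) * (5/4 * d * ?z))) * (\<delta> / 8 * ?z)"
      by (rule mult_mono[OF num_le dv[unfolded norm_minus_commute[of "?P v i'" "?P v i"]] order_trans[OF norm_ge_zero num_le] norm_ge_zero])
    also have "\<dots> = (W * (\<beta> + \<epsilon>) * \<delta>) * (1/8 * (5/4 * d * ?z) * ?z)" by simp
    also have "\<dots> \<le> 1/16 * (1/8 * (5/4 * d * ?z) * ?z)"
      using num d z by (intro mult_right_mono) auto
    finally have num_le': "norm (?P ?u i) * norm (?P v i - ?P v i') \<le> 5/4 * d * ?z * (1/128 * ?z)" by simp
    show "norm (?P ?u i * (?P v i - ?P v i') / (?P v i * ?P v i'))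
        \<le> (5/4 * d * ?z * (1/128 * ?z)) / (?z / 2 * (?z / 4))"
      unfolding norm_divide norm_mult
      by (rule frac_le[OF _ num_le' _ mult_mono[OF den den']]) (use z d in auto)
  qed
  moreover have "(5/64 * d * ?z) / (?z / 4) = 5/16 * d"
    "(5/4 * d * ?z * (1/128 * ?z)) / (?z / 2 * (?z / 4)) = 5/64 * d"
    using z by (simp_all add: divide_simps)
  ultimately show "norm (?P V i' / ?P v i' - ?P V i / ?P v i) \<le> d / 2" using d by linarith
qed

text \<open>Serves for blocks too short for the kernel to vary slowly. The entries of such a block are
  close to one old value each, so starting with variation \<open>\<delta>\<^sup>2\<close> leaves room for the loss.\<close>

lemma short_block_near_const:
  assumes cl: "kernel_close m n \<beta> \<epsilon>"
    and num: "\<delta> \<ge> 0" "\<delta> \<le> 1/4" "W * (\<beta> + \<epsilon>) * \<delta> \<le> 1/16" "W * \<epsilon> \<le> \<delta> / 64"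
    and v: "near_const M (\<delta>\<^sup>2) v"
  shows "near_const M \<delta> (subdiv_iter a m n v)"
  unfolding near_const_def
proof (intro allI impI)
  fix i i' assume i': "\<bar>i' - i\<bar> \<le> int M + 1"
  let ?q = "i div 2 ^ n" and ?q' = "i' div 2 ^ n"
  let ?P = "subdiv_iter a m n v"
  have "W * (\<beta> + \<epsilon>) * \<delta>\<^sup>2 \<le> 1/16 * \<delta>"
    using mult_right_mono[OF num(3,1)] by (simp add: power2_eq_square mult.assoc)
  then have k: "W * \<epsilon> + W * (\<beta> + \<epsilon>) * \<delta>\<^sup>2 \<le> \<delta> / 8" using num by linarith
  have near: "norm (?P l - v (l div 2 ^ n)) \<le> \<delta> / 8 * norm (v (l div 2 ^ n))" for l
    using subdiv_iter_near[OF cl v, of l] mult_right_mono[OF k, of "norm (v (l div 2 ^ n))"] by simp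
  have d2: "\<delta>\<^sup>2 \<le> \<delta> / 4" using mult_left_mono[OF num(2,1)] by (simp add: power2_eq_square)
  have qq: "norm (v ?q' - v ?q) \<le> \<delta> / 4 * norm (v ?q)"
    using near_constD[OF v abs_div_diff_le[OF i'], of n] mult_right_mono[OF d2, of "norm (v ?q)"]
    by simp
  have dz: "\<delta> * norm (v ?q) \<le> 1/4 * norm (v ?q)" using num by (intro mult_right_mono) auto
  have q': "norm (v ?q') \<le> 17/16 * norm (v ?q)"
    using norm_triangle_sub[of "v ?q'" "v ?q"] qq dz by simp
  have "\<delta> / 8 * norm (v ?q') \<le> \<delta> / 8 * (17/16 * norm (v ?q))"
    using num q' by (intro mult_left_mono) auto
  then have n': "norm (?P i' - v ?q') \<le> \<delta> * norm (v ?q) * (17/128)"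
    using near[of i'] by simp
  have "?P i' - ?P i = (?P i' - v ?q') + (v ?q' - v ?q) - (?P i - v ?q)" by simp
  also have "norm \<dots> \<le> norm (?P i' - v ?q') + norm (v ?q' - v ?q) + norm (?P i - v ?q)"
    by (rule order_trans[OF norm_triangle_ineq4 add_right_mono[OF norm_triangle_ineq]])
  also have "\<dots> \<le> \<delta> * norm (v ?q) * (3/4)" using n' qq near[of i] mult_nonneg_nonneg[OF num(1) norm_ge_zero[of "v ?q"]] by simp
  finally have 1: "norm (?P i' - ?P i) \<le> \<delta> * (3/4 * norm (v ?q))" by simp
  have "norm (v ?q) - norm (?P i) \<le> norm (?P i - v ?q)"
    by (metis norm_minus_commute norm_triangle_ineq2)
  then have "3/4 * norm (v ?q) \<le> norm (?P i)" using near[of i] dz norm_ge_zero[of "v ?q"] by linarith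
  then have "\<delta> * (3/4 * norm (v ?q)) \<le> \<delta> * norm (?P i)" using num by (intro mult_left_mono) auto
  then show "norm (?P i' - ?P i) \<le> \<delta> * norm (?P i)" using 1 by linarith
qed

text \<open>The constants have to be chosen in this order: \<open>\<omega>\<close> depends only on \<open>M\<close>, the block length \<open>L\<close> on
  \<open>\<omega>\<close>, the bound \<open>\<beta>\<close> of the kernels on \<open>L\<close>, the aperture \<open>\<delta>\<close> on \<open>\<beta>\<close>, the tolerance \<open>\<epsilon>\<close> on \<open>\<delta>\<close>, and the
  level \<open>m0\<close> on \<open>\<epsilon>\<close>.\<close>

lemma cone_constants:
  obtains L :: nat and \<beta> \<epsilon> \<delta> \<omega> :: real and m0 :: nat
  where "L \<ge> 1" "int M + 1 \<le> 2 ^ L"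
    "\<And>i i'. \<bar>i' - i\<bar> \<le> int M + 1 \<Longrightarrow> \<bar>stationary_kernel L i' - stationary_kernel L i\<bar> \<le> \<omega>"
    "\<delta> > 0" "\<delta> \<le> 1/4" "W * (\<beta> + \<epsilon>) * \<delta> \<le> 1/16" "W * \<epsilon> \<le> \<delta> / 64" "W * \<omega> \<le> 1/32"
    "\<And>m n. m \<ge> m0 \<Longrightarrow> n \<le> L \<Longrightarrow> kernel_close m n \<beta> \<epsilon>"
proof -
  define \<omega> where "\<omega> = 1 / (32 * W)"
  have \<omega>: "\<omega> > 0" "W * \<omega> \<le> 1/32" by (simp_all add: \<omega>_def)
  from limit_kernel_smooth[OF \<omega>(1)] obtain n0 where n0:
    "\<And>n i i'. n \<ge> n0 \<Longrightarrow> \<bar>i' - i\<bar> \<le> int M + 1 \<Longrightarrow> \<bar>stationary_kernel n i' - stationary_kernel n i\<bar> \<le> \<omega>" by blast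
  define L where "L = n0 + M + 1"
  have L: "L \<ge> 1" "L \<ge> n0" by (simp_all add: L_def)
  have "M + 1 < 2 ^ (M + 1)" by (rule less_exp)
  also have "\<dots> \<le> (2::nat) ^ L" by (rule power_increasing) (simp_all add: L_def)
  finally have L2: "int M + 1 \<le> 2 ^ L"
    by (metis Suc_eq_plus1 less_imp_le of_nat_Suc of_nat_le_iff of_nat_numeral of_nat_power add.commute)
  have "\<forall>n. \<exists>B>0. \<forall>i. \<bar>stationary_kernel n i\<bar> \<le> B" using b.kernel_bounded by blast
  then obtain B where B: "\<And>n. B n > 0" "\<And>n i. \<bar>stationary_kernel n i\<bar> \<le> B n" by metis
  define \<beta> where "\<beta> = (\<Sum>n\<le>L. B n)"
  have \<beta>: "B n \<le> \<beta>" if "n \<le> L" for n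
    unfolding \<beta>_def using that B(1) by (intro member_le_sum) (auto simp: less_imp_le)
  have \<beta>0: "\<beta> \<ge> 0" unfolding \<beta>_def using B(1) by (simp add: sum_nonneg less_imp_le)
  define \<delta> where "\<delta> = min (1/4) (1 / (16 * (W * (\<beta> + 1))))"
  have \<delta>: "\<delta> > 0" "\<delta> \<le> 1/4" "\<delta> \<le> 1 / (16 * (W * (\<beta> + 1)))" using \<beta>0 by (simp_all add: \<delta>_def)
  define \<epsilon> where "\<epsilon> = min 1 (\<delta> / (64 * W))"
  have \<epsilon>: "\<epsilon> > 0" "\<epsilon> \<le> 1" "\<epsilon> \<le> \<delta> / (64 * W)" using \<delta> by (simp_all add: \<epsilon>_def)
  have "W * (\<beta> + \<epsilon>) * \<delta> \<le> W * (\<beta> + 1) * (1 / (16 * (W * (\<beta> + 1))))"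
    using \<epsilon> \<delta> \<beta>0 by (intro mult_mono) auto
  also have "\<dots> = 1/16" using \<beta>0 by (simp add: field_simps add_nonneg_eq_0_iff)
  finally have c1: "W * (\<beta> + \<epsilon>) * \<delta> \<le> 1/16" .
  have c2: "W * \<epsilon> \<le> \<delta> / 64" using \<epsilon>(3) by (simp add: field_simps)
  have "\<forall>n. \<exists>m0. \<forall>m\<ge>m0. \<forall>i. \<bar>kernel a m n i - stationary_kernel n i\<bar> \<le> \<epsilon>"
    using kernel_uniform_limit[OF supp_b mask_lim \<epsilon>(1)] by blast
  then obtain m1 where m1: "\<And>n m i. m \<ge> m1 n \<Longrightarrow> \<bar>kernel a m n i - stationary_kernel n i\<bar> \<le> \<epsilon>" by metis
  define m0 where "m0 = Max (m1 ` {..L})"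
  have "kernel_close m n \<beta> \<epsilon>" if "m \<ge> m0" "n \<le> L" for m n
  proof -
    have "m1 n \<le> m0" unfolding m0_def using that by simp
    then have "\<And>i. \<bar>kernel a m n i - stationary_kernel n i\<bar> \<le> \<epsilon>" using m1 that by simp
    moreover have "\<bar>stationary_kernel n i\<bar> \<le> \<beta>" for i using \<beta>[OF that(2)] B(2)[of n i] by linarith
    ultimately show ?thesis unfolding kernel_close_def using \<epsilon> \<beta>0 by simp
  qed
  then show ?thesis using that[OF L(1) L2 n0[OF L(2)] \<delta>(1,2) c1 c2 \<omega>(2)] by blast
qed

text \<open>Cutting \<open>k\<close> steps into blocks of length \<open>L\<close> and at most \<open>L - 1\<close> initial steps turns the halving per block into
  geometric decay, with constants that do not depend on the starting level.\<close>

lemma uniform_ratio_decay: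
  obtains \<delta> \<rho> C D :: real and m0 :: nat
  where "\<delta> > 0" "0 < \<rho>" "\<rho> < 1" "C \<ge> 0" "D \<ge> 0"
    "\<forall>m v. m \<ge> m0 \<longrightarrow> near_const M \<delta> v \<longrightarrow> (\<forall>j. v j \<noteq> 0) \<longrightarrow>
       (\<forall>k i. subdiv_iter a m k v i \<noteq> 0) \<and>
       (\<forall>V d. osc_le M d (\<lambda>j. V j / v j) \<longrightarrow>
          (\<forall>k. osc_le M (d * D * \<rho> ^ k) (\<lambda>i. subdiv_iter a m k V i / subdiv_iter a m k v i)) \<and>
          (\<forall>k i. norm (subdiv_iter a m (Suc k) V i / subdiv_iter a m (Suc k) v i
             - subdiv_iter a m k V (i div 2) / subdiv_iter a m k v (i div 2)) \<le> C * (d * D * \<rho> ^ k)))"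
proof -
  from cone_constants obtain L \<beta> \<epsilon> \<delta> \<omega> m0
    where L: "L \<ge> 1" "int M + 1 \<le> 2 ^ L"
    and sm: "\<And>i i'. \<bar>i' - i\<bar> \<le> int M + 1 \<Longrightarrow> \<bar>stationary_kernel L i' - stationary_kernel L i\<bar> \<le> \<omega>"
    and \<delta>: "\<delta> > 0" "\<delta> \<le> 1/4" and num: "W * (\<beta> + \<epsilon>) * \<delta> \<le> 1/16" "W * \<epsilon> \<le> \<delta> / 64" "W * \<omega> \<le> 1/32"
    and cl: "\<And>m n. m \<ge> m0 \<Longrightarrow> n \<le> L \<Longrightarrow> kernel_close m n \<beta> \<epsilon>" by metis
  have \<delta>0: "\<delta> \<ge> 0" using \<delta> by simp
  define C where "C = 5/2 * (W * (\<beta> + \<epsilon>))"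
  have \<beta>\<epsilon>: "\<beta> \<ge> 0" "\<epsilon> \<ge> 0" using cl[of m0 0] by (auto simp: kernel_close_def)
  then have C: "C \<ge> 0" by (simp add: C_def)
  \<comment> \<open>The rate per step that amounts to halving in \<open>L\<close> steps.\<close>
  define \<rho> where "\<rho> = root L (1/2)"
  have \<rho>: "0 < \<rho>" "\<rho> < 1" "\<rho> ^ L = 1/2" using L by (simp_all add: \<rho>_def)
  \<comment> \<open>A single step increases the oscillation at most by the factor \<open>2 C + 1\<close>; the factor \<open>2 = \<rho> ^ (- L)\<close>
    makes up for the decay claimed during the first \<open>L\<close> steps.\<close>
  define D where "D = 2 * (2 * C + 1) ^ L"
  have D: "D \<ge> 0" using C by (simp add: D_def)
  have split: "subdiv_iter a m k v = subdiv_iter a (m + (k - L)) L (subdiv_iter a m (k - L) v)"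
    if "k \<ge> L" for m k and v :: "int \<Rightarrow> complex"
    using subdiv_iter_add[of a m "k - L" L v] that by simp
  have split1: "subdiv_iter a m (Suc k) v = subdiv_iter a (m + k) 1 (subdiv_iter a m k v)"
    for m k and v :: "int \<Rightarrow> complex"
    using subdiv_iter_add[of a m k 1 v] by simp
  have cone: "near_const M \<delta> (subdiv_iter a m k v)" if "m \<ge> m0" "near_const M (\<delta>\<^sup>2) v" for m k v
  proof (induction k rule: less_induct)
    case (less k)
    show ?case
    proof (cases "k < L")
      case True
      then show ?thesis using that
        by (intro short_block_near_const[OF cl \<delta>0 \<delta>(2) num(1,2)]) auto
    next
      case False
      then have IH: "near_const M \<delta> (subdiv_iter a m (k - L) v)" using L by (intro less) auto
      show ?thesis unfolding split[OF leI[OF False]] near_const_def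
        using cone_invariant(2)[OF cl L(2) sm \<delta>0 \<delta>(2) num IH] that by simp
    qed
  qed
  have nz: "subdiv_iter a m k v i \<noteq> 0" if "m \<ge> m0" "near_const M (\<delta>\<^sup>2) v" "\<And>j. v j \<noteq> 0" for m k v i
  proof (induction k arbitrary: i)
    case (Suc k)
    have "norm (subdiv_iter a m k v (i div 2 ^ 1)) / 2 \<le> norm (subdiv_iter a (m + k) 1 (subdiv_iter a m k v) i)"
      using that L(1) by (intro near_window_value(2)[OF cl \<delta>0 \<delta>(2) num(1,2) cone]) auto
    moreover have "norm (subdiv_iter a m k v (i div 2 ^ 1)) > 0" using Suc by simp
    ultimately show ?case unfolding split1 by (metis half_gt_zero norm_zero not_le)
  qed (use that in auto)
  have step: "norm (subdiv_iter a m (Suc k) V i / subdiv_iter a m (Suc k) v i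
             - subdiv_iter a m k V (i div 2) / subdiv_iter a m k v (i div 2)) \<le> C * d"
    if "m \<ge> m0" "near_const M (\<delta>\<^sup>2) v" "\<And>j. v j \<noteq> 0"
      "osc_le M d (\<lambda>j. subdiv_iter a m k V j / subdiv_iter a m k v j)" for m v V d k i
    unfolding split1 C_def
    using ratio_near[OF cl \<delta>0 \<delta>(2) num(1,2) cone[OF that(1,2)] nz[OF that(1-3)] that(4), of "m + k" 1 i]
      that(1) L(1) by simp
  have osc: "osc_le M (d * D * \<rho> ^ k) (\<lambda>i. subdiv_iter a m k V i / subdiv_iter a m k v i)"
    if m: "m \<ge> m0" and v: "near_const M (\<delta>\<^sup>2) v" "\<And>j. v j \<noteq> 0" and o: "osc_le M d (\<lambda>j. V j / v j)"
    for m v V d k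
  proof (induction k rule: less_induct)
    case (less k)
    have d: "d \<ge> 0" using osc_leD[OF o, of 0 0] by simp
    show ?case
    proof (cases "k < L")
      case True
      have "osc_le M (d * (2 * C + 1) ^ k) (\<lambda>i. subdiv_iter a m k V i / subdiv_iter a m k v i)"
      proof (induction k)
        case 0
        then show ?case using o by simp
      next
        case (Suc k)
        let ?d = "d * (2 * C + 1) ^ k"
        let ?R = "\<lambda>k i. subdiv_iter a m k V i / subdiv_iter a m k v i"
        show ?case unfolding osc_le_def
        proof (intro allI impI)
          fix i i' assume i': "\<bar>i' - i\<bar> \<le> int M + 1"
          have s: "norm (?R (Suc k) l - ?R k (l div 2)) \<le> C * ?d" for l by (rule step[OF m v Suc])
          have "norm (?R k (i' div 2) - ?R k (i div 2)) \<le> ?d"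
            using osc_leD[OF Suc abs_div_diff_le[OF i', of 1]] by simp
          then have "norm (?R (Suc k) i' - ?R (Suc k) i) \<le> C * ?d + ?d + C * ?d"
            using s[of i] s[of i'] norm_triangle_ineq4[of "?R (Suc k) i' - ?R k (i' div 2) + (?R k (i' div 2) - ?R k (i div 2))"
                "?R (Suc k) i - ?R k (i div 2)"]
              norm_triangle_ineq[of "?R (Suc k) i' - ?R k (i' div 2)" "?R k (i' div 2) - ?R k (i div 2)"] by simp
          then show "norm (?R (Suc k) i' - ?R (Suc k) i) \<le> d * (2 * C + 1) ^ Suc k"
            by (simp add: algebra_simps)
        qed
      qed
      moreover have "d * (2 * C + 1) ^ k \<le> d * D * \<rho> ^ k"
      proof -
        have "(2 * C + 1) ^ k \<le> (2 * C + 1) ^ L" using C True by (intro power_increasing) auto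
        moreover have "\<rho> ^ L \<le> \<rho> ^ k" using \<rho> True by (intro power_decreasing) auto
        then have "D * \<rho> ^ L \<le> D * \<rho> ^ k" using D by (rule mult_left_mono)
        ultimately have "(2 * C + 1) ^ k \<le> D * \<rho> ^ k" using \<rho>(3) by (simp add: D_def)
        then show ?thesis using d mult_left_mono by (metis mult.assoc)
      qed
      ultimately show ?thesis unfolding osc_le_def by (meson order_trans)
    next
      case False
      let ?v = "subdiv_iter a m (k - L) v"
      have IH: "osc_le M (d * D * \<rho> ^ (k - L)) (\<lambda>i. subdiv_iter a m (k - L) V i / ?v i)"
        using False L by (intro less) auto
      have "osc_le M (d * D * \<rho> ^ (k - L) / 2) (\<lambda>i. subdiv_iter a m k V i / subdiv_iter a m k v i)"
        unfolding split[OF leI[OF False]]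
        using m by (intro ratio_contracts[OF cl L(2) sm \<delta>0 \<delta>(2) num cone[OF m v(1)] nz[OF m v] IH]) auto
      also have "d * D * \<rho> ^ (k - L) / 2 = d * D * (\<rho> ^ (k - L) * \<rho> ^ L)" using \<rho>(3) by simp
      also have "\<dots> = d * D * \<rho> ^ k" using False by (simp only: power_add[symmetric]) simp
      finally show ?thesis .
    qed
  qed
  have decay: "\<forall>m v. m \<ge> m0 \<longrightarrow> near_const M (\<delta>\<^sup>2) v \<longrightarrow> (\<forall>j. v j \<noteq> 0) \<longrightarrow>
       (\<forall>k i. subdiv_iter a m k v i \<noteq> 0) \<and>
       (\<forall>V d. osc_le M d (\<lambda>j. V j / v j) \<longrightarrow>
          (\<forall>k. osc_le M (d * D * \<rho> ^ k) (\<lambda>i. subdiv_iter a m k V i / subdiv_iter a m k v i)) \<and>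
          (\<forall>k i. norm (subdiv_iter a m (Suc k) V i / subdiv_iter a m (Suc k) v i
             - subdiv_iter a m k V (i div 2) / subdiv_iter a m k v (i div 2)) \<le> C * (d * D * \<rho> ^ k)))"
  proof (intro allI impI conjI)
    fix m v k i assume *: "m \<ge> m0" "near_const M (\<delta>\<^sup>2) v" "\<forall>j. v j \<noteq> 0"
    then show "subdiv_iter a m k v i \<noteq> 0" by (intro nz) auto
    fix V d assume o: "osc_le M d (\<lambda>j. V j / v j)"
    show "osc_le M (d * D * \<rho> ^ k) (\<lambda>i. subdiv_iter a m k V i / subdiv_iter a m k v i)"
      by (rule osc[OF *(1,2) _ o]) (use *(3) in auto)
    then show "norm (subdiv_iter a m (Suc k) V i / subdiv_iter a m (Suc k) v i
             - subdiv_iter a m k V (i div 2) / subdiv_iter a m k v (i div 2)) \<le> C * (d * D * \<rho> ^ k)"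
      by (rule step[OF *(1,2), rotated]) (use *(3) in auto)
  qed
  have "\<delta>\<^sup>2 > 0" using \<delta>(1) by simp
  then show ?thesis using \<rho>(1,2) C D decay by (rule that)
qed

end

section \<open>Basic limit functions\<close>

lemma asymptotically_similar_mask_lim:
  assumes "asymptotically_similar a b"
  shows "(\<lambda>k. a k i) \<longlonglongrightarrow> b i"
proof (rule tendstoI)
  fix e :: real assume "e > 0"
  have "\<forall>\<epsilon>>0. \<forall>\<^sub>F k in sequentially. \<forall>i\<in>UNIV. \<bar>a k i - b i\<bar> \<le> \<epsilon>"
    using assms unfolding asymptotically_similar_def by (subst (asm) SUP_ereal_tendsto_0_iff) auto
  then have "\<forall>\<^sub>F k in sequentially. \<forall>i\<in>UNIV. \<bar>a k i - b i\<bar> \<le> e / 2" using half_gt_zero[OF \<open>e > 0\<close>] by blast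
  then show "\<forall>\<^sub>F k in sequentially. dist (a k i) (b i) < e"
  proof (rule eventually_mono)
    fix k assume "\<forall>i\<in>UNIV. \<bar>a k i - b i\<bar> \<le> e / 2"
    then have "\<bar>a k i - b i\<bar> \<le> e / 2" by simp
    then show "dist (a k i) (b i) < e" using \<open>e > 0\<close> by (simp add: dist_real_def)
  qed
qed

context supported_masks
begin

text \<open>Near \<open>0\<close>, iterates at two consecutive late levels are all close to the same value \<open>g 0 \<noteq> 0\<close>. Passing
  to the limit in one subdivision step shows that each row of \<open>b\<close> sums to \<open>1\<close>.\<close>

lemma limit_mask_preserves_one:
  fixes v :: "int \<Rightarrow> complex"
  assumes b: "mask_supported M b" "\<And>i. (\<lambda>k. a k i) \<longlonglongrightarrow> b i"
    and lim: "is_local_subdiv_limit a 0 v g" and "g 0 \<noteq> 0"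
  shows "subdiv b (\<lambda>_. 1 :: real) = (\<lambda>_. 1)"
proof
  fix i
  let ?L = "{l. \<bar>i - 2 * l\<bar> \<le> int M}"
  have fixed: "(\<lambda>k. subdiv_iter a 0 k v l) \<longlonglongrightarrow> g 0" for l
  proof (rule local_subdiv_limit_tendsto[OF lim])
    have "(\<lambda>k. real_of_int l * (1/2) ^ k) \<longlonglongrightarrow> real_of_int l * 0"
      by (intro tendsto_intros LIMSEQ_power_zero) simp
    then show "(\<lambda>k. real_of_int l / 2 ^ k) \<longlonglongrightarrow> 0" by (simp add: power_divide)
  qed
  have "subdiv_iter a 0 (Suc k) v i = (\<Sum>l\<in>?L. a k (i - 2 * l) *\<^sub>R subdiv_iter a 0 k v l)" for k
    by (simp add: subdiv_eq_sum[OF supp finite_row])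
  moreover have "(\<lambda>k. \<Sum>l\<in>?L. a k (i - 2 * l) *\<^sub>R subdiv_iter a 0 k v l)
      \<longlonglongrightarrow> (\<Sum>l\<in>?L. b (i - 2 * l) *\<^sub>R g 0)"
    by (intro tendsto_intros b(2) fixed)
  ultimately have "(\<lambda>k. subdiv_iter a 0 (Suc k) v i) \<longlonglongrightarrow> (\<Sum>l\<in>?L. b (i - 2 * l)) *\<^sub>R g 0"
    by (simp only: scaleR_sum_left)
  then have "(\<Sum>l\<in>?L. b (i - 2 * l)) *\<^sub>R g 0 = g 0"
    using LIMSEQ_Suc[OF fixed[of i]] by (rule LIMSEQ_unique)
  then have "(\<Sum>l\<in>?L. b (i - 2 * l)) = 1"
    using \<open>g 0 \<noteq> 0\<close> by (metis scaleR_cancel_right scaleR_one)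
  then show "subdiv b (\<lambda>_. 1 :: real) i = 1"
    by (simp add: subdiv_eq_sum[OF b(1) finite_row])
qed

lemma kernel_tendsto_limit:
  assumes "is_subdiv_limit a m unit_seq g"
    and "(\<lambda>k. real_of_int (i k) / 2 ^ k) \<longlonglongrightarrow> x"
  shows "(\<lambda>k. kernel a m k (i k)) \<longlonglongrightarrow> g x"
  unfolding kernel_def
  by (rule local_subdiv_limit_tendsto[OF is_local_subdiv_limit_if_is_subdiv_limit[OF assms(1)] assms(2)])

lemma eventually_floor_outside:
  assumes "\<bar>x\<bar> > real M"
  shows "\<forall>\<^sub>F k in sequentially. \<bar>\<lfloor>2 ^ k * x\<rfloor>\<bar> > int M * 2 ^ k"
proof -
  have "(\<lambda>k. \<bar>real_of_int \<lfloor>2 ^ k * x\<rfloor> / 2 ^ k\<bar>) \<longlonglongrightarrow> \<bar>x\<bar>"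
    by (intro tendsto_intros floor_dyadic_tendsto)
  then have "\<forall>\<^sub>F k in sequentially. \<bar>real_of_int \<lfloor>2 ^ k * x\<rfloor> / 2 ^ k\<bar> > real M"
    using assms by (rule order_tendstoD)
  then show ?thesis
  proof (rule eventually_mono)
    fix k assume "\<bar>real_of_int \<lfloor>2 ^ k * x\<rfloor> / 2 ^ k\<bar> > real M"
    then have "real_of_int \<bar>\<lfloor>2 ^ k * x\<rfloor>\<bar> > real_of_int (int M * 2 ^ k)"
      by (simp add: abs_divide field_simps)
    then show "\<bar>\<lfloor>2 ^ k * x\<rfloor>\<bar> > int M * 2 ^ k" by (simp only: of_int_less_iff)
  qed
qed

text \<open>Off \<open>[-M, M]\<close> the kernels vanish at all late steps along grid points approaching \<open>x\<close>.\<close>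

lemma limit_support:
  assumes "is_subdiv_limit a m unit_seq g" "\<bar>x\<bar> > real M"
  shows "g x = 0"
proof -
  have "(\<lambda>k. kernel a m k \<lfloor>2 ^ k * x\<rfloor>) \<longlonglongrightarrow> g x"
    by (rule kernel_tendsto_limit[OF assms(1) floor_dyadic_tendsto])
  moreover have "(\<lambda>k. kernel a m k \<lfloor>2 ^ k * x\<rfloor>) \<longlonglongrightarrow> 0"
    by (rule tendsto_eventually, rule eventually_mono[OF eventually_floor_outside[OF assms(2)]])
      (rule kernel_support')
  ultimately show ?thesis by (rule LIMSEQ_unique)
qed

lemma limit_uniformly_continuous:
  assumes g: "is_subdiv_limit a m unit_seq g" and "\<epsilon> > 0"
  shows "\<exists>d>0. \<forall>x y. \<bar>x - y\<bar> < d \<longrightarrow> \<bar>g x - g y\<bar> \<le> \<epsilon>"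
proof -
  let ?I = "{- real M - 1 .. real M + 1}"
  have "continuous_on ?I g"
    using g unfolding is_subdiv_limit_def by (auto intro: continuous_on_subset)
  then have "uniformly_continuous_on ?I g" by (intro compact_uniformly_continuous) auto
  then obtain d where d: "d > 0" "\<And>x y. x \<in> ?I \<Longrightarrow> y \<in> ?I \<Longrightarrow> dist y x < d \<Longrightarrow> dist (g y) (g x) < \<epsilon>"
    unfolding uniformly_continuous_on_def using \<open>\<epsilon> > 0\<close> by meson
  have "\<bar>g x - g y\<bar> \<le> \<epsilon>" if xy: "\<bar>x - y\<bar> < min d 1" for x y
  proof (cases "x \<in> ?I \<and> y \<in> ?I")
    case True
    then show ?thesis using d(2)[of x y] xy by (auto simp: dist_real_def abs_minus_commute)
  next
    case False
    then have "\<bar>x\<bar> > real M" "\<bar>y\<bar> > real M" using xy by auto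
    then show ?thesis using limit_support[OF g] \<open>\<epsilon> > 0\<close> by simp
  qed
  then show ?thesis using d(1) by (intro exI[of _ "min d 1"]) auto
qed

text \<open>The kernel is close to samples of the limit function on a fine grid, and that function is uniformly
  continuous, being continuous with compact support.\<close>

lemma kernel_smooth_if_limit:
  assumes g: "is_subdiv_limit a m unit_seq g" and "\<omega> > 0"
  shows "\<exists>n0. \<forall>n\<ge>n0. \<forall>i i'. \<bar>i' - i\<bar> \<le> K \<longrightarrow> \<bar>kernel a m n i' - kernel a m n i\<bar> \<le> \<omega>"
proof -
  obtain d where d: "d > 0" "\<And>x y. \<bar>x - y\<bar> < d \<Longrightarrow> \<bar>g x - g y\<bar> \<le> \<omega> / 3"
    using limit_uniformly_continuous[OF g, of "\<omega> / 3"] \<open>\<omega> > 0\<close> by auto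
  have "\<forall>\<^sub>F k in sequentially. \<forall>i. norm (g (real_of_int i / 2 ^ k) - kernel a m k i) \<le> \<omega> / 3"
    using g \<open>\<omega> > 0\<close> unfolding is_subdiv_limit_iff kernel_def
    by (elim conjE allE[of _ "\<omega> / 3"]) simp
  moreover have "\<forall>\<^sub>F k in sequentially. real_of_int K / 2 ^ k < d"
  proof -
    have "(\<lambda>k. real_of_int K * (1/2) ^ k) \<longlonglongrightarrow> real_of_int K * 0"
      by (intro tendsto_intros LIMSEQ_power_zero) simp
    then have "(\<lambda>k. real_of_int K / 2 ^ k) \<longlonglongrightarrow> 0" by (simp add: power_divide)
    then show ?thesis using d(1) by (rule order_tendstoD)
  qed
  ultimately have "\<forall>\<^sub>F n in sequentially. \<forall>i i'. \<bar>i' - i\<bar> \<le> K \<longrightarrow> \<bar>kernel a m n i' - kernel a m n i\<bar> \<le> \<omega>"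
  proof eventually_elim
    case (elim n)
    show ?case
    proof (intro allI impI)
      fix i i' :: int assume "\<bar>i' - i\<bar> \<le> K"
      then have "real_of_int \<bar>i' - i\<bar> / 2 ^ n \<le> real_of_int K / 2 ^ n"
        by (intro divide_right_mono) (simp_all only: of_int_le_iff, simp)
      then have "\<bar>real_of_int i' / 2 ^ n - real_of_int i / 2 ^ n\<bar> < d"
        using elim(2) by (simp add: diff_divide_distrib[symmetric] abs_divide)
      then have "\<bar>g (real_of_int i' / 2 ^ n) - g (real_of_int i / 2 ^ n)\<bar> \<le> \<omega> / 3" by (rule d(2))
      moreover have "\<bar>g (real_of_int i' / 2 ^ n) - kernel a m n i'\<bar> \<le> \<omega> / 3"
        "\<bar>g (real_of_int i / 2 ^ n) - kernel a m n i\<bar> \<le> \<omega> / 3"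
        using elim(1) by auto
      ultimately show "\<bar>kernel a m n i' - kernel a m n i\<bar> \<le> \<omega>" by linarith
    qed
  qed
  then show ?thesis unfolding eventually_sequentially .
qed

lemma of_real_kernel:
  "subdiv_iter a m k (\<lambda>j. complex_of_real (unit_seq j)) i = complex_of_real (kernel a m k i)"
proof -
  have "kernel a m k i = (\<Sum>j\<in>window k i. kernel a m k (i - 2 ^ k * j) * unit_seq j)"
    using subdiv_iter_window[of i i k m unit_seq] by (simp add: kernel_def)
  then show ?thesis by (simp add: subdiv_iter_window[of i i k] scaleR_conv_of_real)
qed

lemma kernel_one: "kernel a m 1 i = a m i"
proof -
  let ?J = "insert 0 {j. \<bar>i - 2 * j\<bar> \<le> int M}"
  have "kernel a m 1 i = (\<Sum>j\<in>?J. a m (i - 2 * j) * unit_seq j)"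
    unfolding kernel_def using subdiv_eq_sum[OF supp, of ?J i m unit_seq] finite_row by simp
  also have "\<dots> = (\<Sum>j\<in>?J. if j = 0 then a m i else 0)"
    by (rule sum.cong) (auto simp: unit_seq_def)
  also have "\<dots> = a m i" using finite_row by (subst sum.delta) auto
  finally show ?thesis .
qed

lemma kernel_refine:
  "kernel a m (Suc k) i = (\<Sum>j\<in>{- int M .. int M}. kernel a (Suc m) k (i - 2 ^ k * j) * a m j)"
proof -
  let ?J = "{- int M .. int M} \<union> window k i"
  have "kernel a m (Suc k) i = subdiv_iter a (Suc m) k (kernel a m 1) i"
    unfolding kernel_def using subdiv_iter_add[of a m 1 k unit_seq] by simp
  also have "\<dots> = (\<Sum>j\<in>?J. kernel a (Suc m) k (i - 2 ^ k * j) * a m j)"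
    unfolding real_scaleR_def[symmetric] kernel_one[of m, symmetric]
    by (rule subdiv_iter_eq_sum) (auto intro: in_window[of i i])
  also have "\<dots> = (\<Sum>j\<in>{- int M .. int M}. kernel a (Suc m) k (i - 2 ^ k * j) * a m j)"
    by (rule sum.mono_neutral_right) (use supp[of m] in \<open>auto simp: mask_supported_def\<close>)
  finally show ?thesis .
qed

text \<open>The refinement equation: one step from level \<open>m\<close> turns the impulse into the mask \<open>a m\<close>, to which the
  scheme from level \<open>m + 1\<close> is applied. This transports limits from a level to the preceding one.\<close>

lemma basic_limit_refine:
  assumes g: "is_subdiv_limit a (Suc m) unit_seq g"
  shows "is_subdiv_limit a m unit_seq (\<lambda>x. \<Sum>j\<in>{- int M .. int M}. g (2 * x - real_of_int j) * a m j)"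
    (is "is_subdiv_limit a m unit_seq ?h")
  unfolding is_subdiv_limit_iff
proof (intro conjI allI impI)
  have gc: "continuous_on UNIV g" using g by (simp add: is_subdiv_limit_def)
  show "continuous_on UNIV ?h"
    by (intro continuous_intros continuous_on_compose2[OF gc]) auto
  fix \<epsilon> :: real assume "\<epsilon> > 0"
  define S where "S = (\<Sum>j\<in>{- int M .. int M}. \<bar>a m j\<bar>)"
  have S: "S \<ge> 0" by (simp add: S_def sum_nonneg)
  have "\<forall>\<^sub>F k in sequentially. \<forall>i. norm (g (real_of_int i / 2 ^ k) - kernel a (Suc m) k i) \<le> \<epsilon> / (S + 1)"
    using g \<open>\<epsilon> > 0\<close> S unfolding is_subdiv_limit_iff kernel_def by simp
  then have "\<forall>\<^sub>F k in sequentially. \<forall>i. norm (?h (real_of_int i / 2 ^ Suc k) - kernel a m (Suc k) i) \<le> \<epsilon>"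
  proof (rule eventually_mono, intro allI)
    fix k i
    assume *: "\<forall>i. norm (g (real_of_int i / 2 ^ k) - kernel a (Suc m) k i) \<le> \<epsilon> / (S + 1)"
    have arg: "2 * (real_of_int i / 2 ^ Suc k) - real_of_int j = real_of_int (i - 2 ^ k * j) / 2 ^ k" for j
      by (simp add: field_simps)
    have "?h (real_of_int i / 2 ^ Suc k) - kernel a m (Suc k) i
        = (\<Sum>j\<in>{- int M .. int M}. (g (real_of_int (i - 2 ^ k * j) / 2 ^ k) - kernel a (Suc m) k (i - 2 ^ k * j)) * a m j)"
      unfolding arg kernel_refine by (simp add: sum_subtractf left_diff_distrib)
    also have "norm \<dots> \<le> (\<Sum>j\<in>{- int M .. int M}. \<epsilon> / (S + 1) * \<bar>a m j\<bar>)"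
    proof (rule sum_norm_le)
      fix j
      show "norm ((g (real_of_int (i - 2 ^ k * j) / 2 ^ k) - kernel a (Suc m) k (i - 2 ^ k * j)) * a m j)
          \<le> \<epsilon> / (S + 1) * \<bar>a m j\<bar>"
        unfolding norm_mult real_norm_def[of "a m j"] by (rule mult_right_mono) (use * in blast, simp)
    qed
    also have "\<dots> = \<epsilon> / (S + 1) * S" by (simp add: S_def sum_distrib_left)
    also have "\<dots> \<le> \<epsilon>" using S \<open>\<epsilon> > 0\<close> by (simp add: field_simps)
    finally show "norm (?h (real_of_int i / 2 ^ Suc k) - kernel a m (Suc k) i) \<le> \<epsilon>" .
  qed
  then show "\<forall>\<^sub>F k in sequentially. \<forall>i. norm (?h (real_of_int i / 2 ^ k) - subdiv_iter a m k unit_seq i) \<le> \<epsilon>"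
    unfolding kernel_def by (subst eventually_sequentially_Suc[symmetric])
qed

end

text \<open>The ratio of two samples depends only on the difference of the grid points, which tends to \<open>0\<close>
  when the grid is refined.\<close>

lemma exp_samples_near_const:
  assumes "\<delta> > 0"
  shows "\<exists>m0. \<forall>m\<ge>m0. near_const M \<delta> (\<lambda>i. exp (l * of_real (grid \<nu> m i)))"
proof -
  let ?K = "{- (int M + 1) .. int M + 1}"
  have "\<forall>k\<in>?K. \<forall>\<^sub>F m in sequentially. norm (exp (l * of_real (real_of_int k / 2 ^ m)) - 1) \<le> \<delta>"
  proof
    fix k
    have "(\<lambda>m. real_of_int k * (1/2) ^ m) \<longlonglongrightarrow> real_of_int k * 0"
      by (intro tendsto_intros LIMSEQ_power_zero) simp
    then have "(\<lambda>m. real_of_int k / 2 ^ m) \<longlonglongrightarrow> 0" by (simp add: power_divide)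
    then have "(\<lambda>m. exp (l * of_real (real_of_int k / 2 ^ m)) - 1) \<longlonglongrightarrow> exp (l * of_real 0) - 1"
      by (intro tendsto_intros)
    then have "(\<lambda>m. exp (l * of_real (real_of_int k / 2 ^ m)) - 1) \<longlonglongrightarrow> 0" by simp
    then have "\<forall>\<^sub>F m in sequentially. dist (exp (l * of_real (real_of_int k / 2 ^ m)) - 1) 0 < \<delta>"
      using assms by (rule tendstoD)
    then show "\<forall>\<^sub>F m in sequentially. norm (exp (l * of_real (real_of_int k / 2 ^ m)) - 1) \<le> \<delta>"
      by (rule eventually_mono) (simp add: dist_norm)
  qed
  then have "\<forall>\<^sub>F m in sequentially. \<forall>k\<in>?K. norm (exp (l * of_real (real_of_int k / 2 ^ m)) - 1) \<le> \<delta>"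
    by (intro eventually_ball_finite) auto
  then obtain m0 where m0: "\<And>m k. m \<ge> m0 \<Longrightarrow> k \<in> ?K \<Longrightarrow> norm (exp (l * of_real (real_of_int k / 2 ^ m)) - 1) \<le> \<delta>"
    unfolding eventually_sequentially by blast
  have "near_const M \<delta> (\<lambda>i. exp (l * of_real (grid \<nu> m i)))" if "m \<ge> m0" for m
    unfolding near_const_def
  proof (intro allI impI)
    fix j j' :: int assume j: "\<bar>j' - j\<bar> \<le> int M + 1"
    have "grid \<nu> m j' = real_of_int (j' - j) / 2 ^ m + grid \<nu> m j" by (simp add: grid_def field_simps)
    then have "exp (l * of_real (grid \<nu> m j')) - exp (l * of_real (grid \<nu> m j))
        = (exp (l * of_real (real_of_int (j' - j) / 2 ^ m)) - 1) * exp (l * of_real (grid \<nu> m j))"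
      by (simp only: of_real_add distrib_left exp_add left_diff_distrib mult_1)
    moreover have "norm (exp (l * of_real (real_of_int (j' - j) / 2 ^ m)) - 1) \<le> \<delta>"
      by (rule m0) (use that j in auto)
    ultimately show "norm (exp (l * of_real (grid \<nu> m j')) - exp (l * of_real (grid \<nu> m j)))
        \<le> \<delta> * norm (exp (l * of_real (grid \<nu> m j)))"
      by (simp only: norm_mult) (rule mult_right_mono, auto)
  qed
  then show ?thesis by blast
qed

lemma floor_double_div: "\<lfloor>2 ^ Suc k * x\<rfloor> div 2 = \<lfloor>2 ^ k * x :: real\<rfloor>"
  using floor_divide_real_eq_div[of 2 "2 ^ Suc k * x"] by simp

context perturbed_scheme
begin

text \<open>The ratios \<open>R k\<close> of the kernels to the iterates \<open>E k\<close> of the exponential samples change from step to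
  step by geometrically decaying amounts, hence converge uniformly to a continuous function \<open>\<psi>\<close> with
  compact support. As \<open>E k\<close> converges locally uniformly to the exponential, the kernels converge
  to the product of \<open>\<psi>\<close> and the exponential.\<close>

lemma uniform_limits_late_levels:
  fixes l :: complex
  assumes repr: "\<And>m. is_local_subdiv_limit a m (\<lambda>i. exp (l * of_real (grid \<nu> m i))) (\<lambda>x. exp (l * of_real (x / 2 ^ m)))"
    and \<nu>: "\<nu> \<le> 1"
  shows "\<exists>B m0. \<forall>m\<ge>m0. \<exists>\<phi>. is_subdiv_limit a m unit_seq \<phi> \<and> (\<forall>x. \<bar>\<phi> x\<bar> \<le> B)"
proof -
  let ?e = "\<lambda>m i. exp (l * of_real (grid \<nu> m i))"
  let ?V = "\<lambda>j. complex_of_real (unit_seq j)"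
  obtain \<delta> \<rho> C D m1
    where \<delta>: "\<delta> > 0" and \<rho>: "0 < \<rho>" "\<rho> < 1" and CD: "C \<ge> 0" "D \<ge> 0"
    and decay: "\<forall>m v. m \<ge> m1 \<longrightarrow> near_const M \<delta> v \<longrightarrow> (\<forall>j. v j \<noteq> 0) \<longrightarrow>
       (\<forall>k i. subdiv_iter a m k v i \<noteq> 0) \<and>
       (\<forall>V d. osc_le M d (\<lambda>j. V j / v j) \<longrightarrow>
          (\<forall>k. osc_le M (d * D * \<rho> ^ k) (\<lambda>i. subdiv_iter a m k V i / subdiv_iter a m k v i)) \<and>
          (\<forall>k i. norm (subdiv_iter a m (Suc k) V i / subdiv_iter a m (Suc k) v i
             - subdiv_iter a m k V (i div 2) / subdiv_iter a m k v (i div 2)) \<le> C * (d * D * \<rho> ^ k)))"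
    by (rule uniform_ratio_decay)
  obtain m2 where m2: "\<And>m. m \<ge> m2 \<Longrightarrow> near_const M \<delta> (?e m)"
    using exp_samples_near_const[OF \<delta>] by blast
  define m0 where "m0 = max m1 m2"
  define X where "X = exp (norm l)"
  \<comment> \<open>The initial ratio is nonzero at the index \<open>0\<close> only, where it is at most \<open>X\<close> because the grid point
    belonging to the index \<open>0\<close> lies in \<open>[-1, 1]\<close>.\<close>
  define d where "d = 2 * X"
  define T where "T = C * (d * D) / (1 - \<rho>)"
  define G where "G = exp (norm l * real M)"
  define B where "B = (X + T) * G"
  have pos: "X > 0" "d > 0" "T \<ge> 0" "G > 0" using CD \<rho> by (simp_all add: X_def d_def T_def G_def)
  have "\<exists>\<phi>. is_subdiv_limit a m unit_seq \<phi> \<and> (\<forall>x. \<bar>\<phi> x\<bar> \<le> B)" if m: "m \<ge> m0" for m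
  proof -
    have mm: "m \<ge> m1" "near_const M \<delta> (?e m)" using m m2 by (auto simp: m0_def)
    define E where "E k i = subdiv_iter a m k (?e m) i" for k i
    define R where "R k i = subdiv_iter a m k ?V i / E k i" for k i
    have Enz: "E k i \<noteq> 0" for k i using decay mm unfolding E_def by simp
    have RE: "R k i * E k i = complex_of_real (kernel a m k i)" for k i
      using Enz by (simp add: R_def of_real_kernel)
    have R0: "norm (R 0 j) \<le> X" for j
    proof (cases "j = 0")
      case True
      have "\<bar>grid \<nu> m 0\<bar> = real \<nu> / 2 / 2 ^ m" by (simp add: grid_def)
      also have "\<dots> \<le> real \<nu> / 2" using one_le_power[of "2::real" m] by (simp add: field_simps mult_le_cancel_left1)
      also have "\<dots> \<le> 1" using \<nu> by simp
      finally have g: "\<bar>grid \<nu> m 0\<bar> \<le> 1" .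
      have "norm (R 0 0) = norm (exp (- (l * of_real (grid \<nu> m 0))))"
        by (simp add: R_def E_def unit_seq_def norm_divide exp_minus norm_inverse field_simps)
      also have "\<dots> \<le> exp (norm (- (l * of_real (grid \<nu> m 0))))" by (rule norm_exp)
      also have "\<dots> \<le> exp (norm l * 1)" using g by (simp add: norm_mult mult_left_le)
      finally show ?thesis using True by (simp add: X_def)
    next
      case False
      then show ?thesis using pos by (simp add: R_def unit_seq_def)
    qed
    have osc0: "osc_le M d (\<lambda>j. ?V j / ?e m j)"
      unfolding osc_le_def
    proof (intro allI impI)
      fix j j' :: int
      have "norm (R 0 j' - R 0 j) \<le> d"
        using norm_triangle_ineq4[of "R 0 j'" "R 0 j"] R0[of j] R0[of j'] by (simp add: d_def)
      then show "norm (?V j' / ?e m j' - ?V j / ?e m j) \<le> d" by (simp add: R_def E_def)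
    qed
    have osck: "osc_le M (d * D * \<rho> ^ k) (R k)" for k
      using decay mm osc0 unfolding R_def[abs_def] E_def by simp
    have stepk: "norm (R (Suc k) i - R k (i div 2)) \<le> C * (d * D) * \<rho> ^ k" for k i
      using decay mm osc0 unfolding R_def E_def mult.assoc by simp
    define s where "s x k = R k \<lfloor>2 ^ k * x\<rfloor>" for x :: real and k
    have "\<exists>y. s x \<longlonglongrightarrow> y \<and> (\<forall>k. norm (y - s x k) \<le> C * (d * D) * \<rho> ^ k / (1 - \<rho>))" for x
    proof (rule geometric_cauchy)
      show "norm (s x (Suc k) - s x k) \<le> C * (d * D) * \<rho> ^ k" for k
        using stepk[of k "\<lfloor>2 ^ Suc k * x\<rfloor>"] unfolding s_def floor_double_div .
    qed (use \<rho> in auto)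
    then obtain \<psi> where \<psi>: "\<And>x. s x \<longlonglongrightarrow> \<psi> x"
      and "\<And>x k. norm (\<psi> x - s x k) \<le> C * (d * D) * \<rho> ^ k / (1 - \<rho>)" by metis
    then have tail: "norm (\<psi> x - s x k) \<le> T * \<rho> ^ k" for x k by (simp add: T_def)
    have \<psi>_bound: "norm (\<psi> x) \<le> X + T" for x
      using tail[of x 0] R0[of "\<lfloor>x\<rfloor>"] norm_triangle_sub[of "\<psi> x" "s x 0"] by (simp add: s_def)
    have \<psi>_supp: "\<psi> x = 0" if "\<bar>x\<bar> > real M" for x
    proof -
      have "s x \<longlonglongrightarrow> 0"
        by (rule tendsto_eventually, rule eventually_mono[OF eventually_floor_outside[OF that]])
          (simp add: s_def R_def of_real_kernel kernel_support')
      then show ?thesis using \<psi> LIMSEQ_unique by blast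
    qed
    have \<rho>0: "(\<lambda>k. \<rho> ^ k) \<longlonglongrightarrow> 0" using \<rho> by (intro LIMSEQ_power_zero) simp
    have \<psi>_cont: "continuous_on UNIV \<psi>"
      unfolding continuous_on_iff
    proof (intro ballI allI impI)
      fix x \<epsilon> :: real assume "\<epsilon> > 0"
      have "(\<lambda>k. (2 * T + d * D) * \<rho> ^ k) \<longlonglongrightarrow> (2 * T + d * D) * 0" by (intro tendsto_intros \<rho>0)
      then have "\<forall>\<^sub>F k in sequentially. (2 * T + d * D) * \<rho> ^ k < \<epsilon>"
        using \<open>\<epsilon> > 0\<close> by (intro order_tendstoD) auto
      then obtain k where k: "(2 * T + d * D) * \<rho> ^ k < \<epsilon>" unfolding eventually_sequentially by blast
      have "dist (\<psi> y) (\<psi> x) < \<epsilon>" if y: "dist y x < 1 / 2 ^ k" for y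
      proof -
        have "\<bar>2 ^ k * y - 2 ^ k * x\<bar> < 1"
        proof -
          have "\<bar>2 ^ k * y - 2 ^ k * x\<bar> = 2 ^ k * \<bar>y - x\<bar>"
            by (simp only: right_diff_distrib[symmetric] abs_mult) simp
          also have "\<dots> < 1" using y by (simp add: dist_real_def field_simps)
          finally show ?thesis .
        qed
        then have "\<bar>\<lfloor>2 ^ k * y\<rfloor> - \<lfloor>2 ^ k * x\<rfloor>\<bar> \<le> int M + 1" by linarith
        then have "norm (s y k - s x k) \<le> d * D * \<rho> ^ k"
          unfolding s_def by (rule osc_leD[OF osck])
        moreover have "norm (\<psi> y - \<psi> x) \<le> norm (\<psi> y - s y k) + norm (s y k - s x k) + norm (\<psi> x - s x k)"
          using norm_triangle_ineq4[of "\<psi> y - s y k + (s y k - s x k)" "\<psi> x - s x k"]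
            norm_triangle_ineq[of "\<psi> y - s y k" "s y k - s x k"] by simp
        ultimately have "norm (\<psi> y - \<psi> x) \<le> (2 * T + d * D) * \<rho> ^ k"
          using tail[of x k] tail[of y k] by (simp add: algebra_simps)
        then show ?thesis using k by (simp add: dist_norm)
      qed
      then show "\<exists>r>0. \<forall>x'\<in>UNIV. dist x' x < r \<longrightarrow> dist (\<psi> x') (\<psi> x) < \<epsilon>"
        by (intro exI[of _ "1 / 2 ^ k"]) simp
    qed
    let ?g = "\<lambda>x. exp (l * of_real (x / 2 ^ m))"
    have g_bound: "norm (?g x) \<le> G" if "\<bar>x\<bar> \<le> real M" for x
    proof -
      have "\<bar>x / 2 ^ m\<bar> \<le> \<bar>x\<bar>"
        using one_le_power[of "2::real" m] by (simp add: abs_divide field_simps mult_le_cancel_left1)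
      then have "norm l * \<bar>x / 2 ^ m\<bar> \<le> norm l * real M" using that by (intro mult_left_mono) auto
      then show ?thesis
        unfolding G_def by (intro order_trans[OF norm_exp]) (simp add: norm_mult norm_divide norm_power)
    qed
    define \<phi> where "\<phi> x = Re (\<psi> x * ?g x)" for x
    have "\<bar>\<phi> x\<bar> \<le> B" for x
    proof (cases "\<bar>x\<bar> \<le> real M")
      case True
      have "\<bar>\<phi> x\<bar> \<le> norm (\<psi> x * ?g x)" unfolding \<phi>_def by (rule abs_Re_le_cmod)
      also have "\<dots> \<le> B"
        unfolding norm_mult B_def by (rule mult_mono[OF \<psi>_bound g_bound[OF True]]) (use pos in auto)
      finally show ?thesis .
    next
      case False
      then show ?thesis using \<psi>_supp[of x] pos by (simp add: \<phi>_def B_def)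
    qed
    moreover have "is_subdiv_limit a m unit_seq \<phi>"
      unfolding is_subdiv_limit_iff
    proof (intro conjI allI impI)
      show "continuous_on UNIV \<phi>" unfolding \<phi>_def by (intro continuous_intros \<psi>_cont)  auto
      fix \<epsilon> :: real assume "\<epsilon> > 0"
      define \<epsilon>' where "\<epsilon>' = \<epsilon> / (2 * (X + 2 * T))"
      have \<epsilon>': "\<epsilon>' > 0" using \<open>\<epsilon> > 0\<close> pos by (simp add: \<epsilon>'_def)
      have "\<forall>\<^sub>F k in sequentially. \<forall>i. \<bar>real_of_int i / 2 ^ k\<bar> \<le> real M + 1 \<longrightarrow>
          norm (?g (real_of_int i / 2 ^ k) - E k i) \<le> \<epsilon>'"
        using repr[of m] \<epsilon>' unfolding is_local_subdiv_limit_iff E_def by simp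
      moreover have "\<forall>\<^sub>F k in sequentially. T * G * \<rho> ^ k < \<epsilon> / 2"
      proof -
        have "(\<lambda>k. T * G * \<rho> ^ k) \<longlonglongrightarrow> T * G * 0" by (intro tendsto_intros \<rho>0)
        then show ?thesis using \<open>\<epsilon> > 0\<close> by (intro order_tendstoD) auto
      qed
      ultimately show "\<forall>\<^sub>F k in sequentially. \<forall>i. norm (\<phi> (real_of_int i / 2 ^ k) - subdiv_iter a m k unit_seq i) \<le> \<epsilon>"
      proof eventually_elim
        case (elim k)
        show ?case
        proof
          fix i
          let ?x = "real_of_int i / 2 ^ k"
          show "norm (\<phi> ?x - subdiv_iter a m k unit_seq i) \<le> \<epsilon>"
          proof (cases "\<bar>?x\<bar> \<le> real M")
            case False
            then have "real_of_int \<bar>i\<bar> > real_of_int (int M * 2 ^ k)"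
              by (simp add: abs_divide field_simps)
            then have "\<bar>i\<bar> > int M * 2 ^ k" by (simp only: of_int_less_iff)
            then have "kernel a m k i = 0" by (rule kernel_support')
            then show ?thesis using False \<psi>_supp[of ?x] \<open>\<epsilon> > 0\<close> by (simp add: \<phi>_def kernel_def)
          next
            case True
            have sx: "s ?x k = R k i" by (simp add: s_def)
            have R_bound: "norm (R k i) \<le> X + 2 * T"
            proof -
              have "norm (R k i) \<le> norm (\<psi> ?x) + norm (\<psi> ?x - R k i)"
                by (metis add.commute norm_minus_commute norm_triangle_sub)
              moreover have "T * \<rho> ^ k \<le> T" using pos \<rho> by (simp add: mult_left_le power_le_one)
              ultimately show ?thesis using \<psi>_bound[of ?x] tail[of ?x k] sx by simp
            qed
            have "\<phi> ?x - kernel a m k i = Re (\<psi> ?x * ?g ?x - R k i * E k i)"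
              by (simp add: \<phi>_def RE)
            then have "norm (\<phi> ?x - kernel a m k i) \<le> norm (\<psi> ?x * ?g ?x - R k i * E k i)"
              by (metis abs_Re_le_cmod real_norm_def)
            also have "\<psi> ?x * ?g ?x - R k i * E k i = (\<psi> ?x - s ?x k) * ?g ?x + R k i * (?g ?x - E k i)"
              unfolding sx by (simp add: algebra_simps)
            also have "norm \<dots> \<le> T * \<rho> ^ k * G + (X + 2 * T) * \<epsilon>'"
            proof (rule norm_triangle_mono)
              show "norm ((\<psi> ?x - s ?x k) * ?g ?x) \<le> T * \<rho> ^ k * G"
                unfolding norm_mult by (rule mult_mono[OF tail g_bound[OF True]]) (use pos \<rho> in auto)
              have "norm (?g ?x - E k i) \<le> \<epsilon>'" using elim(1) True by auto
              then show "norm (R k i * (?g ?x - E k i)) \<le> (X + 2 * T) * \<epsilon>'"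
                unfolding norm_mult using pos by (intro mult_mono[OF R_bound]) auto
            qed
            also have "\<dots> \<le> \<epsilon>"
            proof -
              have "(X + 2 * T) * \<epsilon>' = \<epsilon> / 2" 
              proof -
                have "Y * (\<epsilon> / (2 * Y)) = \<epsilon> / 2" if "Y > 0" for Y using that by simp
                moreover have "X + 2 * T > 0" using pos by (simp add: add_pos_nonneg)
                ultimately show ?thesis unfolding \<epsilon>'_def by blast
              qed
              moreover have "T * \<rho> ^ k * G < \<epsilon> / 2" using elim(2) by (simp only: mult_ac)
              ultimately show ?thesis by linarith
            qed
            finally show ?thesis unfolding kernel_def .
          qed
        qed
      qed
    qed
    ultimately show ?thesis by blast
  qed
  then show ?thesis by blast
qed

lemma uniform_basic_limits:
  fixes l :: complex
  assumes repr: "\<And>m. is_local_subdiv_limit a m (\<lambda>i. exp (l * of_real (grid \<nu> m i))) (\<lambda>x. exp (l * of_real (x / 2 ^ m)))"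
    and \<nu>: "\<nu> \<le> 1"
  obtains B where "\<And>m. is_subdiv_limit a m unit_seq (basic_limit a m)" "\<And>m x. \<bar>basic_limit a m x\<bar> \<le> B"
proof -
  obtain B0 m0 where late: "\<And>m. m \<ge> m0 \<Longrightarrow> \<exists>\<phi>. is_subdiv_limit a m unit_seq \<phi> \<and> (\<forall>x. \<bar>\<phi> x\<bar> \<le> B0)"
    using uniform_limits_late_levels[OF assms] by blast
  have "\<exists>B. \<forall>m\<ge>m0 - n. \<exists>\<phi>. is_subdiv_limit a m unit_seq \<phi> \<and> (\<forall>x. \<bar>\<phi> x\<bar> \<le> B)" for n
  proof (induction n)
    case 0
    then show ?case using late by auto
  next
    case (Suc n)
    then obtain B where B: "\<And>m. m \<ge> m0 - n \<Longrightarrow> \<exists>\<phi>. is_subdiv_limit a m unit_seq \<phi> \<and> (\<forall>x. \<bar>\<phi> x\<bar> \<le> B)" by blast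
    define m where "m = m0 - Suc n"
    have "\<exists>\<phi>. is_subdiv_limit a (Suc m) unit_seq \<phi> \<and> (\<forall>x. \<bar>\<phi> x\<bar> \<le> B)" by (rule B) (simp add: m_def)
    then obtain \<phi> where \<phi>: "is_subdiv_limit a (Suc m) unit_seq \<phi>" "\<And>x. \<bar>\<phi> x\<bar> \<le> B" by blast
    let ?h = "\<lambda>x. \<Sum>j\<in>{- int M .. int M}. \<phi> (2 * x - real_of_int j) * a m j"
    let ?B = "max B (\<Sum>j\<in>{- int M .. int M}. B * \<bar>a m j\<bar>)"
    have h: "is_subdiv_limit a m unit_seq ?h" by (rule basic_limit_refine[OF \<phi>(1)])
    have "norm (?h x) \<le> (\<Sum>j\<in>{- int M .. int M}. B * \<bar>a m j\<bar>)" for x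
      by (rule sum_norm_le) (auto simp: abs_mult intro!: mult_right_mono \<phi>(2))
    then have hB: "\<bar>?h x\<bar> \<le> ?B" for x by (simp add: le_max_iff_disj)
    have "\<exists>\<phi>. is_subdiv_limit a m' unit_seq \<phi> \<and> (\<forall>x. \<bar>\<phi> x\<bar> \<le> ?B)" if "m' \<ge> m0 - Suc n" for m'
    proof (cases "m' \<ge> m0 - n")
      case True
      then show ?thesis using B[OF True] by (meson max.coboundedI1)
    next
      case False
      then have "m' = m" using that by (simp add: m_def)
      then show ?thesis using h hB by blast
    qed
    then show ?case by blast
  qed
  from this[of m0] obtain B where B: "\<And>m. \<exists>\<phi>. is_subdiv_limit a m unit_seq \<phi> \<and> (\<forall>x. \<bar>\<phi> x\<bar> \<le> B)" by auto
  then have "is_subdiv_limit a m unit_seq (basic_limit a m) \<and> (\<forall>x. \<bar>basic_limit a m x\<bar> \<le> B)" for m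
    using basic_limit_eqI by metis
  then show ?thesis using that by blast
qed

end

context supported_masks
begin

lemma limit_from_level_eq_sum:
  assumes \<phi>: "is_subdiv_limit a m unit_seq (basic_limit a m)"
    and "finite J" "\<And>j. \<bar>2 ^ m * u - real_of_int j\<bar> \<le> real M \<Longrightarrow> j \<in> J"
  shows "limit_from_level a m v u = (\<Sum>j\<in>J. basic_limit a m (2 ^ m * u - real_of_int j) *\<^sub>R v j)"
proof -
  have "limit_from_level a m v u = (\<Sum>\<^sub>\<infinity>j\<in>J. basic_limit a m (2 ^ m * u - real_of_int j) *\<^sub>R v j)"
    unfolding limit_from_level_def
  proof (rule infsum_cong_neutral)
    fix j assume "j \<in> UNIV - J"
    then have "\<bar>2 ^ m * u - real_of_int j\<bar> > real M" using assms(3) by force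
    then show "basic_limit a m (2 ^ m * u - real_of_int j) *\<^sub>R v j = 0"
      using limit_support[OF \<phi>] by simp
  qed auto
  then show ?thesis using assms(2) by simp
qed

text \<open>Inside a window of fixed size the kernels converge to values of the basic limit function, so the
  iterates, which are given by kernels, converge to the series defining \<open>limit_from_level\<close>.\<close>

lemma limit_from_level_reproduces:
  assumes \<phi>: "is_subdiv_limit a m unit_seq (basic_limit a m)"
    and g: "is_local_subdiv_limit a m v g"
  shows "limit_from_level a m v u = g (2 ^ m * u)"
proof -
  define x where "x = 2 ^ m * u"
  let ?i = "\<lambda>k. \<lfloor>2 ^ k * x\<rfloor>"
  let ?J = "{\<lfloor>x\<rfloor> - (int M + 1) .. \<lfloor>x\<rfloor> + (int M + 1)}"
  have win: "window k (?i k) = ?J" for k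
  proof -
    have "?i k div 2 ^ k = \<lfloor>x\<rfloor>"
      using floor_divide_real_eq_div[of "2 ^ k" "2 ^ k * x"] by simp
    then show ?thesis by (simp add: window_def)
  qed
  have "subdiv_iter a m k v (?i k) = (\<Sum>j\<in>?J. kernel a m k (?i k - 2 ^ k * j) *\<^sub>R v j)" for k
    using subdiv_iter_window[of "?i k" "?i k" k m v] win by simp
  moreover have "(\<lambda>k. kernel a m k (?i k - 2 ^ k * j)) \<longlonglongrightarrow> basic_limit a m (x - real_of_int j)" for j
  proof (rule kernel_tendsto_limit[OF \<phi>])
    have "(\<lambda>k. real_of_int (?i k) / 2 ^ k - real_of_int j) \<longlonglongrightarrow> x - real_of_int j"
      by (intro tendsto_intros floor_dyadic_tendsto)
    then show "(\<lambda>k. real_of_int (?i k - 2 ^ k * j) / 2 ^ k) \<longlonglongrightarrow> x - real_of_int j"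
      by (simp add: diff_divide_distrib)
  qed
  then have "(\<lambda>k. \<Sum>j\<in>?J. kernel a m k (?i k - 2 ^ k * j) *\<^sub>R v j)
      \<longlonglongrightarrow> (\<Sum>j\<in>?J. basic_limit a m (x - real_of_int j) *\<^sub>R v j)"
    by (intro tendsto_intros)
  ultimately have "(\<lambda>k. subdiv_iter a m k v (?i k))
      \<longlonglongrightarrow> (\<Sum>j\<in>?J. basic_limit a m (x - real_of_int j) *\<^sub>R v j)" by simp
  moreover have "(\<lambda>k. subdiv_iter a m k v (?i k)) \<longlonglongrightarrow> g x"
    by (rule local_subdiv_limit_tendsto[OF g floor_dyadic_tendsto])
  ultimately have "g x = (\<Sum>j\<in>?J. basic_limit a m (x - real_of_int j) *\<^sub>R v j)"
    using LIMSEQ_unique by blast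
  also have "\<dots> = limit_from_level a m v u"
    unfolding x_def by (rule limit_from_level_eq_sum[OF \<phi>, symmetric]) (auto, linarith+)
  finally show ?thesis by (simp add: x_def)
qed

end

section \<open>A smooth bump function\<close>

text \<open>The functions \<open>p(1/x) exp(-1/x)\<close>, extended by \<open>0\<close>: this family is closed under differentiation, and it
  contains the standard smooth function that is flat at \<open>0\<close>.\<close>

definition flat :: "real poly \<Rightarrow> real \<Rightarrow> real" where
  "flat p x = (if x > 0 then poly p (1 / x) * exp (- (1 / x)) else 0)"

definition flat_deriv :: "real poly \<Rightarrow> real poly" where
  "flat_deriv p = [:0, 0, 1:] * (p - pderiv p)"

lemma poly_over_exp_tendsto_0: "((\<lambda>t. poly p t / exp t) \<longlongrightarrow> (0 :: real)) at_top"
proof -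
  have "((\<lambda>t. \<Sum>i\<le>Polynomial.degree p. Polynomial.coeff p i * (t ^ i / exp t)) \<longlongrightarrow> (\<Sum>i\<le>Polynomial.degree p. Polynomial.coeff p i * 0)) at_top"
    by (intro tendsto_intros tendsto_power_div_exp_0)
  then show ?thesis by (simp add: poly_altdef sum_divide_distrib)
qed

text \<open>Away from \<open>0\<close> this is a computation. At \<open>0\<close> the difference quotient equals, for \<open>y > 0\<close>, a polynomial
  in \<open>t = 1 / y\<close> divided by \<open>exp t\<close>, which tends to \<open>0\<close>.\<close>

lemma flat_has_derivative: "(flat p has_real_derivative flat (flat_deriv p) x) (at x)"
proof -
  consider "x > 0" | "x < 0" | "x = 0" by linarith
  then show ?thesis
  proof cases
    case 1
    have "((\<lambda>x. poly p (1 / x) * exp (- (1 / x))) has_real_derivative flat (flat_deriv p) x) (at x)"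
      using 1 by (auto intro!: derivative_eq_intros DERIV_chain2[OF poly_DERIV]
          simp: flat_def flat_deriv_def power2_eq_square algebra_simps divide_simps)
    then show ?thesis
      by (rule has_field_derivative_transform_within_open[of _ _ _ "{0<..}"]) (use 1 in \<open>auto simp: flat_def\<close>)
  next
    case 2
    have "((\<lambda>x. 0) has_real_derivative flat (flat_deriv p) x) (at x)" using 2 by (simp add: flat_def)
    then show ?thesis
      by (rule has_field_derivative_transform_within_open[of _ _ _ "{..<0}"]) (use 2 in \<open>auto simp: flat_def\<close>)
  next
    case 3
    have "((\<lambda>y. flat p y / y) \<longlongrightarrow> 0) (at_right 0)"
    proof -
      have "((\<lambda>y. poly (pCons 0 p) (inverse y) / exp (inverse y)) \<longlongrightarrow> 0) (at_right (0::real))"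
        by (rule filterlim_compose[OF poly_over_exp_tendsto_0 filterlim_inverse_at_top_right])
      moreover have "eventually (\<lambda>y. poly (pCons 0 p) (inverse y) / exp (inverse y) = flat p y / y) (at_right (0::real))"
        using eventually_at_right_less[of 0]
        by eventually_elim (simp add: flat_def exp_minus field_simps)
      ultimately show ?thesis by (rule Lim_transform_eventually)
    qed
    moreover have "((\<lambda>y. flat p y / y) \<longlongrightarrow> 0) (at_left 0)"
      by (rule tendsto_eventually) (auto simp: eventually_at_filter flat_def)
    ultimately have "((\<lambda>y. flat p y / y) \<longlongrightarrow> 0) (at 0)" by (rule filterlim_split_at[rotated])
    then show ?thesis using 3 by (simp add: has_field_derivative_iff flat_def)
  qed
qed

lemma flat_minus: "flat (- p) x = - flat p x"
  by (simp add: flat_def)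

text \<open>A class of functions that contains the bump function and is closed under differentiation;
  sums are needed for the product rule. All members vanish outside \<open>[-1, 1]\<close>.\<close>

inductive bump_like :: "(real \<Rightarrow> real) \<Rightarrow> bool" where
  prod: "bump_like (\<lambda>x. flat p (1 + x) * flat q (1 - x))"
| add: "bump_like f \<Longrightarrow> bump_like g \<Longrightarrow> bump_like (\<lambda>x. f x + g x)"

lemma bump_like_derivative:
  assumes "bump_like f"
  shows "\<exists>f'. bump_like f' \<and> (\<forall>x. (f has_real_derivative f' x) (at x))"
  using assms
proof induction
  case (prod p q)
  have 1: "((\<lambda>x. flat p (1 + x)) has_real_derivative flat (flat_deriv p) (1 + x) * 1) (at x)" for x
    by (rule DERIV_chain2[OF flat_has_derivative]) (auto intro!: derivative_eq_intros)
  have 2: "((\<lambda>x. flat q (1 - x)) has_real_derivative flat (flat_deriv q) (1 - x) * (-1)) (at x)" for x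
    by (rule DERIV_chain2[OF flat_has_derivative]) (auto intro!: derivative_eq_intros)
  have "((\<lambda>x. flat p (1 + x) * flat q (1 - x)) has_real_derivative
      flat (flat_deriv p) (1 + x) * flat q (1 - x) + flat p (1 + x) * flat (- flat_deriv q) (1 - x)) (at x)" for x
    by (rule DERIV_cong[OF DERIV_mult[OF 1 2]]) (simp add: flat_minus)
  then show ?case using bump_like.intros by blast
next
  case (add f g)
  then show ?case by (blast intro: DERIV_add bump_like.add)
qed

lemma bump_like_support: "bump_like f \<Longrightarrow> \<bar>x\<bar> \<ge> 1 \<Longrightarrow> f x = 0"
  by (induction rule: bump_like.induct) (auto simp: flat_def)

lemma bump_like_iterate: "bump_like f \<Longrightarrow> bump_like ((deriv ^^ n) f)"
proof (induction n)
  case (Suc n)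
  then obtain f' where f': "bump_like f'" "\<And>x. ((deriv ^^ n) f has_real_derivative f' x) (at x)"
    using bump_like_derivative by blast
  then have "deriv ((deriv ^^ n) f) = f'" by (auto intro: DERIV_imp_deriv)
  then show ?case using f' by simp
qed simp

lemma bump_like_has_derivative:
  "bump_like f \<Longrightarrow> ((deriv ^^ n) f has_real_derivative (deriv ^^ Suc n) f x) (at x)"
proof -
  assume "bump_like f"
  then obtain f' where f': "\<And>x. ((deriv ^^ n) f has_real_derivative f' x) (at x)"
    using bump_like_derivative[OF bump_like_iterate, of f n] by blast
  have "deriv ((deriv ^^ n) f) x = f' x" by (rule DERIV_imp_deriv[OF f'])
  then show ?thesis using f' by simp
qed

definition bump :: "real \<Rightarrow> real" where
  "bump x = flat 1 (1 + x) * flat 1 (1 - x)"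

abbreviation "dbump n \<equiv> (deriv ^^ n) bump"

lemma bump_like_bump: "bump_like bump"
  unfolding bump_def[abs_def] by (rule bump_like.prod)

lemma dbump_derivative: "(dbump n has_real_derivative dbump (Suc n) x) (at x)"
  by (rule bump_like_has_derivative[OF bump_like_bump])

lemma dbump_support: "\<bar>x\<bar> \<ge> 1 \<Longrightarrow> dbump n x = 0"
  by (rule bump_like_support[OF bump_like_iterate[OF bump_like_bump]])

lemma dbump_continuous: "continuous_on A (dbump n)"
  by (rule continuous_on_subset[of UNIV]) (auto intro!: DERIV_continuous_on dbump_derivative)

lemma bump_nonneg: "bump x \<ge> 0"
  by (simp add: bump_def flat_def)

lemma bump_0: "bump 0 > 0"
  by (simp add: bump_def flat_def)

lemma scaled_bump_iterate:
  "(deriv ^^ n) (\<lambda>y. bump (c * (x - y))) = (\<lambda>y. (- c) ^ n * dbump n (c * (x - y)))"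
proof (induction n)
  case (Suc n)
  have "((\<lambda>y. dbump n (c * (x - y))) has_real_derivative dbump (Suc n) (c * (x - y)) * (- c)) (at y)" for y
    by (rule DERIV_chain2[OF dbump_derivative]) (auto intro!: derivative_eq_intros)
  then have "((\<lambda>y. (- c) ^ n * dbump n (c * (x - y))) has_real_derivative
      (- c) ^ n * (dbump (Suc n) (c * (x - y)) * (- c))) (at y)" for y
    by (rule DERIV_cmult)
  then have "deriv (\<lambda>y. (- c) ^ n * dbump n (c * (x - y))) = (\<lambda>y. (- c) ^ n * (dbump (Suc n) (c * (x - y)) * (- c)))"
    by (auto intro: DERIV_imp_deriv)
  then show ?case by (simp only: funpow.simps o_apply Suc) (simp add: mult_ac)
qed simp

lemma scaled_bump_test_function:
  assumes "c > 0"
  shows "test_function (\<lambda>y. bump (c * (x - y)))"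
  unfolding test_function_def
proof (intro conjI allI)
  fix n y
  have "((\<lambda>y. dbump n (c * (x - y))) has_real_derivative dbump (Suc n) (c * (x - y)) * (- c)) (at y)"
    by (rule DERIV_chain2[OF dbump_derivative]) (auto intro!: derivative_eq_intros)
  then have "((\<lambda>y. (- c) ^ n * dbump n (c * (x - y))) has_real_derivative
      (- c) ^ n * (dbump (Suc n) (c * (x - y)) * (- c))) (at y)"
    by (rule DERIV_cmult)
  then show "(deriv ^^ n) (\<lambda>y. bump (c * (x - y))) differentiable at y"
    unfolding scaled_bump_iterate using real_differentiable_def by blast
  show "\<exists>R. \<forall>y. \<bar>y\<bar> > R \<longrightarrow> bump (c * (x - y)) = 0"
  proof (intro exI[of _ "\<bar>x\<bar> + 1 / c"] allI impI)
    fix y assume "\<bar>x\<bar> + 1 / c < \<bar>y\<bar>"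
    then have "1 / c \<le> \<bar>x - y\<bar>" by linarith
    then have "1 \<le> c * \<bar>x - y\<bar>" using assms by (simp add: field_simps)
    then have "1 \<le> \<bar>c * (x - y)\<bar>" unfolding abs_mult using assms by simp
    then show "bump (c * (x - y)) = 0" using dbump_support[of _ 0] by simp
  qed
qed

section \<open>Mollification\<close>

lemma continuous_compact_support_integrable:
  fixes g :: "real \<Rightarrow> 'a::euclidean_space"
  assumes "continuous_on UNIV g" "\<And>y. y \<notin> {a..b} \<Longrightarrow> g y = 0"
  shows "integrable lborel g" "integral\<^sup>L lborel g = integral {a..b} g"
proof -
  have eq: "(\<lambda>y. indicator {a..b} y *\<^sub>R g y) = g"
    using assms(2) by (auto simp: indicator_def)
  have "integrable lborel (\<lambda>y. indicator {a..b} y *\<^sub>R g y)"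
    by (rule borel_integrable_compact) (auto intro: continuous_on_subset[OF assms(1)])
  then show i: "integrable lborel g" unfolding eq .
  have "integral\<^sup>L lborel g = integral UNIV g" using integral_lborel[OF i] by simp
  also have "\<dots> = integral UNIV (\<lambda>y. if y \<in> {a..b} then g y else 0)"
    by (rule integral_cong) (use assms(2) in auto)
  also have "\<dots> = integral {a..b} g" by (rule integral_restrict_UNIV)
  finally show "integral\<^sup>L lborel g = integral {a..b} g" .
qed

lemma lebesgue_integral_continuous:
  fixes g :: "real \<Rightarrow> 'a::euclidean_space"
  assumes "continuous_on UNIV g"
  shows "integral\<^sup>L lebesgue g = integral\<^sup>L lborel g"
  by (rule integral_completion) (use assms in \<open>simp add: borel_measurable_continuous_onI\<close>)

definition bump_mass :: real where
  "bump_mass = integral\<^sup>L lborel bump"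

lemma bump_continuous: "continuous_on A bump"
  using dbump_continuous[of A 0] by simp

lemma bump_mass_pos: "bump_mass > 0"
proof -
  have supp: "bump y = 0" if "y \<notin> {-1..1}" for y using dbump_support[of y 0] that by auto
  have eq: "bump_mass = integral {-1..1} bump"
    unfolding bump_mass_def by (rule continuous_compact_support_integrable[OF bump_continuous supp])
  have "bump_mass \<ge> 0" unfolding bump_mass_def by (simp add: bump_nonneg)
  moreover have "bump_mass \<noteq> 0"
  proof
    assume "bump_mass = 0"
    then have "(bump has_integral 0) (cbox (-1) 1)"
      using eq integrable_integral[OF integrable_continuous_interval[OF bump_continuous[of "{-1..1::real}"]]]
      by simp
    then have "bump 0 = 0"
      by (rule has_integral_0_cbox_imp_0[rotated 2]) (auto simp: bump_nonneg bump_continuous)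
    then show False using bump_0 by simp
  qed
  ultimately show ?thesis by simp
qed

lemma scaled_bump_integral:
  assumes "c > 0"
  shows "integrable lborel (\<lambda>y. bump (c * (x - y)))" "(\<integral>y. bump (c * (x - y)) \<partial>lborel) = bump_mass / c"
proof -
  have *: "c * x + (- c) * y = c * (x - y)" for y by (simp add: algebra_simps)
  have "bump_mass = \<bar>- c\<bar> *\<^sub>R (\<integral>y. bump (c * x + (- c) * y) \<partial>lborel)"
    unfolding bump_mass_def by (rule lborel_integral_real_affine) (use assms in simp)
  then show "(\<integral>y. bump (c * (x - y)) \<partial>lborel) = bump_mass / c" using assms unfolding * by (simp add: field_simps)
  have "integrable lborel bump"
  proof (rule continuous_compact_support_integrable[OF bump_continuous])
    show "bump y = 0" if "y \<notin> {-1..1}" for y using dbump_support[of y 0] that by auto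
  qed
  then have "integrable lborel (\<lambda>y. bump (c * x + (- c) * y))"
    by (rule lborel_integrable_real_affine) (use assms in simp)
  then show "integrable lborel (\<lambda>y. bump (c * (x - y)))" unfolding * .
qed

text \<open>The \<open>l\<close>-th derivative of the convolution of \<open>f\<close> with the bump function of mass \<open>1\<close> and width \<open>1 / c\<close>,
  with all derivatives put on the bump function.\<close>

definition mollify :: "real \<Rightarrow> (real \<Rightarrow> complex) \<Rightarrow> nat \<Rightarrow> real \<Rightarrow> complex" where
  "mollify c f l x = (c ^ Suc l / bump_mass) *\<^sub>R (\<integral>y. dbump l (c * (x - y)) *\<^sub>R f y \<partial>lborel)"

lemma mollify_integrand_support:
  assumes "c \<ge> 1" "\<bar>x - x0\<bar> \<le> 1" "y \<notin> {x0 - 2..x0 + 2}"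
  shows "dbump l (c * (x - y)) = 0"
proof (rule dbump_support)
  have "1 \<le> \<bar>x - y\<bar>" using assms by auto
  then have "1 * 1 \<le> c * \<bar>x - y\<bar>" using assms by (intro mult_mono) auto
  then show "1 \<le> \<bar>c * (x - y)\<bar>" using assms by (simp add: abs_mult)
qed

lemma mollify_integrand_continuous:
  fixes f :: "real \<Rightarrow> complex"
  assumes "continuous_on UNIV f"
  shows "continuous_on UNIV (\<lambda>y. dbump l (c * (x - y)) *\<^sub>R f y)"
  by (intro continuous_intros continuous_on_compose2[OF dbump_continuous[of UNIV]] assms) auto

lemma mollify_eq_integral:
  assumes "continuous_on UNIV f" "c \<ge> 1" "\<bar>x - x0\<bar> \<le> 1"
  shows "mollify c f l x = (c ^ Suc l / bump_mass) *\<^sub>R integral (cbox (x0 - 2) (x0 + 2)) (\<lambda>y. dbump l (c * (x - y)) *\<^sub>R f y)"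
  unfolding mollify_def
  using continuous_compact_support_integrable(2)[OF mollify_integrand_continuous[OF assms(1)], of "x0 - 2" "x0 + 2" l c x]
    mollify_integrand_support[OF assms(2,3)] by simp

text \<open>Differentiation under the integral sign; near \<open>x0\<close> all integrands live on one compact interval.\<close>

lemma mollify_has_derivative:
  assumes f: "continuous_on UNIV f" and c: "c \<ge> 1"
  shows "(mollify c f l has_vector_derivative mollify c f (Suc l) x0) (at x0)"
proof -
  let ?U = "{x0 - 1..x0 + 1}"
  let ?k = "c ^ Suc l / bump_mass"
  let ?G = "\<lambda>x. integral (cbox (x0 - 2) (x0 + 2)) (\<lambda>y. dbump l (c * (x - y)) *\<^sub>R f y)"
  let ?g = "\<lambda>x y. (c * dbump (Suc l) (c * (x - y))) *\<^sub>R f y"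
  have "(?G has_vector_derivative integral (cbox (x0 - 2) (x0 + 2)) (?g x0)) (at x0 within ?U)"
  proof (rule leibniz_rule_vector_derivative)
    fix x y
    have "((\<lambda>x. dbump l (c * (x - y))) has_real_derivative dbump (Suc l) (c * (x - y)) * c) (at x within ?U)"
      by (rule DERIV_chain2[OF dbump_derivative]) (auto intro!: derivative_eq_intros)
    then show "((\<lambda>x. dbump l (c * (x - y)) *\<^sub>R f y) has_vector_derivative ?g x y) (at x within ?U)"
      using has_vector_derivative_scaleR[OF _ has_vector_derivative_const[of "f y"]] by (fastforce simp: mult.commute)
  next
    fix x
    show "(\<lambda>y. dbump l (c * (x - y)) *\<^sub>R f y) integrable_on cbox (x0 - 2) (x0 + 2)"
      by (intro integrable_continuous continuous_on_subset[OF mollify_integrand_continuous[OF f]]) auto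
  next
    have "continuous_on UNIV (\<lambda>z. (c * dbump (Suc l) (c * (fst z - snd z))) *\<^sub>R f (snd z))"
      by (intro continuous_intros continuous_on_compose2[OF dbump_continuous[of UNIV]]
          continuous_on_compose2[OF f]) auto
    then show "continuous_on (?U \<times> cbox (x0 - 2) (x0 + 2)) (\<lambda>(x, y). ?g x y)"
      unfolding case_prod_unfold by (rule continuous_on_subset) simp
  qed auto
  then have "((\<lambda>x. ?k *\<^sub>R ?G x) has_vector_derivative ?k *\<^sub>R integral (cbox (x0 - 2) (x0 + 2)) (?g x0)) (at x0 within ?U)"
    by (auto intro!: derivative_eq_intros)
  also have "?k *\<^sub>R integral (cbox (x0 - 2) (x0 + 2)) (?g x0) = mollify c f (Suc l) x0"
  proof -
    have "integral (cbox (x0 - 2) (x0 + 2)) (?g x0)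
        = c *\<^sub>R integral (cbox (x0 - 2) (x0 + 2)) (\<lambda>y. dbump (Suc l) (c * (x0 - y)) *\<^sub>R f y)"
      by (simp add: scaleR_scaleR[symmetric] del: scaleR_scaleR)
    then show ?thesis using mollify_eq_integral[OF f c, of x0 x0 "Suc l"] by (simp add: mult_ac)
  qed
  also have "at x0 within ?U = at x0" by (rule at_within_interior) simp
  finally have "((\<lambda>x. ?k *\<^sub>R ?G x) has_vector_derivative mollify c f (Suc l) x0) (at x0)" .
  then show ?thesis
    by (rule has_vector_derivative_transform_within_open[of _ _ _ "{x0 - 1<..<x0 + 1}"])
      (simp, simp, rule mollify_eq_integral[OF f c, symmetric], auto)
qed

lemma Linf_bounded:
  assumes "h \<in> Linf"
  obtains H where "H \<ge> 0" "AE x in lebesgue. norm (h x) \<le> H"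
proof -
  have "Linf_norm h < \<infinity>" using assms by (simp add: Linf_def)
  then obtain H where H: "Linf_norm h \<le> ereal H"
    by (metis ereal_infty_less_eq(1) less_eq_ereal_def less_ereal.elims(2) linorder_not_le order_refl)
  have "AE x in lebesgue. ereal (norm (h x)) \<le> Linf_norm h" unfolding Linf_norm_def by (rule esssup_AE)
  then have "AE x in lebesgue. norm (h x) \<le> max H 0"
  proof (rule AE_mp, intro AE_I2 impI)
    fix x assume "ereal (norm (h x)) \<le> Linf_norm h"
    then have "ereal (norm (h x)) \<le> ereal H" using H by (rule order_trans)
    then show "norm (h x) \<le> max H 0" by simp
  qed
  then show ?thesis using that[of "max H 0"] by simp
qed

text \<open>The rescaled bump function is a test function, so the \<open>l\<close> derivatives can be moved from it to \<open>f\<close>,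
  where they become the weak derivative \<open>h\<close>; averaging \<open>h\<close> does not exceed its essential bound.\<close>

lemma mollify_bound:
  assumes f: "continuous_on UNIV f" and c: "c \<ge> 1"
    and h: "has_weak_deriv l f h" "h \<in> borel_measurable lebesgue" "AE x in lebesgue. norm (h x) \<le> H"
  shows "norm (mollify c f l x) \<le> H"
proof -
  let ?\<psi> = "\<lambda>y. bump (c * (x - y))"
  have c0: "c > 0" using c by simp
  have weak: "(\<integral>y. (deriv ^^ l) ?\<psi> y *\<^sub>R f y \<partial>lebesgue) = (-1) ^ l * (\<integral>y. ?\<psi> y *\<^sub>R h y \<partial>lebesgue)"
    using h(1) scaled_bump_test_function[OF c0] unfolding has_weak_deriv_def by blast
  have "(\<integral>y. (deriv ^^ l) ?\<psi> y *\<^sub>R f y \<partial>lebesgue) = (\<integral>y. (- c) ^ l *\<^sub>R (dbump l (c * (x - y)) *\<^sub>R f y) \<partial>lebesgue)"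
    unfolding scaled_bump_iterate by simp
  also have "\<dots> = (- c) ^ l *\<^sub>R (\<integral>y. dbump l (c * (x - y)) *\<^sub>R f y \<partial>lborel)"
    using lebesgue_integral_continuous[OF mollify_integrand_continuous[OF f]] by (simp del: scaleR_scaleR)
  finally have eq: "(- c) ^ l *\<^sub>R (\<integral>y. dbump l (c * (x - y)) *\<^sub>R f y \<partial>lborel) = (-1) ^ l * (\<integral>y. ?\<psi> y *\<^sub>R h y \<partial>lebesgue)"
    using weak by simp
  have int\<psi>: "integrable lebesgue (\<lambda>y. H * ?\<psi> y)"
    using scaled_bump_integral(1)[OF c0, of x] by (intro integrable_mult_right) (simp add: integrable_completion)
  have ae: "AE y in lebesgue. norm (?\<psi> y *\<^sub>R h y) \<le> H * ?\<psi> y"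
    using h(3) by eventually_elim (simp add: bump_nonneg mult.commute mult_right_mono)
  have meas: "(\<lambda>y. ?\<psi> y *\<^sub>R h y) \<in> borel_measurable lebesgue"
  proof -
    have "continuous_on UNIV ?\<psi>"
      by (intro continuous_on_compose2[OF bump_continuous[of UNIV]] continuous_intros) auto
    then have "?\<psi> \<in> borel_measurable lebesgue"
      by (intro measurable_completion) (simp add: borel_measurable_continuous_onI)
    then show ?thesis using h(2) by measurable
  qed
  have "norm (\<integral>y. ?\<psi> y *\<^sub>R h y \<partial>lebesgue) \<le> (\<integral>y. H * ?\<psi> y \<partial>lebesgue)"
  proof -
    have "integrable lebesgue (\<lambda>y. ?\<psi> y *\<^sub>R h y)"
      by (rule Bochner_Integration.integrable_bound[OF int\<psi> meas]) (use ae in \<open>eventually_elim; simp\<close>)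
    then have "(\<integral>y. norm (?\<psi> y *\<^sub>R h y) \<partial>lebesgue) \<le> (\<integral>y. H * ?\<psi> y \<partial>lebesgue)"
      by (intro integral_mono_AE int\<psi> ae integrable_norm)
    then show ?thesis by (rule order_trans[OF integral_norm_bound])
  qed
  also have "\<dots> = H * (bump_mass / c)"
  proof -
    have "continuous_on UNIV ?\<psi>"
      by (intro continuous_on_compose2[OF bump_continuous[of UNIV]] continuous_intros) auto
    from lebesgue_integral_continuous[OF this] show ?thesis using scaled_bump_integral(2)[OF c0] by simp
  qed
  finally have B: "norm (\<integral>y. ?\<psi> y *\<^sub>R h y \<partial>lebesgue) \<le> H * (bump_mass / c)" .
  have "norm ((- c) ^ l *\<^sub>R (\<integral>y. dbump l (c * (x - y)) *\<^sub>R f y \<partial>lborel)) \<le> H * (bump_mass / c)"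
    unfolding eq using B by (simp add: norm_mult norm_power)
  then have "c ^ l * norm (\<integral>y. dbump l (c * (x - y)) *\<^sub>R f y \<partial>lborel) \<le> H * (bump_mass / c)"
    using c0 by (simp add: power_abs)
  then have "c / bump_mass * (c ^ l * norm (\<integral>y. dbump l (c * (x - y)) *\<^sub>R f y \<partial>lborel)) \<le> c / bump_mass * (H * (bump_mass / c))"
    using c0 bump_mass_pos by (intro mult_left_mono) auto
  also have "\<dots> = H" using c0 bump_mass_pos by simp
  finally show ?thesis
    using c0 bump_mass_pos by (simp add: mollify_def)
qed

lemma mollify_tendsto:
  assumes f: "continuous_on UNIV f"
  shows "(\<lambda>n. mollify (real (Suc n)) f 0 x) \<longlonglongrightarrow> f x"
proof (rule tendstoI)
  fix e :: real assume e: "e > 0"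
  have "isCont f x" using f by (simp add: continuous_on_eq_continuous_at)
  then obtain d where d: "d > 0" "\<And>y. dist y x < d \<Longrightarrow> dist (f y) (f x) < e / 2"
    unfolding continuous_at_eps_delta using e by (metis half_gt_zero)
  obtain N where N: "1 / d < real N" using reals_Archimedean2 by blast
  have "dist (mollify (real (Suc n)) f 0 x) (f x) < e" if "n \<ge> N" for n
  proof -
    define c where "c = real (Suc n)"
    have c: "c \<ge> 1" "c > 0" by (simp_all add: c_def)
    have "1 / d < c" using N that by (simp add: c_def)
    then have cd: "1 / c < d" using c d by (simp add: field_simps)
    let ?\<psi> = "\<lambda>y. bump (c * (x - y))"
    have i1: "integrable lborel (\<lambda>y. ?\<psi> y *\<^sub>R f y)"
      using continuous_compact_support_integrable(1)[OF mollify_integrand_continuous[OF f], of "x - 2" "x + 2" 0 c x]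
        mollify_integrand_support[OF c(1), of x x _ 0] by simp
    have i2: "integrable lborel (\<lambda>y. ?\<psi> y *\<^sub>R f x)"
      using scaled_bump_integral(1)[OF c(2), of x] by simp
    have "(bump_mass / c) *\<^sub>R f x = (\<integral>y. ?\<psi> y *\<^sub>R f x \<partial>lborel)"
      using scaled_bump_integral[OF c(2), of x] by simp
    then have "(\<integral>y. ?\<psi> y *\<^sub>R f y \<partial>lborel) - (bump_mass / c) *\<^sub>R f x = (\<integral>y. ?\<psi> y *\<^sub>R (f y - f x) \<partial>lborel)"
      using i1 i2 by (simp add: scaleR_diff_right)
    also have "norm \<dots> \<le> (\<integral>y. e / 2 * ?\<psi> y \<partial>lborel)"
    proof (rule Bochner_Integration.integral_norm_bound_integral)
      show "integrable lborel (\<lambda>y. ?\<psi> y *\<^sub>R (f y - f x))" using i1 i2 by (simp add: scaleR_diff_right)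
      show "integrable lborel (\<lambda>y. e / 2 * ?\<psi> y)" using scaled_bump_integral(1)[OF c(2), of x] by simp
      fix y
      show "norm (?\<psi> y *\<^sub>R (f y - f x)) \<le> e / 2 * ?\<psi> y"
      proof (cases "\<bar>c * (x - y)\<bar> \<ge> 1")
        case True
        then show ?thesis using dbump_support[of _ 0] by simp
      next
        case False
        then have "c * \<bar>x - y\<bar> < 1" unfolding abs_mult using c by simp
        then have "\<bar>x - y\<bar> < 1 / c" using c by (simp add: field_simps)
        then have "dist (f y) (f x) < e / 2" using cd by (intro d(2)) (simp add: dist_real_def abs_minus_commute)
        then have "norm (f y - f x) \<le> e / 2" by (simp add: dist_norm)
        from mult_left_mono[OF this bump_nonneg[of "c * (x - y)"]]
        show ?thesis by (simp add: mult.commute bump_nonneg)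
      qed
    qed
    also have "\<dots> = e / 2 * (bump_mass / c)" using scaled_bump_integral(2)[OF c(2), of x] by simp
    finally have le: "norm ((\<integral>y. ?\<psi> y *\<^sub>R f y \<partial>lborel) - (bump_mass / c) *\<^sub>R f x) \<le> e / 2 * (bump_mass / c)" .
    have "mollify c f 0 x - f x = (c / bump_mass) *\<^sub>R ((\<integral>y. ?\<psi> y *\<^sub>R f y \<partial>lborel) - (bump_mass / c) *\<^sub>R f x)"
      using c bump_mass_pos by (simp add: mollify_def scaleR_diff_right)
    then have "norm (mollify c f 0 x - f x) \<le> (c / bump_mass) * (e / 2 * (bump_mass / c))"
      using le c bump_mass_pos by (simp only: norm_scaleR) (intro mult_mono, auto)
    also have "\<dots> = e / 2" using c bump_mass_pos by simp
    finally show ?thesis using e by (simp add: dist_norm c_def)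
  qed
  then show "\<forall>\<^sub>F n in sequentially. dist (mollify (real (Suc n)) f 0 x) (f x) < e"
    unfolding eventually_sequentially by blast
qed

section \<open>Local approximation by exponential polynomials\<close>

text \<open>Repeated use of the mean value inequality, starting from the bound for the highest derivative. It
  replaces Taylor's formula for complex-valued functions.\<close>

lemma vanishing_jet_bound:
  fixes R :: "nat \<Rightarrow> real \<Rightarrow> complex"
  assumes der: "\<And>l x. (R l has_vector_derivative R (Suc l) x) (at x)"
    and jet: "\<And>l. l < n \<Longrightarrow> R l u = 0"
    and bnd: "\<And>y. \<bar>y - u\<bar> \<le> r \<Longrightarrow> norm (R n y) \<le> K"
    and y: "\<bar>y - u\<bar> \<le> r"
  shows "norm (R 0 y) \<le> K * \<bar>y - u\<bar> ^ n"
proof -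
  have "norm (R (n - j) y) \<le> K * \<bar>y - u\<bar> ^ j" if "j \<le> n" "\<bar>y - u\<bar> \<le> r" for j y
    using that
  proof (induction j arbitrary: y)
    case 0
    then show ?case using bnd by simp
  next
    case (Suc j)
    have K: "K \<ge> 0" using bnd[of u] Suc.prems order_trans[OF norm_ge_zero] by force
    let ?S = "closed_segment u y"
    have in_S: "\<bar>x - u\<bar> \<le> \<bar>y - u\<bar>" if "x \<in> ?S" for x
      using that by (auto simp: closed_segment_eq_real_ivl split: if_splits)
    have "norm (R (n - Suc j) y - R (n - Suc j) u) \<le> (K * \<bar>y - u\<bar> ^ j) * norm (y - u)"
    proof (rule differentiable_bound[of ?S "R (n - Suc j)" "\<lambda>x h. h *\<^sub>R R (n - j) x"])
      fix x assume x: "x \<in> ?S"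
      have "Suc (n - Suc j) = n - j" using Suc.prems by simp
      then show "(R (n - Suc j) has_derivative (\<lambda>h. h *\<^sub>R R (n - j) x)) (at x within ?S)"
        using der[of "n - Suc j" x] unfolding has_vector_derivative_def by (metis has_derivative_at_withinI)
      have "norm (R (n - j) x) \<le> K * \<bar>x - u\<bar> ^ j"
        using Suc.prems in_S[OF x] by (intro Suc.IH) auto
      also have "\<dots> \<le> K * \<bar>y - u\<bar> ^ j" using in_S[OF x] K by (intro mult_left_mono power_mono) auto
      finally have "norm (R (n - j) x) \<le> K * \<bar>y - u\<bar> ^ j" .
      then show "onorm (\<lambda>h. h *\<^sub>R R (n - j) x) \<le> K * \<bar>y - u\<bar> ^ j"
        by (intro onorm_le) (simp add: mult.commute mult_left_mono)
    qed auto
    then show ?case using jet[of "n - Suc j"] Suc.prems by (simp add: mult_ac)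
  qed
  from this[of n y] y show ?thesis by simp
qed

abbreviation vderiv :: "(real \<Rightarrow> complex) \<Rightarrow> real \<Rightarrow> complex" where
  "vderiv \<equiv> (\<lambda>g y. vector_derivative g (at y))"

text \<open>Exponential polynomials with one frequency: a family that contains the exponential monomials of
  that frequency and, unlike the monomials themselves, is closed under differentiation.\<close>

definition exp_poly :: "complex \<Rightarrow> complex poly \<Rightarrow> real \<Rightarrow> complex" where
  "exp_poly l p x = poly p (of_real x) * exp (l * of_real x)"

lemma exp_monomial_eq_exp_poly: "exp_monomial l \<beta> = exp_poly l (Polynomial.monom 1 \<beta>)"
  by (rule ext) (simp add: exp_monomial_def exp_poly_def poly_monom)

lemma exp_poly_derivative:
  "(exp_poly l p has_vector_derivative exp_poly l (pderiv p + Polynomial.smult l p) x) (at x)"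
proof -
  have "((\<lambda>z. poly p z * exp (l * z)) has_field_derivative
      poly (pderiv p + Polynomial.smult l p) (of_real x) * exp (l * of_real x)) (at (of_real x))"
    by (auto intro!: derivative_eq_intros poly_DERIV simp: algebra_simps)
  then show ?thesis
    unfolding exp_poly_def[abs_def] by (rule has_vector_derivative_real_field)
qed

lemma exp_poly_iterate: "\<exists>q. (vderiv ^^ n) (exp_poly l p) = exp_poly l q"
proof (induction n)
  case (Suc n)
  then obtain q where q: "(vderiv ^^ n) (exp_poly l p) = exp_poly l q" by blast
  have "vderiv (exp_poly l q) = exp_poly l (pderiv q + Polynomial.smult l q)"
    by (rule ext, rule vector_derivative_at, rule exp_poly_derivative)
  then show ?case using q by auto
qed auto

lemma exp_monomial_derivative:
  "((vderiv ^^ n) (exp_monomial l \<beta>) has_vector_derivative (vderiv ^^ Suc n) (exp_monomial l \<beta>) x) (at x)"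
proof -
  obtain q where q: "(vderiv ^^ n) (exp_poly l (Polynomial.monom 1 \<beta>)) = exp_poly l q" using exp_poly_iterate by blast
  have "(vderiv ^^ Suc n) (exp_poly l (Polynomial.monom 1 \<beta>)) x = vector_derivative (exp_poly l q) (at x)"
    by (simp only: funpow.simps o_apply q)
  also have "\<dots> = exp_poly l (pderiv q + Polynomial.smult l q) x"
    by (rule vector_derivative_at[OF exp_poly_derivative])
  finally have eq: "(vderiv ^^ Suc n) (exp_poly l (Polynomial.monom 1 \<beta>)) x = exp_poly l (pderiv q + Polynomial.smult l q) x" .
  show ?thesis
    unfolding exp_monomial_eq_exp_poly eq q by (rule exp_poly_derivative)
qed

lemma exp_poly_space_sum:
  assumes "finite A" "\<And>x. x \<in> A \<Longrightarrow> g x \<in> exp_poly_space \<eta> lam \<mu>"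
  shows "(\<lambda>y. \<Sum>x\<in>A. k x * g x y) \<in> exp_poly_space \<eta> lam \<mu>"
proof -
  have "\<forall>x\<in>A. \<exists>c. g x = (\<lambda>y. \<Sum>n=1..\<eta>. \<Sum>\<beta><\<mu> n. c n \<beta> * exp_monomial (lam n) \<beta> y)"
    using assms(2) unfolding exp_poly_space_def by blast
  from bchoice[OF this] obtain c where c: "\<And>x. x \<in> A \<Longrightarrow> g x = (\<lambda>y. \<Sum>n=1..\<eta>. \<Sum>\<beta><\<mu> n. c x n \<beta> * exp_monomial (lam n) \<beta> y)"
    by blast
  have "(\<Sum>x\<in>A. k x * g x y)
      = (\<Sum>n=1..\<eta>. \<Sum>\<beta><\<mu> n. (\<Sum>x\<in>A. k x * c x n \<beta>) * exp_monomial (lam n) \<beta> y)" for y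
  proof -
    have "(\<Sum>x\<in>A. k x * g x y) = (\<Sum>x\<in>A. \<Sum>n=1..\<eta>. \<Sum>\<beta><\<mu> n. k x * c x n \<beta> * exp_monomial (lam n) \<beta> y)"
      by (rule sum.cong) (simp_all add: c sum_distrib_left mult.assoc)
    also have "\<dots> = (\<Sum>n=1..\<eta>. \<Sum>\<beta><\<mu> n. \<Sum>x\<in>A. k x * c x n \<beta> * exp_monomial (lam n) \<beta> y)"
      by (simp add: sum.swap[of _ A])
    finally show ?thesis by (simp add: sum_distrib_right)
  qed
  then show ?thesis unfolding exp_poly_space_def by auto
qed

lemma exp_monomial_in_space:
  assumes "n \<in> {1..\<eta>}" "\<beta> < \<mu> n"
  shows "exp_monomial (lam n) \<beta> \<in> exp_poly_space \<eta> lam \<mu>"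
proof -
  have "(\<Sum>n'=1..\<eta>. \<Sum>\<beta>'<\<mu> n'. (if n' = n \<and> \<beta>' = \<beta> then 1 else 0) * exp_monomial (lam n') \<beta>' y)
      = exp_monomial (lam n) \<beta> y" for y
  proof -
    have "(\<Sum>\<beta>'<\<mu> n'. (if n' = n \<and> \<beta>' = \<beta> then 1 else 0) * exp_monomial (lam n') \<beta>' y)
        = (if n' = n then exp_monomial (lam n) \<beta> y else 0)" for n'
    proof (cases "n' = n")
      case True
      have "(\<Sum>\<beta>'<\<mu> n. (if \<beta>' = \<beta> then 1 else 0) * exp_monomial (lam n) \<beta>' y)
          = (\<Sum>\<beta>'<\<mu> n. if \<beta>' = \<beta> then exp_monomial (lam n) \<beta>' y else 0)"
        by (rule sum.cong) auto
      then show ?thesis using True assms(2) by simp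
    qed simp
    then show ?thesis using assms(1) by simp
  qed
  then show ?thesis unfolding exp_poly_space_def 
    by (intro CollectI exI[of _ "\<lambda>n' \<beta>'. if n' = n \<and> \<beta>' = \<beta> then 1 else 0"]) simp
qed

text \<open>By the binomial theorem, a translate is a combination of exponential monomials of the same
  frequency and of no higher degree.\<close>

lemma exp_monomial_translate:
  assumes "g \<in> exp_monomials \<eta> lam \<mu>"
  shows "(\<lambda>y. g (y - u)) \<in> exp_poly_space \<eta> lam \<mu>"
proof -
  from assms obtain n \<beta> where n: "n \<in> {1..\<eta>}" "\<beta> < \<mu> n" and g: "g = exp_monomial (lam n) \<beta>"
    unfolding exp_monomials_def by blast
  let ?l = "lam n"
  have "g (y - u) = (\<Sum>i\<le>\<beta>. (of_nat (\<beta> choose i) * of_real (- u) ^ (\<beta> - i) * exp (- ?l * of_real u)) * exp_monomial ?l i y)" for y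
  proof -
    have "exp (?l * of_real (y - u)) = exp (?l * of_real y) * exp (- ?l * of_real u)"
      by (simp add: exp_add[symmetric] algebra_simps)
    moreover have "complex_of_real (y - u) ^ \<beta> = (\<Sum>i\<le>\<beta>. of_nat (\<beta> choose i) * of_real y ^ i * of_real (- u) ^ (\<beta> - i))"
      using binomial_ring[of "complex_of_real y" "complex_of_real (- u)" \<beta>] by simp
    ultimately have "g (y - u) = (\<Sum>i\<le>\<beta>. of_nat (\<beta> choose i) * of_real y ^ i * of_real (- u) ^ (\<beta> - i))
        * (exp (?l * of_real y) * exp (- ?l * of_real u))" by (simp only: g exp_monomial_def)
    then show ?thesis unfolding exp_monomial_def sum_distrib_right by (simp only: mult_ac)
  qed
  moreover have "(\<lambda>y. \<Sum>i\<in>{..\<beta>}. (of_nat (\<beta> choose i) * of_real (- u) ^ (\<beta> - i) * exp (- ?l * of_real u)) * exp_monomial ?l i y)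
      \<in> exp_poly_space \<eta> lam \<mu>"
    by (rule exp_poly_space_sum) (use n in \<open>auto intro: exp_monomial_in_space\<close>)
  ultimately show ?thesis by simp
qed

text \<open>The rows of the inverse of the Wronskian matrix, divided by factorials, give the coefficients of a
  basis of the span of the \<open>\<phi> \<alpha>\<close> that is dual to the derivatives at \<open>0\<close>.\<close>

lemma jet_interpolation:
  assumes "invertible_mat (wronskian_mat \<gamma> \<phi> 0)"
  shows "\<exists>A :: nat \<Rightarrow> nat \<Rightarrow> complex. \<forall>t. \<forall>\<beta><\<gamma>. (\<Sum>\<alpha><\<gamma>. (\<Sum>\<beta>'<\<gamma>. t \<beta>' * A \<beta>' \<alpha>) * (vderiv ^^ \<beta>) (\<phi> \<alpha>) 0) = t \<beta>"
proof -
  let ?W = "wronskian_mat \<gamma> \<phi> 0"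
  have W: "?W \<in> carrier_mat \<gamma> \<gamma>" by (simp add: wronskian_mat_def)
  obtain V where V: "inverts_mat ?W V" "inverts_mat V ?W"
    using assms unfolding invertible_mat_def by blast
  have WV: "?W * V = 1\<^sub>m \<gamma>" using V(1) W by (simp add: inverts_mat_def)
  have VW: "V * ?W = 1\<^sub>m (dim_row V)" using V(2) by (simp add: inverts_mat_def)
  have "dim_col V = \<gamma>" using WV by (metis index_mult_mat(3) index_one_mat(3))
  moreover have "dim_row V = \<gamma>" using VW W by (metis carrier_matD(2) index_mult_mat(3) index_one_mat(3))
  ultimately have Vc: "V \<in> carrier_mat \<gamma> \<gamma>" by blast
  define A where "A \<beta>' \<alpha> = V $$ (\<beta>', \<alpha>) / fact \<beta>'" for \<beta>' \<alpha>
  have inv: "(\<Sum>\<alpha><\<gamma>. A \<beta>' \<alpha> * (vderiv ^^ \<beta>) (\<phi> \<alpha>) 0) = (if \<beta>' = \<beta> then 1 else 0)"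
    if "\<beta> < \<gamma>" "\<beta>' < \<gamma>" for \<beta> \<beta>'
  proof -
    have "(V * ?W) $$ (\<beta>', \<beta>) = (\<Sum>\<alpha><\<gamma>. V $$ (\<beta>', \<alpha>) * ?W $$ (\<alpha>, \<beta>))"
      using that Vc W by (simp add: scalar_prod_def atLeast0LessThan)
    also have "\<dots> = (\<Sum>\<alpha><\<gamma>. V $$ (\<beta>', \<alpha>) * ((vderiv ^^ \<beta>) (\<phi> \<alpha>) 0 / fact \<beta>))"
      using that by (intro sum.cong) (simp_all add: wronskian_mat_def)
    finally have "(\<Sum>\<alpha><\<gamma>. V $$ (\<beta>', \<alpha>) * ((vderiv ^^ \<beta>) (\<phi> \<alpha>) 0 / fact \<beta>)) = (if \<beta>' = \<beta> then 1 else 0)"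
      using VW Vc that by simp
    then have "(\<Sum>\<alpha><\<gamma>. V $$ (\<beta>', \<alpha>) * (vderiv ^^ \<beta>) (\<phi> \<alpha>) 0) / fact \<beta> = (if \<beta>' = \<beta> then 1 else 0)"
      by (simp add: sum_divide_distrib)
    then have "(\<Sum>\<alpha><\<gamma>. V $$ (\<beta>', \<alpha>) * (vderiv ^^ \<beta>) (\<phi> \<alpha>) 0) = (if \<beta>' = \<beta> then fact \<beta> else 0)"
      by (auto split: if_splits)
    moreover have "(\<Sum>\<alpha><\<gamma>. A \<beta>' \<alpha> * (vderiv ^^ \<beta>) (\<phi> \<alpha>) 0) = (\<Sum>\<alpha><\<gamma>. V $$ (\<beta>', \<alpha>) * (vderiv ^^ \<beta>) (\<phi> \<alpha>) 0) / fact \<beta>'"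
      by (simp add: A_def sum_divide_distrib)
    ultimately show ?thesis by auto
  qed
  show ?thesis
  proof (intro exI[of _ A] allI impI)
    fix t :: "nat \<Rightarrow> complex" and \<beta> assume \<beta>: "\<beta> < \<gamma>"
    have "(\<Sum>\<alpha><\<gamma>. (\<Sum>\<beta>'<\<gamma>. t \<beta>' * A \<beta>' \<alpha>) * (vderiv ^^ \<beta>) (\<phi> \<alpha>) 0)
        = (\<Sum>\<alpha><\<gamma>. \<Sum>\<beta>'<\<gamma>. t \<beta>' * (A \<beta>' \<alpha> * (vderiv ^^ \<beta>) (\<phi> \<alpha>) 0))"
      by (simp add: sum_distrib_right mult.assoc)
    also have "\<dots> = (\<Sum>\<beta>'<\<gamma>. \<Sum>\<alpha><\<gamma>. t \<beta>' * (A \<beta>' \<alpha> * (vderiv ^^ \<beta>) (\<phi> \<alpha>) 0))"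
      by (rule sum.swap)
    also have "\<dots> = (\<Sum>\<beta>'<\<gamma>. t \<beta>' * (\<Sum>\<alpha><\<gamma>. A \<beta>' \<alpha> * (vderiv ^^ \<beta>) (\<phi> \<alpha>) 0))"
      by (simp add: sum_distrib_left)
    also have "\<dots> = (\<Sum>\<beta>'<\<gamma>. if \<beta>' = \<beta> then t \<beta>' else 0)"
      using inv[OF \<beta>] by (intro sum.cong) auto
    also have "\<dots> = t \<beta>" using \<beta> by simp
    finally show "(\<Sum>\<alpha><\<gamma>. (\<Sum>\<beta>'<\<gamma>. t \<beta>' * A \<beta>' \<alpha>) * (vderiv ^^ \<beta>) (\<phi> \<alpha>) 0) = t \<beta>" .
  qed
qed

text \<open>The coefficients interpolating the derivatives of \<open>F\<close> at \<open>u\<close> are bounded in terms of \<open>H\<close> and the \<open>\<phi> \<alpha>\<close>,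
  so the \<open>\<gamma>\<close>-th derivative of the difference is bounded near \<open>u\<close> independently of \<open>u\<close> and of \<open>F\<close>. The lower
  derivatives of the difference vanish at \<open>u\<close>.\<close>

lemma local_approximation:
  fixes \<phi> :: "nat \<Rightarrow> real \<Rightarrow> complex" and H :: "nat \<Rightarrow> real"
  assumes der: "\<And>\<alpha> n x. \<alpha> < \<gamma> \<Longrightarrow> ((vderiv ^^ n) (\<phi> \<alpha>) has_vector_derivative (vderiv ^^ Suc n) (\<phi> \<alpha>) x) (at x)"
    and inv: "invertible_mat (wronskian_mat \<gamma> \<phi> 0)" and \<gamma>: "\<gamma> \<ge> 1"
  shows "\<exists>K\<ge>0. \<forall>F u. (\<forall>l x. (F l has_vector_derivative F (Suc l) x) (at x)) \<longrightarrow> (\<forall>l x. l \<le> \<gamma> \<longrightarrow> norm (F l x) \<le> H l) \<longrightarrow>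
      (\<exists>k. (\<Sum>\<alpha><\<gamma>. k \<alpha> * \<phi> \<alpha> 0) = F 0 u \<and>
          (\<forall>y. \<bar>y - u\<bar> \<le> r \<longrightarrow> norm (F 0 y - (\<Sum>\<alpha><\<gamma>. k \<alpha> * \<phi> \<alpha> (y - u))) \<le> K * \<bar>y - u\<bar> ^ \<gamma>))"
proof -
  obtain A :: "nat \<Rightarrow> nat \<Rightarrow> complex"
    where A: "\<And>t \<beta>. \<beta> < \<gamma> \<Longrightarrow> (\<Sum>\<alpha><\<gamma>. (\<Sum>\<beta>'<\<gamma>. t \<beta>' * A \<beta>' \<alpha>) * (vderiv ^^ \<beta>) (\<phi> \<alpha>) 0) = t \<beta>"
    using jet_interpolation[OF inv] by blast
  have "\<exists>B. \<forall>x\<in>{-r..r}. norm ((vderiv ^^ \<gamma>) (\<phi> \<alpha>) x) \<le> B" if "\<alpha> < \<gamma>" for \<alpha>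
  proof -
    have "continuous_on {-r..r} ((vderiv ^^ \<gamma>) (\<phi> \<alpha>))"
      by (rule continuous_at_imp_continuous_on) (auto intro!: has_vector_derivative_continuous der that)
    then have "bounded ((vderiv ^^ \<gamma>) (\<phi> \<alpha>) ` {-r..r})"
      by (intro compact_imp_bounded compact_continuous_image) auto
    then show ?thesis unfolding bounded_iff by auto
  qed
  then obtain B where B: "\<And>\<alpha> x. \<alpha> < \<gamma> \<Longrightarrow> \<bar>x\<bar> \<le> r \<Longrightarrow> norm ((vderiv ^^ \<gamma>) (\<phi> \<alpha>) x) \<le> B \<alpha>"
    by (metis abs_le_iff atLeastAtMost_iff minus_le_iff)
  define K where "K = H \<gamma> + (\<Sum>\<alpha><\<gamma>. (\<Sum>\<beta><\<gamma>. H \<beta> * norm (A \<beta> \<alpha>)) * B \<alpha>)"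
  show ?thesis
  proof (intro exI[of _ "max K 0"] conjI allI impI)
    fix F :: "nat \<Rightarrow> real \<Rightarrow> complex" and u
    assume "\<forall>l x. (F l has_vector_derivative F (Suc l) x) (at x)" "\<forall>l x. l \<le> \<gamma> \<longrightarrow> norm (F l x) \<le> H l"
    then have F: "\<And>l x. (F l has_vector_derivative F (Suc l) x) (at x)" "\<And>l x. l \<le> \<gamma> \<Longrightarrow> norm (F l x) \<le> H l"
      by blast+
    define k where "k \<alpha> = (\<Sum>\<beta><\<gamma>. F \<beta> u * A \<beta> \<alpha>)" for \<alpha>
    define R where "R l y = F l y - (\<Sum>\<alpha><\<gamma>. k \<alpha> * (vderiv ^^ l) (\<phi> \<alpha>) (y - u))" for l y
    have k: "norm (k \<alpha>) \<le> (\<Sum>\<beta><\<gamma>. H \<beta> * norm (A \<beta> \<alpha>))" for \<alpha>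
      unfolding k_def by (rule sum_norm_le) (auto simp: norm_mult intro!: mult_right_mono F(2))
    have jet: "(\<Sum>\<alpha><\<gamma>. k \<alpha> * (vderiv ^^ \<beta>) (\<phi> \<alpha>) 0) = F \<beta> u" if "\<beta> < \<gamma>" for \<beta>
      unfolding k_def by (rule A[OF that, of "\<lambda>\<beta>. F \<beta> u"])
    have Rder: "(R l has_vector_derivative R (Suc l) y) (at y)" for l y
    proof -
      have "((\<lambda>y. (vderiv ^^ l) (\<phi> \<alpha>) (y - u)) has_vector_derivative (vderiv ^^ Suc l) (\<phi> \<alpha>) (y - u)) (at y)"
        if "\<alpha> < \<gamma>" for \<alpha>
      proof -
        have "((\<lambda>y. y - u) has_vector_derivative 1) (at y)" by (auto intro!: derivative_eq_intros)
        from vector_diff_chain_at[OF this der[OF that]] show ?thesis by (simp add: o_def)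
      qed
      then show ?thesis
        unfolding R_def[abs_def]
        by (intro has_vector_derivative_diff F(1) has_vector_derivative_sum has_vector_derivative_mult_right) auto
    qed
    have Rjet: "R l u = 0" if "l < \<gamma>" for l unfolding R_def using jet[OF that] by simp
    have Rbnd: "norm (R \<gamma> y) \<le> max K 0" if "\<bar>y - u\<bar> \<le> r" for y
    proof -
      have "norm (R \<gamma> y) \<le> norm (F \<gamma> y) + norm (\<Sum>\<alpha><\<gamma>. k \<alpha> * (vderiv ^^ \<gamma>) (\<phi> \<alpha>) (y - u))"
        unfolding R_def by (rule norm_triangle_ineq4)
      also have "\<dots> \<le> K"
        unfolding K_def
      proof (intro add_mono sum_norm_le)
        fix \<alpha> assume "\<alpha> \<in> {..<\<gamma>}"
        then show "norm (k \<alpha> * (vderiv ^^ \<gamma>) (\<phi> \<alpha>) (y - u)) \<le> (\<Sum>\<beta><\<gamma>. H \<beta> * norm (A \<beta> \<alpha>)) * B \<alpha>"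
          unfolding norm_mult by (intro mult_mono[OF k B] that order_trans[OF norm_ge_zero k]) auto
      qed (simp add: F(2))
      finally show ?thesis by simp
    qed
    have "norm (R 0 y) \<le> max K 0 * \<bar>y - u\<bar> ^ \<gamma>" if "\<bar>y - u\<bar> \<le> r" for y
      by (rule vanishing_jet_bound[OF Rder Rjet Rbnd that])
    then show "\<exists>k. (\<Sum>\<alpha><\<gamma>. k \<alpha> * \<phi> \<alpha> 0) = F 0 u \<and>
        (\<forall>y. \<bar>y - u\<bar> \<le> r \<longrightarrow> norm (F 0 y - (\<Sum>\<alpha><\<gamma>. k \<alpha> * \<phi> \<alpha> (y - u))) \<le> max K 0 * \<bar>y - u\<bar> ^ \<gamma>)"
      using jet[of 0] \<gamma> by (intro exI[of _ k]) (auto simp: R_def)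
  qed simp
qed

lemma sobolev_mollify_bounds:
  assumes "f \<in> sobolev_Linf \<gamma>" "continuous_on UNIV f"
  obtains H where "\<And>l. H l \<ge> (0 :: real)"
    "\<And>c l x. c \<ge> 1 \<Longrightarrow> l \<le> \<gamma> \<Longrightarrow> norm (mollify c f l x) \<le> H l"
proof -
  have "\<exists>H\<ge>0. \<forall>c x. c \<ge> 1 \<longrightarrow> norm (mollify c f l x) \<le> H" if "l \<le> \<gamma>" for l
  proof -
    obtain h where h: "h \<in> Linf" "has_weak_deriv l f h"
      using assms(1) \<open>l \<le> \<gamma>\<close> unfolding sobolev_Linf_def by blast
    obtain H where H: "H \<ge> 0" "AE x in lebesgue. norm (h x) \<le> H" by (rule Linf_bounded[OF h(1)])
    have "h \<in> borel_measurable lebesgue" using h(1) by (simp add: Linf_def)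
    then show ?thesis using mollify_bound[OF assms(2) _ h(2) _ H(2)] H(1) by blast
  qed
  then have "\<forall>l. \<exists>H\<ge>0. l \<le> \<gamma> \<longrightarrow> (\<forall>c x. c \<ge> 1 \<longrightarrow> norm (mollify c f l x) \<le> H)"
    by (metis order_refl)
  then obtain H where "\<forall>l. H l \<ge> 0 \<and> (l \<le> \<gamma> \<longrightarrow> (\<forall>c x. c \<ge> 1 \<longrightarrow> norm (mollify c f l x) \<le> H l))"
    by metis
  then show ?thesis using that by blast
qed

text \<open>The mollifications are Lipschitz with one constant, which their pointwise limit inherits. This
  accounts for moving the sampling points by half a grid step when \<open>\<gamma> = 1\<close>.\<close>

lemma sobolev_Lipschitz:
  assumes f: "continuous_on UNIV f" and H: "\<And>c x. c \<ge> 1 \<Longrightarrow> norm (mollify c f 1 x) \<le> H"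
  shows "norm (f y - f x) \<le> H * \<bar>y - x\<bar>"
proof -
  have "norm (mollify c f 0 y - mollify c f 0 x) \<le> H * \<bar>y - x\<bar>" if c: "c \<ge> 1" for c
  proof -
    define R where "R l z = mollify c f l z - (if l = 0 then mollify c f 0 x else 0)" for l z
    have Rder: "(R l has_vector_derivative R (Suc l) z) (at z)" for l z
    proof -
      have "((\<lambda>z. mollify c f l z - (if l = 0 then mollify c f 0 x else 0))
          has_vector_derivative mollify c f (Suc l) z - 0) (at z)"
        by (intro has_vector_derivative_diff mollify_has_derivative[OF f c] has_vector_derivative_const)
      then show ?thesis by (simp add: R_def[abs_def])
    qed
    have Rbound: "norm (R 1 z) \<le> H" for z using H[OF c] by (simp add: R_def)
    have "R l x = 0" if "l < 1" for l using that by (simp add: R_def)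
    then have "norm (R 0 y) \<le> H * \<bar>y - x\<bar> ^ 1"
      by (rule vanishing_jet_bound[OF Rder _ Rbound order_refl])
    then show ?thesis by (simp add: R_def)
  qed
  then have "\<And>n. norm (mollify (real (Suc n)) f 0 y - mollify (real (Suc n)) f 0 x) \<le> H * \<bar>y - x\<bar>" by simp
  moreover have "(\<lambda>n. norm (mollify (real (Suc n)) f 0 y - mollify (real (Suc n)) f 0 x)) \<longlonglongrightarrow> norm (f y - f x)"
    by (intro tendsto_intros mollify_tendsto f)
  ultimately show ?thesis by (intro LIMSEQ_le_const2) auto
qed

lemma Linf_norm_le:
  assumes "g \<in> borel_measurable lebesgue" "\<And>x. norm (g x) \<le> c"
  shows "Linf_norm g \<le> ereal c"
  unfolding Linf_norm_def
proof (rule esssup_I)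
  show "(\<lambda>x. ereal (norm (g x))) \<in> borel_measurable lebesgue" using assms(1) by measurable
qed (use assms(2) in auto)

section \<open>The approximation order\<close>

context supported_masks
begin

lemma limit_from_level_window:
  assumes "is_subdiv_limit a m unit_seq (basic_limit a m)"
  shows "limit_from_level a m v u
    = (\<Sum>j\<in>window 0 \<lfloor>2 ^ m * u\<rfloor>. basic_limit a m (2 ^ m * u - real_of_int j) *\<^sub>R v j)"
  by (rule limit_from_level_eq_sum[OF assms]) (auto simp: window_def, linarith+)

text \<open>At each point the symmetric partial sums, which are continuous, are eventually constant.\<close>

lemma limit_from_level_measurable:
  fixes v :: "int \<Rightarrow> complex"
  assumes \<phi>: "is_subdiv_limit a m unit_seq (basic_limit a m)"
  shows "limit_from_level a m v \<in> borel_measurable lebesgue"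
proof -
  have cb: "continuous_on UNIV (basic_limit a m)" using \<phi> by (simp add: is_subdiv_limit_def)
  then have c: "continuous_on UNIV (\<lambda>u. \<Sum>j\<in>{- int n..int n}. basic_limit a m (2 ^ m * u - real_of_int j) *\<^sub>R v j)" for n
    by (intro continuous_intros continuous_on_compose2[OF cb]) auto
  have "limit_from_level a m v \<in> borel_measurable borel"
  proof (rule borel_measurable_LIMSEQ_metric)
    show "(\<lambda>u. \<Sum>j\<in>{- int n..int n}. basic_limit a m (2 ^ m * u - real_of_int j) *\<^sub>R v j) \<in> borel_measurable borel" for n
      by (rule borel_measurable_continuous_onI[OF c])
    fix u :: real
    show "(\<lambda>n. \<Sum>j\<in>{- int n..int n}. basic_limit a m (2 ^ m * u - real_of_int j) *\<^sub>R v j) \<longlonglongrightarrow> limit_from_level a m v u"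
    proof (rule tendsto_eventually)
      obtain n0 where n0: "\<bar>2 ^ m * u\<bar> + real M < real n0" using reals_Archimedean2 by blast
      have "limit_from_level a m v u = (\<Sum>j\<in>{- int n..int n}. basic_limit a m (2 ^ m * u - real_of_int j) *\<^sub>R v j)"
        if "n \<ge> n0" for n
      proof (rule limit_from_level_eq_sum[OF \<phi>])
        fix j assume "\<bar>2 ^ m * u - real_of_int j\<bar> \<le> real M"
        then have "\<bar>real_of_int j\<bar> \<le> real n" using n0 that by linarith
        then show "j \<in> {- int n..int n}" by auto
      qed simp
      then show "\<forall>\<^sub>F n in sequentially. (\<Sum>j\<in>{- int n..int n}. basic_limit a m (2 ^ m * u - real_of_int j) *\<^sub>R v j) = limit_from_level a m v u"
        unfolding eventually_sequentially by metis
    qed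
  qed
  then show ?thesis by (intro measurable_completion) simp
qed

lemma limit_from_level_bound:
  fixes v :: "int \<Rightarrow> complex"
  assumes \<phi>: "is_subdiv_limit a m unit_seq (basic_limit a m)" "\<And>x. \<bar>basic_limit a m x\<bar> \<le> B"
    and v: "\<And>j. \<bar>real_of_int j - 2 ^ m * u\<bar> \<le> real M + 2 \<Longrightarrow> norm (v j) \<le> D"
  shows "norm (limit_from_level a m v u) \<le> real (2 * M + 3) * (B * D)"
proof -
  have "norm (\<Sum>j\<in>window 0 \<lfloor>2 ^ m * u\<rfloor>. basic_limit a m (2 ^ m * u - real_of_int j) *\<^sub>R v j)
      \<le> of_nat (card (window 0 \<lfloor>2 ^ m * u\<rfloor>)) * (B * D)"
  proof (rule sum_norm_bound)
    fix j assume "j \<in> window 0 \<lfloor>2 ^ m * u\<rfloor>"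
    then have "\<bar>real_of_int j - 2 ^ m * u\<bar> \<le> real M + 2" by (simp add: window_def) linarith
    then have "norm (v j) \<le> D" by (rule v)
    then show "norm (basic_limit a m (2 ^ m * u - real_of_int j) *\<^sub>R v j) \<le> B * D"
      using \<phi>(2) order_trans[OF abs_ge_zero \<phi>(2)] by (simp add: mult_mono)
  qed
  then show ?thesis unfolding limit_from_level_window[OF \<phi>(1)] by simp
qed

lemma limit_from_level_diff:
  fixes v w :: "int \<Rightarrow> complex"
  assumes "is_subdiv_limit a m unit_seq (basic_limit a m)"
  shows "limit_from_level a m v u - limit_from_level a m w u = limit_from_level a m (\<lambda>j. v j - w j) u"
  unfolding limit_from_level_window[OF assms] by (simp add: scaleR_diff_right sum_subtractf)

lemma limit_from_level_tendsto:
  fixes v :: "nat \<Rightarrow> int \<Rightarrow> complex"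
  assumes "is_subdiv_limit a m unit_seq (basic_limit a m)" "\<And>j. (\<lambda>n. v n j) \<longlonglongrightarrow> w j"
  shows "(\<lambda>n. limit_from_level a m (v n) u) \<longlonglongrightarrow> limit_from_level a m w u"
  unfolding limit_from_level_window[OF assms(1)] by (intro tendsto_intros assms(2))

text \<open>For a mollification \<open>F\<close> of \<open>f\<close>, the error at \<open>u\<close> is the limit function of the samples of \<open>F - q\<close>, where the
  exponential polynomial \<open>q\<close> agrees with \<open>F\<close> at \<open>u\<close> up to order \<open>\<gamma>\<close>. The estimate is uniform in the width
  of the mollifier, which then tends to \<open>0\<close>.\<close>

lemma approximation_order:
  fixes \<phi> :: "nat \<Rightarrow> real \<Rightarrow> complex"
  assumes lim: "\<And>m. is_subdiv_limit a m unit_seq (basic_limit a m)" "\<And>m x. \<bar>basic_limit a m x\<bar> \<le> B"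
    and repr: "\<And>g m. g \<in> \<Phi> \<Longrightarrow> is_local_subdiv_limit a m (\<lambda>i. g (grid \<nu> m i)) (\<lambda>x. g (x / 2 ^ m))"
    and der: "\<And>\<alpha> n x. \<alpha> < \<gamma> \<Longrightarrow> ((vderiv ^^ n) (\<phi> \<alpha>) has_vector_derivative (vderiv ^^ Suc n) (\<phi> \<alpha>) x) (at x)"
    and trans: "\<And>k u. (\<lambda>y. \<Sum>\<alpha><\<gamma>. k \<alpha> * \<phi> \<alpha> (y - u)) \<in> \<Phi>"
    and inv: "invertible_mat (wronskian_mat \<gamma> \<phi> 0)" and \<gamma>: "\<gamma> \<ge> 1" and \<nu>: "\<nu> \<le> 1"
    and f: "continuous_on UNIV f"
    and H: "\<And>c l x. c \<ge> 1 \<Longrightarrow> l \<le> \<gamma> \<Longrightarrow> norm (mollify c f l x) \<le> H l"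
  obtains C where "C \<ge> 0"
    "\<And>m u. norm (limit_from_level a m (\<lambda>i. f (grid \<nu> m i)) u - f u) \<le> C * (1 / 2 ^ m) ^ \<gamma>"
proof -
  \<comment> \<open>A window reaches at most \<open>M + 2\<close> grid steps away from \<open>u\<close>; the parametrization shifts the grid by
    at most half a step more.\<close>
  define r where "r = real M + 3"
  obtain K where K: "K \<ge> 0" and approx: "\<And>F u. \<forall>l x. (F l has_vector_derivative F (Suc l) x) (at x) \<Longrightarrow>
      \<forall>l x. l \<le> \<gamma> \<longrightarrow> norm (F l x) \<le> H l \<Longrightarrow>
      \<exists>k. (\<Sum>\<alpha><\<gamma>. k \<alpha> * \<phi> \<alpha> 0) = F 0 u \<and>
          (\<forall>y. \<bar>y - u\<bar> \<le> r \<longrightarrow> norm (F 0 y - (\<Sum>\<alpha><\<gamma>. k \<alpha> * \<phi> \<alpha> (y - u))) \<le> K * \<bar>y - u\<bar> ^ \<gamma>)"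
    using local_approximation[OF der inv \<gamma>, of H r] by blast
  define C where "C = real (2 * M + 3) * (B * (K * r ^ \<gamma>))"
  have B: "B \<ge> 0" using order_trans[OF abs_ge_zero lim(2)] .
  have C: "C \<ge> 0" using K B by (simp add: C_def r_def)
  have moll: "norm (limit_from_level a m (\<lambda>i. mollify c f 0 (grid \<nu> m i)) u - mollify c f 0 u) \<le> C * (1 / 2 ^ m) ^ \<gamma>"
    if c: "c \<ge> 1" for c m u
  proof -
    let ?F = "mollify c f 0"
    obtain k where k0: "(\<Sum>\<alpha><\<gamma>. k \<alpha> * \<phi> \<alpha> 0) = ?F u"
      and k: "\<And>y. \<bar>y - u\<bar> \<le> r \<Longrightarrow> norm (?F y - (\<Sum>\<alpha><\<gamma>. k \<alpha> * \<phi> \<alpha> (y - u))) \<le> K * \<bar>y - u\<bar> ^ \<gamma>"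
      using approx[of "mollify c f" u] mollify_has_derivative[OF f c] H[OF c] by blast
    define q where "q y = (\<Sum>\<alpha><\<gamma>. k \<alpha> * \<phi> \<alpha> (y - u))" for y
    have "q \<in> \<Phi>" unfolding q_def[abs_def] by (rule trans)
    from limit_from_level_reproduces[OF lim(1) repr[OF this]]
    have "limit_from_level a m (\<lambda>i. q (grid \<nu> m i)) u = q u" by simp
    also have "q u = ?F u" using k0 by (simp add: q_def)
    finally have "limit_from_level a m (\<lambda>i. ?F (grid \<nu> m i)) u - ?F u
        = limit_from_level a m (\<lambda>i. ?F (grid \<nu> m i) - q (grid \<nu> m i)) u"
      using limit_from_level_diff[OF lim(1), of m "\<lambda>i. ?F (grid \<nu> m i)" u "\<lambda>i. q (grid \<nu> m i)"] by simp
    also have "norm \<dots> \<le> real (2 * M + 3) * (B * (K * (r / 2 ^ m) ^ \<gamma>))"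
    proof (rule limit_from_level_bound[OF lim])
      fix j assume j: "\<bar>real_of_int j - 2 ^ m * u\<bar> \<le> real M + 2"
      have "grid \<nu> m j - u = (real_of_int j - 2 ^ m * u - real \<nu> / 2) / 2 ^ m" by (simp add: grid_def field_simps)
      moreover have "\<bar>real_of_int j - 2 ^ m * u - real \<nu> / 2\<bar> \<le> r" using j \<nu> by (simp add: r_def)
      ultimately have g: "\<bar>grid \<nu> m j - u\<bar> \<le> r / 2 ^ m" by (simp add: abs_divide divide_right_mono)
      also have "r / 2 ^ m \<le> r"
        using one_le_power[of "2::real" m] by (simp add: r_def divide_le_eq mult_le_cancel_left1)
      finally have "norm (?F (grid \<nu> m j) - q (grid \<nu> m j)) \<le> K * \<bar>grid \<nu> m j - u\<bar> ^ \<gamma>"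
        unfolding q_def by (rule k)
      also have "\<dots> \<le> K * (r / 2 ^ m) ^ \<gamma>" using g K by (intro mult_left_mono power_mono) auto
      finally show "norm (?F (grid \<nu> m j) - q (grid \<nu> m j)) \<le> K * (r / 2 ^ m) ^ \<gamma>" .
    qed
    also have "\<dots> = C * (1 / 2 ^ m) ^ \<gamma>" by (simp add: C_def power_divide)
    finally show ?thesis .
  qed
  show ?thesis
  proof (rule that[OF C])
    fix m u
    let ?e = "\<lambda>n. norm (limit_from_level a m (\<lambda>i. mollify (real (Suc n)) f 0 (grid \<nu> m i)) u - mollify (real (Suc n)) f 0 u)"
    have "?e \<longlonglongrightarrow> norm (limit_from_level a m (\<lambda>i. f (grid \<nu> m i)) u - f u)"
      by (intro tendsto_intros limit_from_level_tendsto lim mollify_tendsto f)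
    moreover have "?e n \<le> C * (1 / 2 ^ m) ^ \<gamma>" for n by (rule moll) simp
    ultimately show "norm (limit_from_level a m (\<lambda>i. f (grid \<nu> m i)) u - f u) \<le> C * (1 / 2 ^ m) ^ \<gamma>"
      by (intro LIMSEQ_le_const2) auto
  qed
qed

end

theorem theorem21:
  fixes a :: "nat \<Rightarrow> int \<Rightarrow> real" and b :: "int \<Rightarrow> real"
    and M \<eta> N \<nu> \<gamma> :: nat
    and lam :: "nat \<Rightarrow> complex" and \<mu> :: "nat \<Rightarrow> nat"
    and \<phi> :: "nat \<Rightarrow> real \<Rightarrow> complex"
    and f :: "real \<Rightarrow> complex"
  assumes "\<And>k. mask_supported M (a k)" and "mask_supported M b"
    and "inj_on lam {1..\<eta>}" and "\<And>n. n \<in> {1..\<eta>} \<Longrightarrow> \<mu> n \<ge> 1" and "(\<Sum>n=1..\<eta>. \<mu> n) = N"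
    and "bij_betw \<phi> {..<N} (exp_monomials \<eta> lam \<mu>)"
    and "\<nu> \<in> {0, 1}"
    and "reproducing \<nu> a (exp_poly_space \<eta> lam \<mu>)"
    and "convergent_scheme (\<lambda>_. b)" and "asymptotically_similar a b"
    and "1 \<le> \<gamma>" and "\<gamma> \<le> N"
    and "invertible_mat (wronskian_mat \<gamma> \<phi> 0)"
    and "f \<in> sobolev_Linf \<gamma>" and "continuous_on UNIV f"
  shows "\<exists>C>0. \<forall>m.
    (\<nu> = 0 \<or> \<gamma> = 1 \<longrightarrow>
       Linf_norm (\<lambda>u. limit_from_level a m (\<lambda>i. f (2 powr (- real m) * real_of_int i)) u - f u)
         \<le> ereal (C * 2 powr (- real (\<gamma> * m)))) \<and>
    Linf_norm (\<lambda>u. limit_from_level a m (\<lambda>i. f (grid \<nu> m i)) u - f u)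
      \<le> ereal (C * 2 powr (- real (\<gamma> * m)))"
proof -
  let ?\<Phi> = "exp_poly_space \<eta> lam \<mu>"
  have \<nu>: "\<nu> \<le> 1" using assms(7) by auto
  have repr: "is_local_subdiv_limit a m (\<lambda>i. g (grid \<nu> m i)) (\<lambda>x. g (x / 2 ^ m))" if "g \<in> ?\<Phi>" for g m
    using assms(8) that unfolding reproducing_def by blast
  define l where "l = lam 1"
  have "\<eta> \<ge> 1"
  proof (rule ccontr)
    assume "\<not> \<eta> \<ge> 1"
    then have "N = 0" using assms(5) by simp
    then show False using assms(11,12) by simp
  qed
  then have "exp_monomial l 0 \<in> ?\<Phi>"
    unfolding l_def using assms(4)[of 1] by (intro exp_monomial_in_space) auto
  then have repr_exp: "is_local_subdiv_limit a m (\<lambda>i. exp (l * of_real (grid \<nu> m i))) (\<lambda>x. exp (l * of_real (x / 2 ^ m)))" for m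
    using repr[of "exp_monomial l 0" m] by (simp add: exp_monomial_def)

  interpret supported_masks a M by unfold_locales (rule assms(1))
  interpret sb: supported_masks "\<lambda>_. b" M by unfold_locales (rule assms(2))
  have mask_lim: "(\<lambda>k. a k i) \<longlonglongrightarrow> b i" for i
    by (rule asymptotically_similar_mask_lim[OF assms(10)])
  have "bounded (range unit_seq)"
    unfolding bounded_iff by (intro exI[of _ 1]) (auto simp: unit_seq_def)
  then obtain g where g: "is_subdiv_limit (\<lambda>_. b) 0 unit_seq g"
    using assms(9) unfolding convergent_scheme_def by blast
  interpret perturbed_scheme a M b
  proof
    show "mask_supported M b" by (rule assms(2))
    show "(\<lambda>k. a k i) \<longlonglongrightarrow> b i" for i by (rule mask_lim)
    show "subdiv b (\<lambda>_. 1 :: real) = (\<lambda>_. 1)"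
      by (rule limit_mask_preserves_one[OF assms(2) mask_lim repr_exp[of 0]]) simp
    show "\<exists>n0. \<forall>n\<ge>n0. \<forall>i i'. \<bar>i' - i\<bar> \<le> int M + 1 \<longrightarrow>
        \<bar>kernel (\<lambda>_. b) 0 n i' - kernel (\<lambda>_. b) 0 n i\<bar> \<le> \<omega>" if "\<omega> > 0" for \<omega>
      by (rule sb.kernel_smooth_if_limit[OF g that])
  qed
  obtain B where lim: "\<And>m. is_subdiv_limit a m unit_seq (basic_limit a m)" "\<And>m x. \<bar>basic_limit a m x\<bar> \<le> B"
    using uniform_basic_limits[OF repr_exp \<nu>] by blast
  have B: "B \<ge> 0" using order_trans[OF abs_ge_zero lim(2)] .

  have \<phi>: "\<phi> \<alpha> \<in> exp_monomials \<eta> lam \<mu>" if "\<alpha> < \<gamma>" for \<alpha>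
    using bij_betwE[OF assms(6)] that assms(12) by auto
  have der: "((vderiv ^^ n) (\<phi> \<alpha>) has_vector_derivative (vderiv ^^ Suc n) (\<phi> \<alpha>) x) (at x)" if \<alpha>: "\<alpha> < \<gamma>" for \<alpha> n x
  proof -
    obtain l \<beta> where "\<phi> \<alpha> = exp_monomial l \<beta>" using \<phi>[OF \<alpha>] unfolding exp_monomials_def by blast
    then show ?thesis using exp_monomial_derivative by metis
  qed
  have trans: "(\<lambda>y. \<Sum>\<alpha><\<gamma>. k \<alpha> * \<phi> \<alpha> (y - u)) \<in> ?\<Phi>" for k u
    by (rule exp_poly_space_sum) (auto intro: exp_monomial_translate \<phi>)
  obtain H where H: "\<And>l. H l \<ge> 0" "\<And>c l x. c \<ge> 1 \<Longrightarrow> l \<le> \<gamma> \<Longrightarrow> norm (mollify c f l x) \<le> H l"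
    by (rule sobolev_mollify_bounds[OF assms(14,15)]) blast
  obtain C0 where C0: "C0 \<ge> 0"
    and err: "\<And>m u. norm (limit_from_level a m (\<lambda>i. f (grid \<nu> m i)) u - f u) \<le> C0 * (1 / 2 ^ m) ^ \<gamma>"
    by (rule approximation_order[OF lim repr der trans assms(13,11) \<nu> assms(15) H(2)]) blast+
  define C1 where "C1 = real (2 * M + 3) * (B * H 1)"
  define C where "C = C0 + C1 + 1"
  have C1: "C1 \<ge> 0" unfolding C1_def using B H(1)[of 1] by simp
  have C: "C > 0" "C0 \<le> C" "C0 + C1 \<le> C" using C0 C1 by (simp_all add: C_def)
  have pow: "(1 / 2 ^ m) ^ \<gamma> = (2 :: real) powr (- real (\<gamma> * m))" for m
    by (simp add: power_divide power_mult[symmetric] powr_minus_divide powr_realpow[symmetric] powr_powr mult.commute)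
  have pt: "2 powr (- real m) * real_of_int i = real_of_int i / 2 ^ m" for m i
    by (simp add: powr_minus_divide powr_realpow)
  have Linf: "Linf_norm (\<lambda>u. limit_from_level a m v u - f u) \<le> ereal (C * 2 powr (- real (\<gamma> * m)))"
    if "\<And>u. norm (limit_from_level a m v u - f u) \<le> C * (1 / 2 ^ m) ^ \<gamma>" for m v
    unfolding pow[symmetric]
  proof (rule Linf_norm_le[OF _ that])
    have "f \<in> borel_measurable lebesgue"
      using assms(15) by (intro measurable_completion) (simp add: borel_measurable_continuous_onI)
    then show "(\<lambda>u. limit_from_level a m v u - f u) \<in> borel_measurable lebesgue"
      using limit_from_level_measurable[OF lim(1)] by (intro borel_measurable_diff)
  qed
  have err_C: "norm (limit_from_level a m (\<lambda>i. f (grid \<nu> m i)) u - f u) \<le> C * (1 / 2 ^ m) ^ \<gamma>" for m u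
    by (rule order_trans[OF err mult_right_mono[OF C(2)]]) simp
  have shifted: "norm (limit_from_level a m (\<lambda>i. f (real_of_int i / 2 ^ m)) u - f u) \<le> C * (1 / 2 ^ m) ^ \<gamma>"
    if "\<nu> = 0 \<or> \<gamma> = 1" for m u
  proof (cases "\<nu> = 0")
    case True
    then show ?thesis using err_C[of m u] by (simp add: grid_def)
  next
    case False
    then have \<gamma>: "\<gamma> = 1" using that by simp
    let ?v = "\<lambda>i. f (real_of_int i / 2 ^ m)" and ?w = "\<lambda>i. f (grid \<nu> m i)"
    have "norm (?v i - ?w i) \<le> H 1 * (1 / 2 ^ m)" for i
    proof -
      have "norm (?v i - ?w i) \<le> H 1 * \<bar>real_of_int i / 2 ^ m - grid \<nu> m i\<bar>"
        by (rule sobolev_Lipschitz[OF assms(15)]) (use H(2) \<gamma> in auto)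
      also have "\<bar>real_of_int i / 2 ^ m - grid \<nu> m i\<bar> = real \<nu> / 2 / 2 ^ m"
        by (simp add: grid_def diff_divide_distrib)
      also have "H 1 * (real \<nu> / 2 / 2 ^ m) \<le> H 1 * (1 / 2 ^ m)"
        using \<nu> H(1) by (intro mult_left_mono divide_right_mono) auto
      finally show ?thesis .
    qed
    then have "norm (limit_from_level a m (\<lambda>i. ?v i - ?w i) u) \<le> real (2 * M + 3) * (B * (H 1 * (1 / 2 ^ m)))"
      by (intro limit_from_level_bound lim)
    then have "norm (limit_from_level a m ?v u - limit_from_level a m ?w u) \<le> C1 * (1 / 2 ^ m)"
      unfolding limit_from_level_diff[OF lim(1)] C1_def by (simp add: mult.assoc)
    moreover have "norm (limit_from_level a m ?v u - f u)
        \<le> norm (limit_from_level a m ?v u - limit_from_level a m ?w u) + norm (limit_from_level a m ?w u - f u)"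
      using norm_triangle_ineq[of "limit_from_level a m ?v u - limit_from_level a m ?w u"
          "limit_from_level a m ?w u - f u"] by simp
    ultimately have "norm (limit_from_level a m ?v u - f u) \<le> (C0 + C1) * (1 / 2 ^ m)"
      using err[of m u] \<gamma> by (simp add: add_divide_distrib)
    also have "\<dots> \<le> C * (1 / 2 ^ m)" using C(3) by (rule mult_right_mono) simp
    finally show ?thesis using \<gamma> by simp
  qed
  show ?thesis
    using C(1) Linf[OF err_C] Linf[OF shifted] unfolding pt by blast
qed

end
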